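(* Fix $\omega\neq0$ and set $\gamma(x):=\sum_{z\in\mathcal Z}r(x,x+z)\,z$. Then $$\partial_{\lambda=0}V_\lambda(t)=\Re\big(e^{i\omega t}\sigma(\omega)v\big),$$ where the complex mobility matrix $\sigma(\omega)=(\sigma_{j,k}(\omega))$ is the $d\times d$ matrix with complex entries given by $$\sigma_{j,k}(\omega)=\sum_{z\in\mathcal Z}\pi[r(\cdot,\cdot+z)]z_jz_k+\langle\gamma_j,(i\omega-\mathcal L^* )^{-1}\Psi_k\rangle=\sum_{z\in\mathcal Z}\pi[r(\cdot,\cdot+z)]z_jz_k+\int_0^{+\infty}\langle\gamma_j,e^{-(i\omega-\mathcal L^* )s}\Psi_k\rangle\,ds .$$ For the reversible random walk (i.e. $r^*(x,y)=r(x,y)$ for all $x,y$) it holds $\Psi(x)=-2\gamma(x)$ and $\mathcal L^*=\mathcal L$, thus implying that $\sigma(\omega)$ is symmetric and $$\sigma_{j,k}(\omega)=\sum_{z\in\mathcal Z}\pi[r(\cdot,\cdot+z)]z_jz_k-2\langle\gamma_j,(i\omega-\mathcal L)^{-1}\gamma_k\rangle=\sum_{z\in\mathcal Z}\pi[r(\cdot,\cdot+z)]z_jz_k-2\int_0^{+\infty}\langle\gamma_j,e^{-(i\omega-\mathcal L)s}\gamma_k\rangle\,ds .$$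
   Context: Let $N\ge1$ be an integer, $\mathbb T^d_N:=\mathbb Z^d/N\mathbb Z^d$, and let $\mathcal Z\subset\mathbb Z^d$ be a finite set such that the canonical projection $\mathrm{pr}:\mathbb Z^d\to\mathbb T^d_N$ is injective when restricted to $\mathcal Z$. For $x\in\mathbb T^d_N$ and $z\in\mathcal Z$, $x+z$ means $x+\mathrm{pr}(z)$ in the quotient group $\mathbb T^d_N$. The unperturbed process $(X_t)_{t\ge0}$ is an irreducible continuous-time Markov chain (random walk) on $\mathbb T^d_N$ with jump rates $r(x,y)$ (with $r(x,x)=0$), such that $r(x,y)=0$ if $y\notin\{x+z:z\in\mathcal Z\}$; $\pi$ is its unique invariant distribution, $\pi[f]:=\sum_x\pi(x)f(x)$ (so $\pi[r(\cdot,\cdot+z)]=\sum_x\pi(x)r(x,x+z)$), and $r^*(x,y):=\pi(y)r(y,x)/\pi(x)$ are the time-reversed jump rates. Fix a unit vector $v\in\mathbb R^d$ and $\omega\in\mathbb R\setminus\{0\}$. Given $\lambda>0$, the perturbed process $(X^\lambda_t)_{t\ge0}$ has at time $t$ jump rates $r^\lambda_t(x,y):=\exp\{\lambda\cos(\omega t)\,(z\cdot v)\}\,r(x,x+z)$ if $y=x+z$ for some (necessarily unique) $z\in\mathcal Z$, and $r^\lambda_t(x,y):=0$ otherwise, where $\cdot$ is the Euclidean scalar product. Let $T$ be the period of $\cos(\omega t)$. Then $\pi_\lambda$ denotes the unique invariant distribution of the discrete-time chain $(X^\lambda_{nT})_{n\ge0}$, and $\mathbb E_{\pi_\lambda}$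 is expectation when $X^\lambda_0$ has distribution $\pi_\lambda$ (oscillatory steady state). The lifted random walk $(Y^\lambda_t)_{t\ge0}$ on $\mathbb Z^d$ satisfies $\mathrm{pr}(Y^\lambda_t)=X^\lambda_t$ and makes a jump $z$ whenever $X^\lambda$ jumps from $x$ to $x+z$ for some $z\in\mathcal Z$; $Y^\lambda_0$ is any point in $\mathrm{pr}^{-1}(X^\lambda_0)$. The mean instantaneous velocity is $$V_\lambda(t):=\frac{d}{dt}\mathbb E_{\pi_\lambda}[Y^\lambda_t]=\sum_{z\in\mathcal Z}\mathbb E_{\pi_\lambda}\big[r^\lambda_t(X^\lambda_t,X^\lambda_t+z)\big]\,z .$$ The value $\lambda=0$ corresponds to the unperturbed process. $L^2(\pi)$ is the complex Hilbert space of functions on $\mathbb T^d_N$ with scalar product $\langle f,h\rangle=\sum_x\pi(x)\overline{f(x)}h(x)$. The Markov generator of $(X_t)_{t\ge0}$ is $\mathcal Lf(x)=\sum_yr(x,y)[f(y)-f(x)]$ and its adjoint in $L^2(\pi)$ is $\mathcal L^*f(x)=\sum_yr^*(x,y)[f(y)-f(x)]$. The operator $i\omega-\mathcal L^*$ is invertible on $L^2(\pi)$. The function $\Psi:\mathbb T^d_N\to\mathbb R^d$ is $$\Psi(x):=-\sum_{z\in\mathcal Z}\big(r^*(x,x+z)+r(x,x+z)\big)z .$$ $\gamma_j,\Psi_j,z_j$ are the $j$-th coordinates of $\gamma,\Psi,z$. $\Re$ denotes real part (componentwise) and $\partial_{\lambda=0}$ is the derivative in $\lambda$ at $\lambda=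0$.
   Formalization: The jump set 𝒵 is additionally assumed symmetric (z∈𝒵 implies −z∈𝒵); without this the formula with the given Ψ fails, e.g. d=1, N=3, 𝒵={1}, r(x,x+1)=1, where the true mobility is 1 but the formula gives 1+i/ω. *)

theory Defs
  imports
    "HOL-Probability.Probability"
    "Berlekamp_Zassenhaus.Finite_Field"
begin

section \<open>The discrete torus\<close>

text \<open>\<open>'n mod_ring\<close> is the ring of integers modulo \<open>CARD('n)\<close>; hence \<open>'n mod_ring ^ 'd\<close> is the
  group \<open>\<int>\<^sup>d / N\<int>\<^sup>d\<close>, where \<open>d = CARD('d)\<close> and \<open>N = CARD('n)\<close> is an arbitrary integer at least 1.\<close>

type_synonym ('n, 'd) torus = "'n mod_ring ^ 'd"

definition pr :: "int ^ 'd \<Rightarrow> ('n::finite, 'd::finite) torus" where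
  "pr z = (\<chi> i. of_int_mod_ring (z $ i))"

definition real_vec :: "int ^ 'd \<Rightarrow> real ^ 'd::finite" where
  "real_vec z = (\<chi> i. real_of_int (z $ i))"

section \<open>Jump rates on a finite state space\<close>

definition irreducible_rates :: "('s \<Rightarrow> 's \<Rightarrow> real) \<Rightarrow> bool" where
  "irreducible_rates r \<longleftrightarrow> (\<forall>x y. (x, y) \<in> {(a, b). r a b > 0}\<^sup>*)"

definition distribution :: "('s::finite \<Rightarrow> real) \<Rightarrow> bool" where
  "distribution p \<longleftrightarrow> (\<forall>x. 0 \<le> p x) \<and> (\<Sum>x\<in>UNIV. p x) = 1"

definition invariant_distribution :: "('s::finite \<Rightarrow> 's \<Rightarrow> real) \<Rightarrow> ('s \<Rightarrow> real) \<Rightarrow> bool" where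
  "invariant_distribution r p \<longleftrightarrow> distribution p \<and>
     (\<forall>y. (\<Sum>x\<in>UNIV. p x * r x y) = p y * (\<Sum>x\<in>UNIV. r y x))"

definition time_reversal :: "('s \<Rightarrow> real) \<Rightarrow> ('s \<Rightarrow> 's \<Rightarrow> real) \<Rightarrow> 's \<Rightarrow> 's \<Rightarrow> real" where
  "time_reversal p r x y = p y * r y x / p x"

definition generator :: "('s::finite \<Rightarrow> 's \<Rightarrow> real) \<Rightarrow> ('s \<Rightarrow> complex) \<Rightarrow> 's \<Rightarrow> complex" where
  "generator r f x = (\<Sum>y\<in>UNIV. complex_of_real (r x y) * (f y - f x))"

definition l2_inner :: "('s::finite \<Rightarrow> real) \<Rightarrow> ('s \<Rightarrow> complex) \<Rightarrow> ('s \<Rightarrow> complex) \<Rightarrow> complex" where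
  "l2_inner p f h = (\<Sum>x\<in>UNIV. complex_of_real (p x) * cnj (f x) * h x)"

text \<open>The operators \<open>i\<omega> - A\<close> and \<open>e\<^sup>A\<close> for an operator \<open>A\<close> on complex functions on the state
  space; the exponential series is evaluated pointwise.\<close>

definition shifted :: "real \<Rightarrow> (('s \<Rightarrow> complex) \<Rightarrow> 's \<Rightarrow> complex) \<Rightarrow> ('s \<Rightarrow> complex) \<Rightarrow> 's \<Rightarrow> complex" where
  "shifted \<omega> A f x = \<i> * complex_of_real \<omega> * f x - A f x"

definition op_exp :: "(('s \<Rightarrow> complex) \<Rightarrow> 's \<Rightarrow> complex) \<Rightarrow> ('s \<Rightarrow> complex) \<Rightarrow> 's \<Rightarrow> complex" where
  "op_exp A f x = (\<Sum>m. (A ^^ m) f x / of_nat (fact m))"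

section \<open>Time-inhomogeneous Markov chains\<close>

text \<open>\<open>P s t x y\<close> is the probability to be in \<open>y\<close> at time \<open>t\<close> given that the chain is in \<open>x\<close> at
  time \<open>s \<le> t\<close>; it is determined by the Kolmogorov forward equation with rates \<open>q t x y\<close>.\<close>

definition transition_function ::
    "(real \<Rightarrow> 's::finite \<Rightarrow> 's \<Rightarrow> real) \<Rightarrow> (real \<Rightarrow> real \<Rightarrow> 's \<Rightarrow> 's \<Rightarrow> real) \<Rightarrow> bool" where
  "transition_function q P \<longleftrightarrow>
     (\<forall>s\<ge>0. \<forall>x y. P s s x y = (if x = y then 1 else 0)) \<and>
     (\<forall>s\<ge>0. \<forall>t\<ge>s. \<forall>x y.
        ((\<lambda>u. P s u x y) has_real_derivative
           ((\<Sum>w\<in>UNIV. P s t x w * q t w y) - P s t x y * (\<Sum>w\<in>UNIV. q t y w)))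
          (at t within {s..}))"

text \<open>Right-continuous paths with left limits, for the discrete topology on the state space.\<close>

definition step_path :: "(real \<Rightarrow> 's) \<Rightarrow> bool" where
  "step_path f \<longleftrightarrow>
     (\<forall>t\<ge>0. \<forall>\<^sub>F s in at_right t. f s = f t) \<and>
     (\<forall>t>0. \<exists>a. \<forall>\<^sub>F s in at_left t. f s = a)"

definition markov_chain ::
    "'w measure \<Rightarrow> (real \<Rightarrow> real \<Rightarrow> 's \<Rightarrow> 's \<Rightarrow> real) \<Rightarrow> (real \<Rightarrow> 'w \<Rightarrow> 's) \<Rightarrow> bool" where
  "markov_chain M P X \<longleftrightarrow>
     prob_space M \<and>
     (\<forall>t\<ge>0. X t \<in> measurable M (count_space UNIV)) \<and>
     (AE w in M. step_path (\<lambda>t. X t w)) \<and>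
     (\<forall>m (t :: nat \<Rightarrow> real) x. 0 \<le> t 0 \<and> (\<forall>i<m. t i \<le> t (Suc i)) \<longrightarrow>
        measure M {w \<in> space M. \<forall>i\<le>m. X (t i) w = x i} =
        measure M {w \<in> space M. X (t 0) w = x 0} *
          (\<Prod>i<m. P (t i) (t (Suc i)) (x i) (x (Suc i))))"

section \<open>The perturbed random walk and its lift\<close>

text \<open>If \<open>pr\<close> is injective on \<open>Z\<close>, the sum has at most one term.\<close>

definition perturbed_rate ::
    "(int ^ 'd) set \<Rightarrow> (('n::finite, 'd::finite) torus \<Rightarrow> ('n, 'd) torus \<Rightarrow> real) \<Rightarrow> real ^ 'd \<Rightarrow> real \<Rightarrow>
     real \<Rightarrow> real \<Rightarrow> ('n, 'd) torus \<Rightarrow> ('n, 'd) torus \<Rightarrow> real" where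
  "perturbed_rate Z r v \<omega> l t x y =
     (\<Sum>z\<in>{z \<in> Z. y = x + pr z}. exp (l * cos (\<omega> * t) * (real_vec z \<bullet> v)) * r x (x + pr z))"

text \<open>\<open>y\<close> follows the path \<open>x\<close>, jumping by \<open>z \<in> Z\<close> whenever \<open>x\<close> jumps by \<open>pr z\<close>; \<open>a\<close> and \<open>b\<close> are the
  left limits of \<open>x\<close> and \<open>y\<close> at time \<open>t\<close>.\<close>

definition lifted_path ::
    "(int ^ 'd) set \<Rightarrow> (real \<Rightarrow> ('n::finite, 'd::finite) torus) \<Rightarrow> (real \<Rightarrow> int ^ 'd) \<Rightarrow> bool" where
  "lifted_path Z x y \<longleftrightarrow>
     (\<forall>t\<ge>0. pr (y t) = x t) \<and>
     (\<forall>t\<ge>0. \<forall>\<^sub>F s in at_right t. y s = y t) \<and>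
     (\<forall>t>0. \<exists>a b. (\<forall>\<^sub>F s in at_left t. x s = a \<and> y s = b) \<and>
        (if x t = a then y t = b else (\<exists>z\<in>Z. x t = a + pr z \<and> y t = b + z)))"

definition lifted_walk ::
    "'w measure \<Rightarrow> (int ^ 'd) set \<Rightarrow> (real \<Rightarrow> 'w \<Rightarrow> ('n::finite, 'd::finite) torus) \<Rightarrow>
     (real \<Rightarrow> 'w \<Rightarrow> int ^ 'd) \<Rightarrow> bool" where
  "lifted_walk M Z X Y \<longleftrightarrow>
     (\<forall>t\<ge>0. Y t \<in> measurable M (count_space UNIV)) \<and>
     integrable M (\<lambda>w. real_vec (Y 0 w)) \<and>
     (AE w in M. lifted_path Z (\<lambda>t. X t w) (\<lambda>t. Y t w))"

text \<open>The time derivative of the mean position; at time 0 it is the right derivative.\<close>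

definition mean_velocity :: "'w measure \<Rightarrow> (real \<Rightarrow> 'w \<Rightarrow> int ^ 'd) \<Rightarrow> real \<Rightarrow> real ^ 'd::finite" where
  "mean_velocity M Y t =
     vector_derivative (\<lambda>s. integral\<^sup>L M (\<lambda>w. real_vec (Y s w))) (at t within {0..})"

text \<open>As \<open>P\<close> has period \<open>2\<pi>/|\<omega>|\<close> in time, the chain observed at the multiples of the period is
  homogeneous, with the one-period transition matrix below.\<close>

definition oscillatory_distribution ::
    "real \<Rightarrow> (real \<Rightarrow> real \<Rightarrow> 's::finite \<Rightarrow> 's \<Rightarrow> real) \<Rightarrow> ('s \<Rightarrow> real) \<Rightarrow> bool" where
  "oscillatory_distribution \<omega> P p \<longleftrightarrow> distribution p \<and>
     (\<forall>y. (\<Sum>x\<in>UNIV. p x * P 0 (2 * pi / \<bar>\<omega>\<bar>) x y) = p y)"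

section \<open>The complex mobility matrix\<close>

definition drift ::
    "(int ^ 'd) set \<Rightarrow> (('n::finite, 'd::finite) torus \<Rightarrow> ('n, 'd) torus \<Rightarrow> real) \<Rightarrow>
     ('n, 'd) torus \<Rightarrow> real ^ 'd" where
  "drift Z r x = (\<Sum>z\<in>Z. r x (x + pr z) *\<^sub>R real_vec z)"

text \<open>Up to the factor \<open>p x\<close>, the first-order source term in the forward equation is
  \<open>\<Sum>z\<in>Z. (time_reversal p r x (x - pr z) - r x (x + pr z)) *\<^sub>R real_vec z\<close>. It agrees with \<open>Psi\<close> when
  \<open>Z = - Z\<close>, but not in general: for the totally asymmetric walk with \<open>d = 1\<close>, \<open>Z = {1}\<close> and
  constant rates it vanishes, whereas \<open>Psi\<close> does not.\<close>

definition Psi ::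
    "(int ^ 'd) set \<Rightarrow> (('n::finite, 'd::finite) torus \<Rightarrow> real) \<Rightarrow>
     (('n, 'd) torus \<Rightarrow> ('n, 'd) torus \<Rightarrow> real) \<Rightarrow> ('n, 'd) torus \<Rightarrow> real ^ 'd" where
  "Psi Z p r x = - (\<Sum>z\<in>Z. (time_reversal p r x (x + pr z) + r x (x + pr z)) *\<^sub>R real_vec z)"

definition coord :: "('s \<Rightarrow> real ^ 'd::finite) \<Rightarrow> 'd \<Rightarrow> 's \<Rightarrow> complex" where
  "coord f j x = complex_of_real (f x $ j)"

definition jump_covariance ::
    "(int ^ 'd) set \<Rightarrow> (('n::finite, 'd::finite) torus \<Rightarrow> real) \<Rightarrow>
     (('n, 'd) torus \<Rightarrow> ('n, 'd) torus \<Rightarrow> real) \<Rightarrow> 'd \<Rightarrow> 'd \<Rightarrow> real" where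
  "jump_covariance Z p r j k =
     (\<Sum>z\<in>Z. (\<Sum>x\<in>UNIV. p x * r x (x + pr z)) * real_vec z $ j * real_vec z $ k)"

definition mobility ::
    "(int ^ 'd) set \<Rightarrow> (('n::finite, 'd::finite) torus \<Rightarrow> real) \<Rightarrow>
     (('n, 'd) torus \<Rightarrow> ('n, 'd) torus \<Rightarrow> real) \<Rightarrow> real \<Rightarrow> complex ^ 'd ^ 'd" where
  "mobility Z p r \<omega> = (\<chi> j k. complex_of_real (jump_covariance Z p r j k) +
     l2_inner p (coord (drift Z r) j)
       (inv_into UNIV (shifted \<omega> (generator (time_reversal p r))) (coord (Psi Z p r) k)))"

end

theory Submission
  imports Defs "HOL-Real_Asymp.Real_Asymp"
begin

text \<open>
  Let \<open>\<mu>\<^sub>t\<close> be the law of the perturbed walk in the oscillatory steady state. Its density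
  \<open>\<mu>\<^sub>t / \<pi>\<close> is a periodic solution of \<open>\<partial>\<^sub>t h = L\<^sup>* h + f\<close>, where \<open>f\<close> is of the order of the
  perturbation. By the Poincare inequality, a mean-zero periodic solution is bounded by a multiple
  of \<open>sup \<bar>f\<bar>\<close>, since its energy cannot decrease at a time where it is maximal. Applied first to
  \<open>\<mu>\<^sub>t / \<pi> - 1\<close> and then to \<open>\<mu>\<^sub>t / \<pi> - 1 - \<lambda> \<rho>\<^sub>t\<close> with \<open>\<rho>\<^sub>t = Re (e\<^sup>i\<^sup>\<omega>\<^sup>t (i\<omega> - L\<^sup>*)\<^sup>-\<^sup>1 (\<Psi> \<bullet> v))\<close>, this shows that
  \<open>\<rho>\<^sub>t\<close> is the derivative of the density at \<open>\<lambda> = 0\<close>, with an error of order \<open>\<lambda>\<^sup>2\<close> that is uniform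
  in time.

  The mean velocity is expressed through the law by refining \<open>[s, t]\<close> dyadically: the sum of the
  jumps seen on the grid converges to \<open>Y\<^sub>t - Y\<^sub>s\<close>, and each refinement changes the sum only where
  two jumps occur in one cell, which costs \<open>O((t - s)\<^sup>2)\<close> in mean altogether.
\<close>

section \<open>Dirichlet form and Poincare inequality\<close>

text \<open>Each parameter \<lambda> comes with its own probability space, and nothing is assumed
  about how the oscillatory distribution depends on \<lambda>. Differentiability at 0 must therefore
  come from an a priori bound whose constant is fixed before \<lambda>. Two passes are made because,
  once the linear term is subtracted, the forcing still contains the change of the rates acting on
  \<open>\<mu> - p\<close>; only the first pass shows that \<open>\<mu> - p\<close> is itself small.
  The density relative to \<pi> is used because it evolves under the generator of the time reversal,
  which has the same invariant distribution, so that all results for stationary rates apply to it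
  again. The source term counts arrivals at \<open>y\<close> from \<open>y - pr z\<close>, whereas
  \<open>Psi\<close> is written with jumps to \<open>y + pr z\<close>; the hypothesis that
  \<open>Z\<close> is symmetric reconciles the two. Finally, the lift is not a function of the walk
  at one time, and its integrability at later times has to be proved along with the formula for its
  mean.\<close>

lemma generator_diff: "generator r (\<lambda>x. f x - g x) x = generator r f x - generator r g x"
  unfolding generator_def by (simp add: sum_subtractf[symmetric] algebra_simps)

lemma generator_cmult: "generator r (\<lambda>x. c * f x) x = c * generator r f x"
  unfolding generator_def by (simp add: sum_distrib_left algebra_simps)

lemma generator_const: "generator r (\<lambda>x. c) x = 0"
  unfolding generator_def by simp

lemma generator_sum: "generator r (\<lambda>x. \<Sum>k\<in>K. f k x) x = (\<Sum>k\<in>K. generator r (f k) x)"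
  unfolding generator_def
  by (subst sum.swap) (simp add: sum_subtractf[symmetric] sum_distrib_left)

lemma generator_of_real_Re:
  "generator r (\<lambda>x. complex_of_real (Re (f x))) x = complex_of_real (Re (generator r f x))"
  unfolding generator_def by simp

lemma shifted_sum:
  "shifted \<omega> (generator r) (\<lambda>x. \<Sum>k\<in>K. f k x) x = (\<Sum>k\<in>K. shifted \<omega> (generator r) (f k) x)"
  unfolding shifted_def by (simp add: generator_sum sum_subtractf sum_distrib_left)

lemma shifted_cmult: "shifted \<omega> (generator r) (\<lambda>x. c * f x) x = c * shifted \<omega> (generator r) f x"
  unfolding shifted_def by (simp add: generator_cmult algebra_simps)

section \<open>Stationary rates and their time reversal\<close>

locale stationary_rates =
  fixes r :: "'s::finite \<Rightarrow> 's \<Rightarrow> real" and p :: "'s \<Rightarrow> real"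
  assumes rate_nonneg: "0 \<le> r x y"
    and irreducible: "irreducible_rates r"
    and invariant: "invariant_distribution r p"
begin

lemma balance: "(\<Sum>x\<in>UNIV. p x * r x y) = p y * (\<Sum>x\<in>UNIV. r y x)"
  using invariant unfolding invariant_distribution_def by auto

lemma p_nonneg: "0 \<le> p x" and p_sum: "(\<Sum>x\<in>UNIV. p x) = 1"
  using invariant unfolding invariant_distribution_def distribution_def by auto

text \<open>Positivity spreads along jumps of positive rate: a charged \<open>y\<close> sends mass
  into \<open>z\<close>, and stationarity equates the inflow into \<open>z\<close> with an outflow
  proportional to \<open>p z\<close>.\<close>

lemma p_pos: "0 < p y"
proof -
  obtain x where x: "0 < p x"
    using p_sum p_nonneg by (metis sum_nonpos not_less zero_less_one)
  have "(x, y) \<in> {(a, b). r a b > 0}\<^sup>*"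
    using irreducible unfolding irreducible_rates_def by auto
  then show ?thesis
  proof induction
    case (step y z)
    have "0 < p y * r y z" using step by simp
    also have "\<dots> \<le> (\<Sum>x\<in>UNIV. p x * r x z)"
      by (rule member_le_sum) (auto simp: p_nonneg rate_nonneg)
    also have "\<dots> = p z * (\<Sum>x\<in>UNIV. r z x)" by (rule balance)
    finally show ?case using p_nonneg[of z] by (cases "p z = 0") auto
  qed (rule x)
qed

lemma p_nonzero [simp]: "p x \<noteq> 0"
  using p_pos[of x] by simp

lemma reversal_sum: "(\<Sum>y\<in>UNIV. time_reversal p r x y) = (\<Sum>y\<in>UNIV. r x y)"
  using balance[of x] unfolding time_reversal_def sum_divide_distrib[symmetric] by simp

lemma p_reversal: "p x * time_reversal p r x y = p y * r y x"
  unfolding time_reversal_def by simp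

text \<open>Lets every result of this locale be reused for the adjoint generator. Reversal turns all
  arrows of the graph of positive rates around, and by \<open>reversal_sum\<close> it keeps the exit
  rates.\<close>

lemma stationary_reversal: "stationary_rates (time_reversal p r) p"
proof
  show "0 \<le> time_reversal p r x y" for x y
    unfolding time_reversal_def by (simp add: p_nonneg rate_nonneg)
  have "{(a, b). time_reversal p r a b > 0} = {(a, b). r a b > 0}\<inverse>"
    unfolding time_reversal_def using p_pos p_nonneg
    by (auto simp: zero_less_mult_iff zero_less_divide_iff) (meson not_less)+
  then show "irreducible_rates (time_reversal p r)"
    using irreducible unfolding irreducible_rates_def by (auto simp: rtrancl_converse)
  have "(\<Sum>x\<in>UNIV. p x * time_reversal p r x y) = p y * (\<Sum>x\<in>UNIV. r y x)" for y
    by (simp add: p_reversal sum_distrib_left)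
  then show "invariant_distribution (time_reversal p r) p"
    unfolding invariant_distribution_def reversal_sum
    using invariant unfolding invariant_distribution_def by auto
qed

text \<open>By \<open>balance\<close> each value of \<open>\<phi>\<close> is weighted equally by
  inflow and outflow. The value type is general because complex \<open>f\<close> and the real
  observable \<open>(cmod (f x))\<^sup>2 / 2\<close> are both needed.\<close>

lemma balance_weighted:
  fixes \<phi> :: "'s \<Rightarrow> 'a::real_vector"
  shows "(\<Sum>x\<in>UNIV. \<Sum>y\<in>UNIV. (p x * r x y) *\<^sub>R (\<phi> y - \<phi> x)) = 0"
proof -
  have "(\<Sum>x\<in>UNIV. \<Sum>y\<in>UNIV. (p x * r x y) *\<^sub>R \<phi> y) = (\<Sum>y\<in>UNIV. (\<Sum>x\<in>UNIV. p x * r x y) *\<^sub>R \<phi> y)"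
    by (subst sum.swap) (simp add: scaleR_sum_left)
  also have "\<dots> = (\<Sum>x\<in>UNIV. \<Sum>y\<in>UNIV. (p x * r x y) *\<^sub>R \<phi> x)"
    by (simp add: balance scaleR_sum_left sum_distrib_left)
  finally show ?thesis by (simp add: scaleR_diff_right sum_subtractf)
qed

lemma generator_mean: "(\<Sum>x\<in>UNIV. complex_of_real (p x) * generator r f x) = 0"
  using balance_weighted[of f] unfolding generator_def
  by (simp add: sum_distrib_left scaleR_conv_of_real mult.assoc)

text \<open>The Dirichlet form of the symmetric part of the generator, without the usual factor
  1/2.\<close>

definition dirichlet :: "('s \<Rightarrow> complex) \<Rightarrow> real" where
  "dirichlet f = (\<Sum>x\<in>UNIV. \<Sum>y\<in>UNIV. p x * r x y * (cmod (f y - f x))\<^sup>2)"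

definition energy :: "('s \<Rightarrow> complex) \<Rightarrow> real" where
  "energy f = (\<Sum>x\<in>UNIV. p x * (cmod (f x))\<^sup>2)"

text \<open>\<open>polar\<close> splits each term into an increment of
  \<open>(cmod (f x))\<^sup>2 / 2\<close>, which stationarity averages out, and a negative square.
  Only the symmetric part of the generator survives, so the formula covers nonreversible
  rates.\<close>

lemma Re_inner_generator: "Re (l2_inner p f (generator r f)) = - dirichlet f / 2"
proof -
  have polar: "Re (cnj a * (b - a)) = ((cmod b)\<^sup>2 - (cmod a)\<^sup>2) / 2 - (cmod (b - a))\<^sup>2 / 2" for a b
    unfolding cmod_power2 by (simp add: power2_eq_square field_simps)
  have "Re (l2_inner p f (generator r f)) =
      (\<Sum>x\<in>UNIV. \<Sum>y\<in>UNIV. p x * r x y * Re (cnj (f x) * (f y - f x)))"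
    unfolding l2_inner_def generator_def
    by (simp add: sum_distrib_left Re_sum algebra_simps)
  also have "\<dots> = (\<Sum>x\<in>UNIV. \<Sum>y\<in>UNIV. (p x * r x y) *\<^sub>R ((cmod (f y))\<^sup>2 / 2 - (cmod (f x))\<^sup>2 / 2))
      - dirichlet f / 2"
    unfolding dirichlet_def polar sum_divide_distrib sum_subtractf[symmetric]
    by (intro sum.cong refl) (simp add: field_simps)
  finally show ?thesis using balance_weighted[of "\<lambda>x. (cmod (f x))\<^sup>2 / 2"] by simp
qed

lemma dirichlet_nonneg: "0 \<le> dirichlet f"
  unfolding dirichlet_def by (intro sum_nonneg) (auto simp: p_nonneg rate_nonneg)

lemma dirichlet_ge: "p x * r x y * (cmod (f y - f x))\<^sup>2 \<le> dirichlet f"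
proof -
  have "p x * r x y * (cmod (f y - f x))\<^sup>2 \<le> (\<Sum>y\<in>UNIV. p x * r x y * (cmod (f y - f x))\<^sup>2)"
    by (rule member_le_sum) (auto simp: p_nonneg rate_nonneg)
  also have "\<dots> \<le> dirichlet f" unfolding dirichlet_def
    by (rule member_le_sum) (auto simp: p_nonneg rate_nonneg intro!: sum_nonneg)
  finally show ?thesis .
qed

text \<open>A path of positive rates joins \<open>x\<close> to \<open>y\<close>, and the squared
  increment of \<open>f\<close> over one edge is at most \<open>dirichlet f\<close> divided by the
  weight of that edge.\<close>

lemma oscillation_le_dirichlet: "\<exists>C\<ge>0. \<forall>f. (cmod (f y - f x))\<^sup>2 \<le> C * dirichlet f"
proof -
  have "(x, y) \<in> {(a, b). r a b > 0}\<^sup>*"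
    using irreducible unfolding irreducible_rates_def by auto
  then show ?thesis
  proof induction
    case base
    show ?case by (intro exI[of _ 0]) simp
  next
    case (step y z)
    then obtain C where C: "C \<ge> 0" "\<And>f. (cmod (f y - f x))\<^sup>2 \<le> C * dirichlet f" by blast
    let ?q = "p y * r y z"
    have q: "0 < ?q" using step p_pos by simp
    \<comment> \<open>From \<open>(a + b)\<^sup>2 \<le> 2 * a\<^sup>2 + 2 * b\<^sup>2\<close>, with
      the path up to \<open>y\<close> and the last edge estimated separately.\<close>
    have "(cmod (f z - f x))\<^sup>2 \<le> (2 * C + 2 / ?q) * dirichlet f" for f
    proof -
      have "cmod (f z - f x) \<le> cmod (f y - f x) + cmod (f z - f y)"
        by (metis add.commute diff_add_cancel norm_triangle_ineq add_diff_eq)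
      then have "(cmod (f z - f x))\<^sup>2 \<le> (cmod (f y - f x) + cmod (f z - f y))\<^sup>2"
        by (simp add: power_mono)
      also have "\<dots> \<le> 2 * (cmod (f y - f x))\<^sup>2 + 2 * (cmod (f z - f y))\<^sup>2"
        by (smt (verit) power2_sum sum_squares_bound)
      also have "(cmod (f z - f y))\<^sup>2 \<le> dirichlet f / ?q"
        using dirichlet_ge[of y z f] q by (simp add: field_simps)
      finally show ?thesis using C(2)[of f] by (simp add: algebra_simps)
    qed
    then show ?case using C q by (intro exI[of _ "2 * C + 2 / ?q"]) auto
  qed
qed

text \<open>A function of mean zero is at each point the \<open>p\<close>-average of its differences
  \<open>f x - f y\<close>, and finitely many constants bound all of these by the Dirichlet
  form.\<close>

lemma poincare: "\<exists>c>0. \<forall>f. (\<Sum>x\<in>UNIV. complex_of_real (p x) * f x) = 0 \<longrightarrow>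
    Re (l2_inner p f (generator r f)) \<le> - c * energy f"
proof -
  obtain C where C: "\<And>x y. C x y \<ge> 0" "\<And>x y f. (cmod (f y - f x))\<^sup>2 \<le> C x y * dirichlet f"
  proof -
    have "\<forall>x y. \<exists>C. C \<ge> 0 \<and> (\<forall>f. (cmod (f y - f x))\<^sup>2 \<le> C * dirichlet f)"
      using oscillation_le_dirichlet by blast
    then show ?thesis using that by metis
  qed
  define D where "D = (\<Sum>x\<in>UNIV. \<Sum>y\<in>UNIV. C x y) + 1"
  have D: "0 < D" unfolding D_def using C(1) by (intro add_nonneg_pos sum_nonneg) auto
  have CD: "C x y \<le> D" for x y
  proof -
    have "C x y \<le> (\<Sum>y\<in>UNIV. C x y)" by (rule member_le_sum) (auto simp: C)
    also have "\<dots> \<le> (\<Sum>x\<in>UNIV. \<Sum>y\<in>UNIV. C x y)"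
      by (rule member_le_sum) (auto simp: C intro!: sum_nonneg)
    finally show ?thesis by (simp add: D_def)
  qed
  \<comment> \<open>The bound \<open>energy f \<le> D * dirichlet f\<close> and the factor 1/2 in
    \<open>Re_inner_generator\<close> give this rate.\<close>
  have "Re (l2_inner p f (generator r f)) \<le> - (1 / (2 * D)) * energy f"
    if mean: "(\<Sum>x\<in>UNIV. complex_of_real (p x) * f x) = 0" for f
  proof -
    have "(cmod (f x))\<^sup>2 \<le> D * dirichlet f" for x
    proof -
      have "f x = (\<Sum>y\<in>UNIV. complex_of_real (p y) * (f x - f y))"
        using mean p_sum
        by (simp add: right_diff_distrib sum_subtractf sum_distrib_right[symmetric] of_real_sum[symmetric]
            del: of_real_sum)
      also have "cmod \<dots> \<le> (\<Sum>y\<in>UNIV. p y * sqrt (D * dirichlet f))"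
      proof (intro sum_norm_le)
        fix y
        have "(cmod (f x - f y))\<^sup>2 \<le> D * dirichlet f"
          using C(2)[of f x y] CD[of y x] dirichlet_nonneg[of f]
          by (meson mult_right_mono order_trans)
        then have "cmod (f x - f y) \<le> sqrt (D * dirichlet f)" by (rule real_le_rsqrt)
        then show "cmod (complex_of_real (p y) * (f x - f y)) \<le> p y * sqrt (D * dirichlet f)"
          by (simp add: norm_mult p_nonneg mult_left_mono)
      qed
      also have "\<dots> = sqrt (D * dirichlet f)"
        by (simp add: sum_distrib_right[symmetric] p_sum)
      finally show ?thesis using D dirichlet_nonneg[of f]
        by (metis norm_ge_zero power_mono real_sqrt_pow2 mult_nonneg_nonneg less_imp_le)
    qed
    then have "energy f \<le> (\<Sum>x\<in>UNIV. p x * (D * dirichlet f))"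
      unfolding energy_def by (intro sum_mono mult_left_mono) (auto simp: p_nonneg)
    also have "\<dots> = D * dirichlet f" by (simp add: sum_distrib_right[symmetric] p_sum)
    finally show ?thesis unfolding Re_inner_generator using D by (simp add: field_simps)
  qed
  then show ?thesis using D by (intro exI[of _ "1 / (2 * D)"]) auto
qed

section \<open>Invertibility of i \<omega> - L\<close>

lemma energy_nonneg: "0 \<le> energy f"
  unfolding energy_def by (intro sum_nonneg) (auto simp: p_nonneg)

lemma norm_le_energy: "cmod (f x) \<le> sqrt (energy f / p x)"
proof -
  have "p x * (cmod (f x))\<^sup>2 \<le> energy f" unfolding energy_def
    by (rule member_le_sum[where f="\<lambda>x. p x * (cmod (f x))\<^sup>2"]) (auto simp: p_nonneg)
  then show ?thesis using p_pos[of x] by (intro real_le_rsqrt) (simp add: field_simps)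
qed

text \<open>For \<open>h\<close> in the kernel the generator acts as multiplication by i \<omega>.
  This forces mean zero because \<omega> is nonzero, and makes the real part of
  \<open>l2_inner p h (generator r h)\<close> vanish, which the Poincare inequality allows only for
  \<open>h = 0\<close>.\<close>

lemma inj_shifted:
  assumes "\<omega> \<noteq> 0" shows "inj (shifted \<omega> (generator r))"
proof (rule injI)
  fix f g assume eq: "shifted \<omega> (generator r) f = shifted \<omega> (generator r) g"
  define h where "h x = f x - g x" for x
  have h0: "generator r h x = \<i> * \<omega> * h x" for x
    using fun_cong[OF eq, of x] unfolding h_def generator_diff shifted_def
    by (simp add: algebra_simps)
  have "(\<Sum>x\<in>UNIV. complex_of_real (p x) * (\<i> * \<omega> * h x)) = 0"
    using generator_mean[of h] by (simp add: h0)
  then have "\<i> * \<omega> * (\<Sum>x\<in>UNIV. complex_of_real (p x) * h x) = 0"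
    by (simp add: sum_distrib_left algebra_simps)
  then have mean: "(\<Sum>x\<in>UNIV. complex_of_real (p x) * h x) = 0" using assms by simp
  have "l2_inner p h (generator r h) = \<i> * \<omega> * complex_of_real (energy h)"
    unfolding l2_inner_def h0 energy_def
    by (simp add: sum_distrib_left complex_norm_square mult_ac del: of_real_power)
  then have "Re (l2_inner p h (generator r h)) = 0" by simp
  then have "energy h \<le> 0" using poincare mean by (metis mult_minus_left neg_0_le_iff_le mult_le_0_iff not_le)
  then have "h x = 0" for x using norm_le_energy[of h x] energy_nonneg[of h] by simp
  then show "f = g" unfolding h_def by auto
qed

text \<open>In finite dimension injectivity gives surjectivity. The operator is written as a matrix
  on \<open>complex^'s\<close> so that linear algebra applies.\<close>

lemma bij_shifted:
  assumes "\<omega> \<noteq> 0" shows "bij (shifted \<omega> (generator r))"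
proof -
  define A :: "complex^'s^'s" where
    "A = (\<chi> x y. (if x = y then \<i> * \<omega> + (\<Sum>w\<in>UNIV. complex_of_real (r x w)) else 0) - r x y)"
  have A: "(A *v u) $ x = shifted \<omega> (generator r) (($) u) x" for u x
    unfolding A_def matrix_vector_mult_def shifted_def generator_def
    by (simp add: left_diff_distrib sum_subtractf if_distrib[of "\<lambda>a. a * _"] right_diff_distrib
        sum_distrib_right distrib_right cong: if_cong)
  have "inj ((*v) A)"
  proof (rule injI)
    fix u v assume "A *v u = A *v v"
    then have "shifted \<omega> (generator r) (($) u) = shifted \<omega> (generator r) (($) v)"
      by (auto simp: A[symmetric])
    then have "($) u = ($) v" using inj_shifted[OF assms] by (simp add: inj_def)
    then show "u = v" by (simp add: vec_eq_iff)
  qed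
  then have "surj ((*v) A)"
    using matrix_left_invertible_injective matrix_right_invertible_surjective matrix_left_right_inverse
    by blast
  then have "surj (shifted \<omega> (generator r))"
  proof -
    have "\<exists>f. g = shifted \<omega> (generator r) f" for g
    proof -
      obtain u where u: "A *v u = vec_lambda g" using \<open>surj ((*v) A)\<close> by (metis surjD)
      have "g = shifted \<omega> (generator r) (($) u)" by (rule ext) (simp add: A[symmetric] u)
      then show ?thesis by blast
    qed
    then show ?thesis by (simp add: surj_def)
  qed
  then show ?thesis using inj_shifted[OF assms] by (simp add: bij_def)
qed

end

section \<open>The semigroup and periodic solutions\<close>

lemma has_real_derivative_cmod_power2:
  assumes "(u has_vector_derivative u') (at t within S)"
  shows "((\<lambda>t. (cmod (u t))\<^sup>2) has_real_derivative 2 * Re (cnj (u t) * u')) (at t within S)"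
proof -
  have "((\<lambda>t. (Re (u t))\<^sup>2 + (Im (u t))\<^sup>2) has_real_derivative
      2 * Re (u t) * Re u' + 2 * Im (u t) * Im u') (at t within S)"
    using assms unfolding has_vector_derivative_complex_iff
    by (intro DERIV_add) (auto intro!: DERIV_power[THEN DERIV_cong])
  then show ?thesis unfolding cmod_power2 by (simp add: algebra_simps)
qed

lemma uniformly_bounded_finite:
  fixes f :: "'s::finite \<Rightarrow> 'a::real_normed_vector"
  obtains B where "0 \<le> B" "\<And>x. norm (f x) \<le> B"
proof
  show "0 \<le> (\<Sum>x\<in>UNIV. norm (f x))" by (intro sum_nonneg) auto
  show "norm (f x) \<le> (\<Sum>x\<in>UNIV. norm (f x))" for x by (rule member_le_sum) auto
qed

text \<open>Pulls the time out of the iterates, leaving a power series in \<open>s\<close> with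
  coefficients independent of \<open>s\<close>; this is what can be differentiated term by
  term.\<close>

lemma op_exp_scaled:
  assumes "\<And>c f. A (\<lambda>x. c * f x) = (\<lambda>x. c * A f x)"
  shows "op_exp (\<lambda>f x. - (s * A f x)) f x = (\<Sum>m. ((- 1) ^ m * (A ^^ m) f x / fact m) * s ^ m)"
proof -
  have "((\<lambda>f x. - (s * A f x)) ^^ m) f = (\<lambda>x. (- s) ^ m * (A ^^ m) f x)" for m
    by (induction m) (auto simp: assms)
  then show ?thesis unfolding op_exp_def
    by (simp add: power_minus[of s] mult_ac)
qed

lemma shifted_bounded:
  fixes r :: "'s::finite \<Rightarrow> 's \<Rightarrow> real"
  obtains K where "0 \<le> K"
    "\<And>f B x. (\<And>x. cmod (f x) \<le> B) \<Longrightarrow> cmod (shifted \<omega> (generator r) f x) \<le> K * B"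
proof
  define K where "K = \<bar>\<omega>\<bar> + 2 * (\<Sum>x\<in>UNIV. \<Sum>y\<in>UNIV. \<bar>r x y\<bar>)"
  show "0 \<le> K" unfolding K_def by (intro add_nonneg_nonneg mult_nonneg_nonneg sum_nonneg) auto
  show "cmod (shifted \<omega> (generator r) f x) \<le> K * B" if f: "\<And>x. cmod (f x) \<le> B" for f B x
  proof -
    have B: "0 \<le> B" using f[of x] norm_ge_zero order_trans by blast
    have "cmod (generator r f x) \<le> (\<Sum>y\<in>UNIV. \<bar>r x y\<bar> * (2 * B))"
      unfolding generator_def
    proof (intro sum_norm_le)
      fix y
      have "cmod (f y - f x) \<le> 2 * B"
        using norm_triangle_ineq4[of "f y" "f x"] f[of x] f[of y] by linarith
      then show "cmod (complex_of_real (r x y) * (f y - f x)) \<le> \<bar>r x y\<bar> * (2 * B)"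
        by (simp add: norm_mult mult_left_mono)
    qed
    also have "\<dots> = (\<Sum>y\<in>UNIV. \<bar>r x y\<bar>) * (2 * B)" by (simp add: sum_distrib_right)
    also have "\<dots> \<le> (\<Sum>x\<in>UNIV. \<Sum>y\<in>UNIV. \<bar>r x y\<bar>) * (2 * B)"
      using B by (intro mult_right_mono member_le_sum) (auto intro: sum_nonneg)
    finally have "cmod (generator r f x) \<le> (\<Sum>x\<in>UNIV. \<Sum>y\<in>UNIV. \<bar>r x y\<bar>) * (2 * B)" .
    moreover have "cmod (\<i> * complex_of_real \<omega> * f x) \<le> \<bar>\<omega>\<bar> * B"
      using f[of x] by (simp add: norm_mult mult_left_mono)
    ultimately show ?thesis
      using norm_triangle_ineq4[of "\<i> * complex_of_real \<omega> * f x" "generator r f x"]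
      unfolding shifted_def K_def by (simp add: algebra_simps)
  qed
qed

text \<open>The semigroup \<open>exp (- s * (i \<omega> - L))\<close>, which is the Markov semigroup
  of \<open>r\<close> times the phase \<open>exp (- i \<omega> s)\<close>.\<close>

definition evolution ::
    "real \<Rightarrow> ('s::finite \<Rightarrow> 's \<Rightarrow> real) \<Rightarrow> real \<Rightarrow> ('s \<Rightarrow> complex) \<Rightarrow> 's \<Rightarrow> complex" where
  "evolution \<omega> r s = op_exp (\<lambda>f x. - (complex_of_real s * shifted \<omega> (generator r) f x))"

text \<open>The iterates grow at most like \<open>K ^ m\<close>, so the exponential series
  dominates. Time is first taken complex, where the theorems on power series give the derivative,
  and is restricted to the real line at the end.\<close>

lemma evolution_sums:
  "(\<lambda>m. ((- 1) ^ m * (shifted \<omega> (generator r) ^^ m) f x / fact m) * complex_of_real s ^ m)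
      sums evolution \<omega> r s f x"
  and evolution_has_vector_derivative:
  "((\<lambda>s. evolution \<omega> r s f x) has_vector_derivative
      - evolution \<omega> r s (shifted \<omega> (generator r) f) x) (at s within S)"
proof -
  let ?A = "shifted \<omega> (generator r)"
  define c where "c f m = (- 1) ^ m * (?A ^^ m) f x / fact m" for f m
  have E: "op_exp (\<lambda>f x. - (z * ?A f x)) f x = (\<Sum>m. c f m * z ^ m)" for z f
    unfolding c_def by (rule op_exp_scaled) (auto simp: shifted_cmult)
  obtain K where K: "0 \<le> K" "\<And>f B x. (\<And>x. cmod (f x) \<le> B) \<Longrightarrow> cmod (?A f x) \<le> K * B"
    using shifted_bounded[of \<omega> r] by blast
  obtain B where B: "0 \<le> B" "\<And>x. cmod (f x) \<le> B"
    using uniformly_bounded_finite[of f] by blast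
  have power_bound: "cmod ((?A ^^ m) f x) \<le> K ^ m * B" for m x
  proof (induction m arbitrary: x)
    case (Suc m)
    show ?case using K(2)[of "(?A ^^ m) f", OF Suc] by (simp add: mult.assoc)
  qed (simp add: B)
  have summable: "summable (\<lambda>m. c f m * z ^ m)" for z
  proof (rule summable_comparison_test')
    show "summable (\<lambda>m. B * (inverse (fact m) * (K * cmod z) ^ m))"
      by (intro summable_mult summable_exp)
    show "norm (c f m * z ^ m) \<le> B * (inverse (fact m) * (K * cmod z) ^ m)" for m
    proof -
      have "norm (c f m * z ^ m) = cmod ((?A ^^ m) f x) * cmod z ^ m / fact m"
        unfolding c_def by (simp add: norm_mult norm_divide norm_power)
      also have "\<dots> \<le> K ^ m * B * cmod z ^ m / fact m"
        by (intro divide_right_mono mult_right_mono power_bound) auto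
      finally show ?thesis by (simp add: field_simps power_mult_distrib)
    qed
  qed
  show "(\<lambda>m. ((- 1) ^ m * (?A ^^ m) f x / fact m) * complex_of_real s ^ m) sums evolution \<omega> r s f x"
    using summable_sums[OF summable] unfolding evolution_def E c_def .
  \<comment> \<open>Differentiating the series shifts the index by one, and the extra iterate is
    absorbed in the starting function.\<close>
  have "diffs (c f) m = - c (?A f) m" for m
    unfolding diffs_def c_def by (simp add: funpow_swap1 field_simps del: of_nat_Suc)
  then have "((\<lambda>z. op_exp (\<lambda>f x. - (z * ?A f x)) f x) has_field_derivative
      (\<Sum>m. - (c (?A f) m * z ^ m))) (at z)" for z
    using termdiffs_strong_converges_everywhere[OF summable, of z] unfolding E by simp
  moreover have "summable (\<lambda>m. c (?A f) m * z ^ m)" for z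
    using termdiff_converges_all[OF summable, of z] \<open>\<And>m. diffs (c f) m = - c (?A f) m\<close>
    by (simp add: summable_minus_iff)
  ultimately show "((\<lambda>s. evolution \<omega> r s f x) has_vector_derivative
      - evolution \<omega> r s (?A f) x) (at s within S)"
    unfolding evolution_def by (intro has_vector_derivative_real_field) (simp add: E suminf_minus)
qed

lemma shifted_sums:
  assumes "\<And>x. (\<lambda>m. f m x) sums g x"
  shows "(\<lambda>m. shifted \<omega> (generator r) (f m) x) sums shifted \<omega> (generator r) g x"
  unfolding shifted_def generator_def
  by (intro sums_diff sums_mult sums_sum assms)

text \<open>The operator may be applied term by term, and both series then have the same terms,
  since it commutes with its own powers.\<close>

lemma evolution_shifted:
  "evolution \<omega> r s (shifted \<omega> (generator r) f) x = shifted \<omega> (generator r) (evolution \<omega> r s f) x"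
proof -
  let ?A = "shifted \<omega> (generator r)"
  have "(\<lambda>m. ?A (\<lambda>x. ((- 1) ^ m / fact m * complex_of_real s ^ m) * (?A ^^ m) f x) x)
      sums ?A (evolution \<omega> r s f) x"
    using evolution_sums[of \<omega> r f _ s] by (intro shifted_sums) (simp add: mult_ac)
  moreover have "(\<lambda>m. ?A (\<lambda>x. ((- 1) ^ m / fact m * complex_of_real s ^ m) * (?A ^^ m) f x) x)
      sums evolution \<omega> r s (?A f) x"
    using evolution_sums[of \<omega> r "?A f" x s] unfolding shifted_cmult by (simp add: funpow_swap1 mult_ac)
  ultimately show ?thesis by (rule sums_unique2[symmetric])
qed

lemma evolution_0: "evolution \<omega> r 0 f x = f x"
proof (rule sums_unique2)
  show "(\<lambda>m. ((- 1) ^ m * (shifted \<omega> (generator r) ^^ m) f x / fact m) * complex_of_real 0 ^ m) sums f x"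
    using powser_sums_zero[of "\<lambda>m. (- 1) ^ m * (shifted \<omega> (generator r) ^^ m) f x / fact m"] by simp
qed (rule evolution_sums)

section \<open>Decay on functions of mean zero and its consequences\<close>

context stationary_rates begin

lemma shifted_mean:
  "(\<Sum>x\<in>UNIV. complex_of_real (p x) * shifted \<omega> (generator r) f x)
    = \<i> * \<omega> * (\<Sum>x\<in>UNIV. complex_of_real (p x) * f x)"
  using generator_mean[of f] unfolding shifted_def
  by (simp add: right_diff_distrib sum_subtractf sum_distrib_left mult_ac)

lemma evolution_mean:
  assumes "(\<Sum>x\<in>UNIV. complex_of_real (p x) * f x) = 0"
  shows "(\<Sum>x\<in>UNIV. complex_of_real (p x) * evolution \<omega> r s f x) = 0"
proof -
  let ?A = "shifted \<omega> (generator r)"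
  have mean: "(\<Sum>x\<in>UNIV. complex_of_real (p x) * (?A ^^ m) f x) = 0" for m
    by (induction m) (auto simp: assms shifted_mean)
  have "(\<lambda>m. \<Sum>x\<in>UNIV. complex_of_real (p x) * (((- 1) ^ m * (?A ^^ m) f x / fact m) * complex_of_real s ^ m))
      sums (\<Sum>x\<in>UNIV. complex_of_real (p x) * evolution \<omega> r s f x)"
    by (intro sums_sum sums_mult evolution_sums)
  moreover have "(\<Sum>x\<in>UNIV. complex_of_real (p x) * (((- 1) ^ m * (?A ^^ m) f x / fact m) * complex_of_real s ^ m))
      = ((- 1) ^ m / fact m * complex_of_real s ^ m) * (\<Sum>x\<in>UNIV. complex_of_real (p x) * (?A ^^ m) f x)" for m
    by (simp add: sum_distrib_left mult_ac)
  ultimately show ?thesis by (simp add: mean sums_iff)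
qed

lemma energy_has_derivative:
  assumes "\<And>x. ((\<lambda>t. h t x) has_vector_derivative h' x) (at t within S)"
  shows "((\<lambda>t. energy (h t)) has_real_derivative 2 * Re (l2_inner p (h t) h')) (at t within S)"
proof -
  have "((\<lambda>t. energy (h t)) has_real_derivative (\<Sum>x\<in>UNIV. p x * (2 * Re (cnj (h t x) * h' x)))) (at t within S)"
    unfolding energy_def by (intro DERIV_sum DERIV_cmult has_real_derivative_cmod_power2 assms)
  also have "(\<Sum>x\<in>UNIV. p x * (2 * Re (cnj (h t x) * h' x))) = 2 * Re (l2_inner p (h t) h')"
    unfolding l2_inner_def Re_sum sum_distrib_left by (intro sum.cong refl) (simp add: algebra_simps)
  finally show ?thesis .
qed

text \<open>Shared by two arguments: decay of the semigroup takes \<open>\<alpha> = \<omega>\<close>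
  and no forcing, periodic solutions take \<open>\<alpha> = 0\<close>. The phase term is skew and
  leaves the real part alone. Of the dissipation \<open>2 * c\<close> from the Poincare inequality
  one half pays for the forcing.\<close>

lemma energy_dissipation: "\<exists>c>0. \<forall>h f \<alpha> \<epsilon>.
    (\<Sum>x\<in>UNIV. complex_of_real (p x) * h x) = 0 \<longrightarrow> (\<forall>x. cmod (f x) \<le> \<epsilon>) \<longrightarrow>
    2 * Re (l2_inner p h (\<lambda>x. generator r h x - \<i> * complex_of_real \<alpha> * h x + f x))
      \<le> - c * energy h + \<epsilon>\<^sup>2 / c"
proof -
  obtain c where c: "c > 0" "\<And>f. (\<Sum>x\<in>UNIV. complex_of_real (p x) * f x) = 0 \<Longrightarrow>
    Re (l2_inner p f (generator r f)) \<le> - c * energy f"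
    using poincare by blast
  have "2 * Re (l2_inner p h (\<lambda>x. generator r h x - \<i> * complex_of_real \<alpha> * h x + f x))
      \<le> - c * energy h + \<epsilon>\<^sup>2 / c"
    if mean: "(\<Sum>x\<in>UNIV. complex_of_real (p x) * h x) = 0" and f: "\<forall>x. cmod (f x) \<le> \<epsilon>" for h f \<alpha> \<epsilon>
  proof -
    have "l2_inner p h (\<lambda>x. generator r h x - \<i> * complex_of_real \<alpha> * h x + f x)
        = l2_inner p h (generator r h) - \<i> * complex_of_real (\<alpha> * energy h) + l2_inner p h f"
      unfolding l2_inner_def energy_def
      by (simp add: sum.distrib sum_subtractf distrib_left right_diff_distrib sum_distrib_left
          complex_norm_square mult_ac del: of_real_power)
    then have "2 * Re (l2_inner p h (\<lambda>x. generator r h x - \<i> * complex_of_real \<alpha> * h x + f x))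
        = 2 * Re (l2_inner p h (generator r h)) + 2 * Re (l2_inner p h f)" by simp
    moreover have "2 * Re (l2_inner p h f) \<le> (\<Sum>x\<in>UNIV. c * (p x * (cmod (h x))\<^sup>2) + p x * (\<epsilon>\<^sup>2 / c))"
      unfolding l2_inner_def Re_sum sum_distrib_left
    proof (rule sum_mono)
      fix x
      have "2 * Re (cnj (h x) * f x) \<le> 2 * (cmod (h x) * \<epsilon>)"
      proof -
        have "Re (cnj (h x) * f x) \<le> cmod (h x) * cmod (f x)"
          using complex_Re_le_cmod[of "cnj (h x) * f x"] unfolding norm_mult complex_mod_cnj .
        also have "\<dots> \<le> cmod (h x) * \<epsilon>" using f by (intro mult_left_mono) auto
        finally show ?thesis by simp
      qed
      also have "\<dots> \<le> c * (cmod (h x))\<^sup>2 + \<epsilon>\<^sup>2 / c"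
      proof -
        have "0 \<le> (c * cmod (h x) - \<epsilon>)\<^sup>2 / c" using c(1) by simp
        then show ?thesis using c(1) by (simp add: power2_eq_square field_simps)
      qed
      finally have "p x * (2 * Re (cnj (h x) * f x)) \<le> p x * (c * (cmod (h x))\<^sup>2 + \<epsilon>\<^sup>2 / c)"
        by (intro mult_left_mono p_nonneg)
      then show "2 * Re (complex_of_real (p x) * cnj (h x) * f x) \<le> c * (p x * (cmod (h x))\<^sup>2) + p x * (\<epsilon>\<^sup>2 / c)"
        by (simp add: algebra_simps)
    qed
    moreover have "(\<Sum>x\<in>UNIV. c * (p x * (cmod (h x))\<^sup>2) + p x * (\<epsilon>\<^sup>2 / c)) = c * energy h + \<epsilon>\<^sup>2 / c"
      unfolding energy_def sum.distrib sum_distrib_left[symmetric] sum_distrib_right[symmetric] p_sum by simp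
    ultimately show ?thesis using c(2)[OF mean] by simp
  qed
  then show ?thesis using c(1) by blast
qed

text \<open>Gronwall's argument: the energy times \<open>exp (c * s)\<close> has nonpositive
  derivative. Mean zero is preserved in time, so the dissipation estimate applies at every
  \<open>s\<close>.\<close>

lemma evolution_decay: "\<exists>c>0. \<forall>f. (\<Sum>x\<in>UNIV. complex_of_real (p x) * f x) = 0 \<longrightarrow>
    (\<forall>s\<ge>0. energy (evolution \<omega> r s f) \<le> energy f * exp (- c * s))"
proof -
  obtain c where c: "c > 0" "\<And>h \<alpha>. (\<Sum>x\<in>UNIV. complex_of_real (p x) * h x) = 0 \<Longrightarrow>
    2 * Re (l2_inner p h (\<lambda>x. generator r h x - \<i> * complex_of_real \<alpha> * h x)) \<le> - c * energy h"
  proof -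
    obtain c where c: "c > 0" "\<forall>h f \<alpha> \<epsilon>.
      (\<Sum>x\<in>UNIV. complex_of_real (p x) * h x) = 0 \<longrightarrow> (\<forall>x. cmod (f x) \<le> \<epsilon>) \<longrightarrow>
      2 * Re (l2_inner p h (\<lambda>x. generator r h x - \<i> * complex_of_real \<alpha> * h x + f x))
        \<le> - c * energy h + \<epsilon>\<^sup>2 / c"
      using energy_dissipation by blast
    show ?thesis
      by (rule that[OF c(1)]) (use c(2)[rule_format, where \<epsilon>=0 and f="\<lambda>_. 0"] in simp)
  qed
  have "energy (evolution \<omega> r s f) \<le> energy f * exp (- c * s)"
    if mean: "(\<Sum>x\<in>UNIV. complex_of_real (p x) * f x) = 0" and s: "0 \<le> s" for f s
  proof -
    let ?h = "\<lambda>s. evolution \<omega> r s f"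
    define D where "D s = 2 * Re (l2_inner p (?h s) (\<lambda>x. generator r (?h s) x - \<i> * complex_of_real \<omega> * ?h s x))" for s
    have "((\<lambda>s. ?h s x) has_vector_derivative (generator r (?h s) x - \<i> * complex_of_real \<omega> * ?h s x)) (at s)" for s x
      using evolution_has_vector_derivative[of \<omega> r f x s UNIV]
      unfolding evolution_shifted shifted_def by simp
    then have "((\<lambda>s. energy (?h s)) has_real_derivative D s) (at s)" for s
      unfolding D_def by (intro energy_has_derivative)
    then have "((\<lambda>s. energy (?h s) * exp (c * s)) has_real_derivative (D s + c * energy (?h s)) * exp (c * s)) (at s)" for s
      by (auto intro!: derivative_eq_intros simp: algebra_simps)
    moreover have "(D s + c * energy (?h s)) * exp (c * s) \<le> 0" for s
      using c(2)[of "?h s" \<omega>, OF evolution_mean[OF mean]] unfolding D_def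
      by (intro mult_nonpos_nonneg) auto
    ultimately have "energy (?h s) * exp (c * s) \<le> energy (?h 0) * exp (c * 0)"
      using s by (intro DERIV_nonpos_imp_nonincreasing[of 0 s "\<lambda>s. energy (?h s) * exp (c * s)"]) (assumption, blast)
    moreover have "?h 0 = f" using evolution_0[of \<omega> r f] by blast
    ultimately show ?thesis by (simp add: exp_minus field_simps)
  qed
  then show ?thesis using c(1) by blast
qed

text \<open>With \<open>g\<close> the resolvent applied to \<open>f\<close>, the integrand is the
  derivative of minus the pairing of \<open>a\<close> with the evolution of \<open>g\<close>. The
  value at 0 gives the claim, and the value at infinity vanishes by decay.\<close>

lemma resolvent_integral:
  assumes \<omega>: "\<omega> \<noteq> 0" and mean: "(\<Sum>x\<in>UNIV. complex_of_real (p x) * f x) = 0"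
  shows "(\<lambda>s. l2_inner p a (evolution \<omega> r s f)) absolutely_integrable_on {0..}"
    and "integral {0..} (\<lambda>s. l2_inner p a (evolution \<omega> r s f)) =
      l2_inner p a (inv_into UNIV (shifted \<omega> (generator r)) f)"
proof -
  let ?A = "shifted \<omega> (generator r)"
  define g where "g = inv_into UNIV ?A f"
  have g: "?A g = f" unfolding g_def using bij_shifted[OF \<omega>] by (simp add: bij_is_surj surj_f_inv_f)
  \<comment> \<open>\<open>g\<close> inherits mean zero because \<open>i \<omega> - L\<close>
    multiplies the mean by \<open>i \<omega>\<close>; this is what makes \<open>?G\<close>
    decay.\<close>
  have mean_g: "(\<Sum>x\<in>UNIV. complex_of_real (p x) * g x) = 0"
    using shifted_mean[of \<omega> g] \<omega> mean unfolding g by simp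
  obtain c where c: "c > 0" "\<And>f s. (\<Sum>x\<in>UNIV. complex_of_real (p x) * f x) = 0 \<Longrightarrow> 0 \<le> s \<Longrightarrow>
      energy (evolution \<omega> r s f) \<le> energy f * exp (- c * s)"
    using evolution_decay by blast
  \<comment> \<open>The energy is quadratic, so the functions themselves decay at rate
    \<open>c / 2\<close>.\<close>
  have bound: "cmod (l2_inner p a (evolution \<omega> r s f)) \<le>
      (\<Sum>x\<in>UNIV. p x * cmod (a x) * sqrt (energy f / p x)) * exp (- (c / 2) * s)"
    if "(\<Sum>x\<in>UNIV. complex_of_real (p x) * f x) = 0" "0 \<le> s" for f s
    unfolding l2_inner_def sum_distrib_right
  proof (rule sum_norm_le)
    fix x
    have "energy (evolution \<omega> r s f) / p x \<le> energy f / p x * exp (- c * s)"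
      using c(2)[OF that] p_pos[of x] by (simp add: divide_right_mono)
    then have "sqrt (energy (evolution \<omega> r s f) / p x) \<le> sqrt (energy f / p x) * sqrt (exp (- c * s))"
      by (metis real_sqrt_le_mono real_sqrt_mult)
    also have "sqrt (exp (- c * s)) = exp (- (c / 2) * s)"
      by (rule real_sqrt_unique) (auto simp: exp_double[symmetric])
    finally have "cmod (evolution \<omega> r s f x) \<le> sqrt (energy f / p x) * exp (- (c / 2) * s)"
      using norm_le_energy[of "evolution \<omega> r s f" x] by linarith
    then show "cmod (complex_of_real (p x) * cnj (a x) * evolution \<omega> r s f x)
        \<le> p x * cmod (a x) * sqrt (energy f / p x) * exp (- (c / 2) * s)"
      using p_nonneg[of x] by (simp add: norm_mult mult.assoc mult_left_mono)
  qed
  let ?F = "\<lambda>s. l2_inner p a (evolution \<omega> r s f)"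
  let ?G = "\<lambda>s. l2_inner p a (evolution \<omega> r s g)"
  have deriv: "((\<lambda>s. l2_inner p a (evolution \<omega> r s f)) has_vector_derivative
      - l2_inner p a (evolution \<omega> r s (?A f))) (at s within S)" for f s S
  proof -
    have "((\<lambda>s. l2_inner p a (evolution \<omega> r s f)) has_vector_derivative
        (\<Sum>x\<in>UNIV. complex_of_real (p x) * cnj (a x) * - evolution \<omega> r s (?A f) x)) (at s within S)"
      unfolding l2_inner_def
      by (intro has_vector_derivative_sum has_vector_derivative_mult_right evolution_has_vector_derivative)
    then show ?thesis by (simp add: l2_inner_def sum_negf)
  qed
  have cont: "continuous_on S ?F" for S
    unfolding continuous_on_eq_continuous_within
    by (intro ballI has_vector_derivative_continuous[OF deriv])
  show int: "?F absolutely_integrable_on {0..}"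
  proof (rule measurable_bounded_by_integrable_imp_absolutely_integrable)
    show "?F \<in> borel_measurable (lebesgue_on {0..})"
      by (intro continuous_imp_measurable_on_sets_lebesgue cont) auto
    show "(\<lambda>s. (\<Sum>x\<in>UNIV. p x * cmod (a x) * sqrt (energy f / p x)) * exp (- (c / 2) * s)) integrable_on {0..}"
      using integrable_on_cmult_left[OF integrable_on_exp_minus_to_infinity[of "c / 2" 0]] c(1)
      by (simp only: of_real_eq_id id_apply half_gt_zero)
  qed (use bound[OF mean] in auto)
  have "(?F has_integral (- ?G b - - ?G 0)) {0..b}" if "0 \<le> b" for b
    using deriv[of g] that unfolding g
    by (intro fundamental_theorem_of_calculus) (auto intro!: derivative_eq_intros)
  moreover have "?G 0 = l2_inner p a g"
    unfolding l2_inner_def by (simp add: evolution_0)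
  ultimately have eq: "integral {0..b} ?F = l2_inner p a g - ?G b" if "0 \<le> b" for b
    using that by (force dest: integral_unique)
  \<comment> \<open>Absolute integrability yields the integral over the half line as a limit over
    \<open>{0..b}\<close>, taken through the Lebesgue integral.\<close>
  have "((\<lambda>b. LINT s:{0..b}|lebesgue. ?F s) \<longlongrightarrow> (LINT s:{0..}|lebesgue. ?F s)) at_top"
    using int by (intro tendsto_set_lebesgue_integral_at_top) auto
  moreover have "(LINT s:{0..}|lebesgue. ?F s) = integral {0..} ?F"
    using int by (rule set_lebesgue_integral_eq_integral)
  moreover have "(LINT s:{0..b}|lebesgue. ?F s) = integral {0..b} ?F" for b
    using int by (intro set_lebesgue_integral_eq_integral set_integrable_subset[OF int]) auto
  ultimately have lim: "((\<lambda>b. integral {0..b} ?F) \<longlongrightarrow> integral {0..} ?F) at_top" by simp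
  have "((\<lambda>b. (\<Sum>x\<in>UNIV. p x * cmod (a x) * sqrt (energy g / p x)) * exp (- (c / 2) * b)) \<longlongrightarrow> 0) at_top"
    using c(1) by (intro tendsto_mult_right_zero) real_asymp
  then have "(?G \<longlongrightarrow> 0) at_top"
    by (rule Lim_null_comparison[rotated])
      (rule eventually_mono[OF eventually_ge_at_top[of 0]], rule bound[OF mean_g])
  then have "((\<lambda>b. l2_inner p a g - ?G b) \<longlongrightarrow> l2_inner p a g) at_top"
    by (auto intro!: tendsto_eq_intros)
  then have "((\<lambda>b. integral {0..b} ?F) \<longlongrightarrow> l2_inner p a g) at_top"
    by (rule Lim_transform_eventually)
      (rule eventually_mono[OF eventually_ge_at_top[of 0]], rule eq[symmetric])
  then show "integral {0..} ?F = l2_inner p a (inv_into UNIV ?A f)"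
    using lim tendsto_unique unfolding g_def[symmetric] by force
qed

text \<open>\<open>C\<close> is chosen before \<open>h\<close>, \<open>f\<close>, \<epsilon> and
  \<open>T\<close>, so a forcing of order \<lambda> or of its square gives a solution of the same
  order. The identity \<open>h T = h 0\<close> deals with a maximum at time 0.\<close>

lemma periodic_stability: "\<exists>C\<ge>0. \<forall>h f \<epsilon> T. T > 0 \<longrightarrow> \<epsilon> \<ge> 0 \<longrightarrow> h T = h 0 \<longrightarrow>
    (\<forall>t\<ge>0. (\<Sum>x\<in>UNIV. complex_of_real (p x) * h t x) = 0) \<longrightarrow>
    (\<forall>t\<ge>0. \<forall>x. ((\<lambda>t. h t x) has_vector_derivative (generator r (h t) x + f t x)) (at t within {0..})) \<longrightarrow>
    (\<forall>t\<ge>0. \<forall>x. cmod (f t x) \<le> \<epsilon>) \<longrightarrow>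
    (\<forall>t\<ge>0. \<forall>x. cmod (h t x) \<le> C * \<epsilon>)"
proof -
  obtain c where c: "c > 0" "\<forall>h f \<alpha> \<epsilon>.
      (\<Sum>x\<in>UNIV. complex_of_real (p x) * h x) = 0 \<longrightarrow> (\<forall>x. cmod (f x) \<le> \<epsilon>) \<longrightarrow>
      2 * Re (l2_inner p h (\<lambda>x. generator r h x - \<i> * complex_of_real \<alpha> * h x + f x))
        \<le> - c * energy h + \<epsilon>\<^sup>2 / c"
    using energy_dissipation by blast
  \<comment> \<open>The maximal energy is at most \<open>(\<epsilon> / c)\<^sup>2\<close>;
    recovering the value at \<open>x\<close> costs \<open>1 / sqrt (p x)\<close>, and the sum makes
    this uniform in \<open>x\<close>.\<close>
  define C where "C = (\<Sum>x\<in>UNIV. 1 / (c * sqrt (p x)))"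
  have C_ge: "1 / (c * sqrt (p x)) \<le> C" for x
    unfolding C_def by (rule member_le_sum) (auto simp: c(1) p_nonneg less_imp_le)
  have main: "cmod (h t x) \<le> C * \<epsilon>"
    if T: "T > 0" "\<epsilon> \<ge> 0" "h T = h 0"
      and mean: "\<forall>t\<ge>0. (\<Sum>x\<in>UNIV. complex_of_real (p x) * h t x) = 0"
      and deriv: "\<forall>t\<ge>0. \<forall>x. ((\<lambda>t. h t x) has_vector_derivative (generator r (h t) x + f t x)) (at t within {0..})"
      and f: "\<forall>t\<ge>0. \<forall>x. cmod (f t x) \<le> \<epsilon>" and t: "0 \<le> t"
    for h f \<epsilon> T t x
  proof -
    define D where "D t = 2 * Re (l2_inner p (h t) (\<lambda>x. generator r (h t) x + f t x))" for t
    have D: "((\<lambda>t. energy (h t)) has_real_derivative D t) (at t within {0..})" if "0 \<le> t" for t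
      unfolding D_def using deriv that by (intro energy_has_derivative) auto
    have D_le: "D t \<le> - c * energy (h t) + \<epsilon>\<^sup>2 / c" if "0 \<le> t" for t
      using c(2)[rule_format, of "h t" "f t" \<epsilon> 0] mean f that unfolding D_def by simp
    define S where "S = max t T"
    have "continuous_on {0..S} (\<lambda>t. energy (h t))"
      by (rule DERIV_continuous_on, rule DERIV_subset[OF D]) auto
    then have "\<exists>m\<in>{0..S}. \<forall>u\<in>{0..S}. energy (h u) \<le> energy (h m)"
      using T by (intro continuous_attains_sup) (auto simp: S_def)
    then obtain m where m: "m \<in> {0..S}" "\<And>u. u \<in> {0..S} \<Longrightarrow> energy (h u) \<le> energy (h m)" by blast
    \<comment> \<open>A maximum at time 0 has no times before it; \<open>T\<close> has the same
      energy and does.\<close>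
    define m' where "m' = (if m = 0 then T else m)"
    have m': "0 < m'" "m' \<in> {0..S}" "energy (h m') = energy (h m)"
      using m T unfolding m'_def S_def by auto
    have "0 \<le> D m'"
    proof (rule ccontr)
      assume "\<not> 0 \<le> D m'"
      then obtain d where d: "d > 0" "\<forall>\<eta>>0. m' - \<eta> \<in> {0..} \<longrightarrow> \<eta> < d \<longrightarrow> energy (h m') < energy (h (m' - \<eta>))"
        using has_real_derivative_neg_dec_left[OF D, of m'] m' by auto
      define \<eta> where "\<eta> = min m' (d / 2)"
      have "energy (h m') < energy (h (m' - \<eta>))"
        using d m' unfolding \<eta>_def by auto
      moreover have "energy (h (m' - \<eta>)) \<le> energy (h m)"
        using m' d by (intro m) (auto simp: \<eta>_def)
      ultimately show False using m' by simp
    qed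
    then have "energy (h m) \<le> (\<epsilon> / c)\<^sup>2"
    proof -
      have "c * energy (h m) \<le> \<epsilon>\<^sup>2 / c" using \<open>0 \<le> D m'\<close> D_le[of m'] m' by simp
      then show ?thesis using c(1) by (simp add: field_simps power2_eq_square)
    qed
    then have "energy (h t) \<le> (\<epsilon> / c)\<^sup>2"
      using m(2)[of t] t unfolding S_def by auto
    then have "energy (h t) / p x \<le> (\<epsilon> / c)\<^sup>2 / p x"
      by (intro divide_right_mono p_nonneg)
    also have "\<dots> = (\<epsilon> / (c * sqrt (p x)))\<^sup>2"
      using p_nonneg[of x] by (simp add: power_divide power_mult_distrib)
    finally have "energy (h t) / p x \<le> (\<epsilon> / (c * sqrt (p x)))\<^sup>2" .
    then have "sqrt (energy (h t) / p x) \<le> \<epsilon> / (c * sqrt (p x))"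
      by (intro real_le_lsqrt) (use T c(1) p_nonneg[of x] in auto)
    then have "cmod (h t x) \<le> 1 / (c * sqrt (p x)) * \<epsilon>"
      using norm_le_energy[of "h t" x] by simp
    then show ?thesis using mult_right_mono[OF C_ge T(2)] order_trans by blast
  qed
  have "C \<ge> 0" unfolding C_def using c(1) p_nonneg by (intro sum_nonneg) auto
  then show ?thesis
    by (intro exI[of _ C] conjI allI impI, assumption) (rule main, assumption+)
qed

end

section \<open>Mean increments of a jump functional\<close>

text \<open>Serves for the derivative in time and for the one in \<lambda>; the latter expansion is
  available only up to \<lambda> = 1, hence the condition
  \<open>\<bar>y - x\<bar> \<le> 1\<close>.\<close>

lemma has_vector_derivative_quadratic:
  fixes F :: "real \<Rightarrow> 'a::real_normed_vector"
  assumes "\<And>y. y \<in> S \<Longrightarrow> \<bar>y - x\<bar> \<le> 1 \<Longrightarrow> norm (F y - F x - (y - x) *\<^sub>R D) \<le> C * (y - x)\<^sup>2"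
  shows "(F has_vector_derivative D) (at x within S)"
  unfolding has_vector_derivative_def has_derivative_within_alt
proof (intro conjI allI impI)
  show "bounded_linear (\<lambda>h. h *\<^sub>R D)" by (rule bounded_linear_scaleR_left)
  fix e :: real assume e: "e > 0"
  define d where "d = min 1 (e / (\<bar>C\<bar> + 1))"
  have "norm (F y - F x - (y - x) *\<^sub>R D) \<le> e * norm (y - x)" if "y \<in> S" "norm (y - x) < d" for y
  proof -
    have "norm (F y - F x - (y - x) *\<^sub>R D) \<le> C * (y - x)\<^sup>2"
      using that unfolding d_def by (intro assms) auto
    also have "\<dots> \<le> (\<bar>C\<bar> + 1) * (y - x)\<^sup>2" by (intro mult_right_mono) auto
    also have "\<dots> = ((\<bar>C\<bar> + 1) * \<bar>y - x\<bar>) * \<bar>y - x\<bar>"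
      by (simp add: power2_eq_square mult.assoc)
    also have "(\<bar>C\<bar> + 1) * \<bar>y - x\<bar> \<le> e"
      using that(2) unfolding d_def by (simp add: pos_less_divide_eq mult.commute)
    finally show ?thesis by (simp add: mult_right_mono)
  qed
  moreover have "d > 0" unfolding d_def using e by (simp add: add_nonneg_pos)
  ultimately show "\<exists>d>0. \<forall>y\<in>S. norm (y - x) < d \<longrightarrow> norm (F y - F x - (y - x) *\<^sub>R D) \<le> e * norm (y - x)"
    by blast
qed

text \<open>Fatou's lemma applied to the norms. It also gives integrability of the limit, which for
  the displacement of the lift is not known beforehand.\<close>

lemma norm_integral_limit_le:
  fixes f :: "'w \<Rightarrow> 'a::{banach, second_countable_topology}"
  assumes f: "f \<in> borel_measurable M" and u: "\<And>n. integrable M (u n)"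
    and bound: "\<And>n. (\<integral>w. norm (u n w) \<partial>M) \<le> B" and B: "0 \<le> B"
    and lim: "AE w in M. (\<lambda>n. u n w) \<longlonglongrightarrow> f w"
  shows "integrable M f" and "norm (\<integral>w. f w \<partial>M) \<le> B"
proof -
  have "(\<integral>\<^sup>+w. norm (f w) \<partial>M) = (\<integral>\<^sup>+w. liminf (\<lambda>n. ennreal (norm (u n w))) \<partial>M)"
  proof (rule nn_integral_cong_AE, use lim in eventually_elim)
    case (elim w)
    then have "(\<lambda>n. ennreal (norm (u n w))) \<longlonglongrightarrow> ennreal (norm (f w))" by (intro tendsto_intros)
    then show ?case by (rule lim_imp_Liminf[OF sequentially_bot, symmetric])
  qed
  also have "\<dots> \<le> liminf (\<lambda>n. \<integral>\<^sup>+w. norm (u n w) \<partial>M)"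
    using u by (intro nn_integral_liminf) auto
  also have "\<dots> \<le> liminf (\<lambda>n. ennreal B)"
    by (intro Liminf_mono always_eventually allI)
      (subst nn_integral_eq_integral, auto intro!: u bound ennreal_leI)
  also have "\<dots> = ennreal B" by (simp add: Liminf_const)
  finally have le: "(\<integral>\<^sup>+w. norm (f w) \<partial>M) \<le> ennreal B" .
  then show int: "integrable M f"
    using f by (intro integrableI_bounded) (auto simp: le_less_trans[OF _ ennreal_less_top])
  have "norm (\<integral>w. f w \<partial>M) \<le> (\<integral>w. norm (f w) \<partial>M)" by (rule integral_norm_bound)
  also have "\<dots> \<le> B" using le B int by (subst (asm) nn_integral_eq_integral) auto
  finally show "norm (\<integral>w. f w \<partial>M) \<le> B" .
qed

text \<open>The recursion by halving, in place of a sum over grid indices, lets telescoping and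
  error bounds go by induction on \<open>n\<close> with the interval generalised.\<close>

fun dyadic_sum :: "nat \<Rightarrow> (real \<Rightarrow> real \<Rightarrow> 'a::plus) \<Rightarrow> real \<Rightarrow> real \<Rightarrow> 'a" where
  "dyadic_sum 0 g s t = g s t"
| "dyadic_sum (Suc n) g s t = dyadic_sum n g s ((s + t) / 2) + dyadic_sum n g ((s + t) / 2) t"

lemma dyadic_sum_increments:
  fixes y :: "real \<Rightarrow> 'a::ab_group_add"
  assumes "\<And>u v. 0 \<le> u \<Longrightarrow> u \<le> v \<Longrightarrow> v \<le> T \<Longrightarrow> v - u < \<epsilon> \<Longrightarrow> g u v = y v - y u"
    and "0 \<le> s" "s \<le> t" "t \<le> T" "t - s < \<epsilon> * 2 ^ n"
  shows "dyadic_sum n g s t = y t - y s"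
  using assms(2-)
proof (induction n arbitrary: s t)
  case (Suc n)
  have "dyadic_sum n g s ((s + t) / 2) = y ((s + t) / 2) - y s"
    using Suc.prems by (intro Suc.IH) (auto simp: field_simps)
  moreover have "dyadic_sum n g ((s + t) / 2) t = y t - y ((s + t) / 2)"
    using Suc.prems by (intro Suc.IH) (auto simp: field_simps)
  ultimately show ?case by simp
qed (simp add: assms(1))

text \<open>The right-hand side of the Kolmogorov forward equation. It is linear in the rates and in
  the measure separately, and the expansion in \<lambda> uses both.\<close>

definition flux :: "('s::finite \<Rightarrow> 's \<Rightarrow> real) \<Rightarrow> ('s \<Rightarrow> real) \<Rightarrow> 's \<Rightarrow> real" where
  "flux Q \<mu> y = (\<Sum>w\<in>UNIV. \<mu> w * Q w y) - \<mu> y * (\<Sum>w\<in>UNIV. Q y w)"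

section \<open>Transition probabilities and laws for bounded rates\<close>

locale bounded_rate_chain =
  fixes M :: "'w measure" and q :: "real \<Rightarrow> 's::finite \<Rightarrow> 's \<Rightarrow> real"
    and P :: "real \<Rightarrow> real \<Rightarrow> 's \<Rightarrow> 's \<Rightarrow> real" and X :: "real \<Rightarrow> 'w \<Rightarrow> 's" and K L :: real
  assumes transition: "transition_function q P" and chain: "markov_chain M P X"
    and q_nonneg: "0 \<le> q t x y" and q_le: "q t x y \<le> K"
    and q_lipschitz: "\<bar>q s x y - q t x y\<bar> \<le> L * \<bar>s - t\<bar>"
begin

sublocale prob_space M using chain unfolding markov_chain_def by auto

lemma measurable_X [measurable]: "0 \<le> t \<Longrightarrow> X t \<in> measurable M (count_space UNIV)"
  using chain unfolding markov_chain_def by auto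

definition law :: "real \<Rightarrow> 's \<Rightarrow> real" where
  "law t x = measure M {w \<in> space M. X t w = x}"

lemma law_bounds: "0 \<le> law t x" "law t x \<le> 1" unfolding law_def by auto

lemma markov: "0 \<le> t 0 \<Longrightarrow> (\<And>i. i < m \<Longrightarrow> t i \<le> t (Suc i)) \<Longrightarrow>
    measure M {w \<in> space M. \<forall>i\<le>m. X (t i) w = x i} =
      law (t 0) (x 0) * (\<Prod>i<m. P (t i) (t (Suc i)) (x i) (x (Suc i)))"
  for t :: "nat \<Rightarrow> real"
  using chain unfolding markov_chain_def law_def by blast

lemma joint2:
  assumes "0 \<le> a" "a \<le> b"
  shows "measure M {w \<in> space M. X a w = x \<and> X b w = y} = law a x * P a b x y"
proof -
  have "{w \<in> space M. X a w = x \<and> X b w = y} =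
      {w \<in> space M. \<forall>i\<le>1. X (if i = 0 then a else b) w = (if i = (0::nat) then x else y)}"
    by (auto simp: le_Suc_eq)
  then show ?thesis
    using markov[of "\<lambda>i. if i = 0 then a else b" 1 "\<lambda>i. if i = 0 then x else y"] assms by simp
qed

lemma joint3:
  assumes "0 \<le> a" "a \<le> b" "b \<le> c"
  shows "measure M {w \<in> space M. X a w = x \<and> X b w = y \<and> X c w = z} =
    law a x * P a b x y * P b c y z"
proof -
  let ?t = "\<lambda>i::nat. if i = 0 then a else if i = 1 then b else c"
  let ?x = "\<lambda>i::nat. if i = 0 then x else if i = 1 then y else z"
  have "{w \<in> space M. X a w = x \<and> X b w = y \<and> X c w = z} = {w \<in> space M. \<forall>i\<le>2. X (?t i) w = ?x i}"
    by (auto simp: numeral_2_eq_2 le_Suc_eq)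
  then show ?thesis
    using markov[of ?t 2 ?x] assms by (simp add: numeral_2_eq_2 lessThan_Suc)
qed

lemma P_refl: "0 \<le> s \<Longrightarrow> P s s x y = (if x = y then 1 else 0)"
  using transition unfolding transition_function_def by auto

lemma P_forward: "0 \<le> s \<Longrightarrow> s \<le> t \<Longrightarrow>
    ((\<lambda>u. P s u x y) has_real_derivative flux (q t) (P s t x) y) (at t within {s..})"
  using transition unfolding transition_function_def flux_def by auto

text \<open>The transition function is only assumed to solve the forward equation. Rows starting at a state
  charged by the law are conditional probabilities, and the other rows never enter an expectation.\<close>

lemma P_bounds:
  assumes "0 < law s x" "0 \<le> s" "s \<le> t"
  shows "0 \<le> P s t x y" "P s t x y \<le> 1"
proof -
  have eq: "law s x * P s t x y = measure M {w \<in> space M. X s w = x \<and> X t w = y}"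
    using joint2 assms by simp
  then have "0 \<le> law s x * P s t x y" by simp
  then show "0 \<le> P s t x y" using assms by (simp add: zero_le_mult_iff)
  have "law s x * P s t x y \<le> law s x * 1"
    unfolding eq unfolding law_def mult_1_right
    by (rule finite_measure_mono) (use assms in auto)
  then show "P s t x y \<le> 1" using assms by simp
qed

lemma K_nonneg: "0 \<le> K" using q_nonneg q_le order_trans by blast

lemma L_nonneg: "0 \<le> L"
  using q_lipschitz[of 0 undefined undefined 1] by simp

text \<open>For weights between 0 and 1, inflow and outflow are each at most
  \<open>CARD('s) * K\<close>, so this bounds the forward equation. It serves as Lipschitz constant
  in time for laws and transition probabilities.\<close>

definition K1 :: real where "K1 = 2 * real CARD('s) * K"

lemma K1_nonneg: "0 \<le> K1" unfolding K1_def using K_nonneg by simp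

lemma q_row: "(\<Sum>w\<in>UNIV. q t y w) \<le> real CARD('s) * K" "0 \<le> (\<Sum>w\<in>UNIV. q t y w)"
  using sum_bounded_above[of UNIV "q t y" K] q_le q_nonneg by (auto intro: sum_nonneg)

lemma flux_bound:
  assumes "\<And>x. 0 \<le> \<mu> x" "\<And>x. \<mu> x \<le> 1"
  shows "\<bar>flux (q t) \<mu> y\<bar> \<le> K1"
proof -
  have "(\<Sum>w\<in>UNIV. \<mu> w * q t w y) \<le> of_nat (card (UNIV :: 's set)) * K"
    using assms q_le q_nonneg by (intro sum_bounded_above) (metis mult_mono mult_1 zero_le_one)
  moreover have "0 \<le> (\<Sum>w\<in>UNIV. \<mu> w * q t w y)"
    using assms q_nonneg by (intro sum_nonneg) auto
  moreover have "\<mu> y * (\<Sum>w\<in>UNIV. q t y w) \<le> 1 * (real CARD('s) * K)"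
    using assms q_row by (intro mult_mono) auto
  moreover have "0 \<le> \<mu> y * (\<Sum>w\<in>UNIV. q t y w)" using assms q_row by auto
  moreover have "0 \<le> real CARD('s) * K" using K_nonneg by simp
  ultimately show ?thesis unfolding flux_def K1_def by (simp add: abs_if)
qed

lemma P_continuity:
  assumes "0 < law s x" "0 \<le> s" "s \<le> t"
  shows "\<bar>P s t x y - (if x = y then 1 else 0)\<bar> \<le> K1 * (t - s)"
proof -
  have "norm (P s t x y - P s s x y) \<le> K1 * norm (t - s)"
  proof (rule field_differentiable_bound[of "{s..t}" "\<lambda>u. P s u x y" "\<lambda>u. flux (q u) (P s u x) y"])
    show "((\<lambda>u. P s u x y) has_real_derivative flux (q u) (P s u x) y) (at u within {s..t})"
      if "u \<in> {s..t}" for u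
      using P_forward[of s u x y] assms that by (auto intro: has_field_derivative_subset)
    show "norm (flux (q u) (P s u x) y) \<le> K1" if "u \<in> {s..t}" for u
      using flux_bound[of "P s u x"] P_bounds[OF assms(1,2)] that by auto
  qed (use assms in auto)
  then show ?thesis using P_refl assms by simp
qed

text \<open>The derivative of \<open>P s u x y\<close> in \<open>u\<close> differs from
  \<open>q s x y\<close> for two reasons: the row at \<open>u\<close> is within
  \<open>K1 * (t - s)\<close> of the point mass at \<open>x\<close>, which costs another factor
  \<open>K1\<close>, and the rate has moved by at most \<open>L * (t - s)\<close>.\<close>

definition K2 :: real where "K2 = K1 * K1 + L"

lemma K2_nonneg: "0 \<le> K2" unfolding K2_def using K1_nonneg L_nonneg by simp

lemma P_first_order:
  assumes "0 < law s x" "0 \<le> s" "s \<le> t" "x \<noteq> y"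
  shows "\<bar>P s t x y - (t - s) * q s x y\<bar> \<le> K2 * (t - s)\<^sup>2"
proof -
  let ?f = "\<lambda>u. P s u x y - (u - s) * q s x y"
  have "norm (?f t - ?f s) \<le> (K2 * (t - s)) * norm (t - s)"
  proof (rule field_differentiable_bound[of "{s..t}" ?f "\<lambda>u. flux (q u) (P s u x) y - q s x y"])
    show "(?f has_real_derivative flux (q u) (P s u x) y - q s x y) (at u within {s..t})"
      if "u \<in> {s..t}" for u
      using has_field_derivative_subset[OF P_forward[of s u x y]] assms that
      by (auto intro!: derivative_eq_intros)
    show "norm (flux (q u) (P s u x) y - q s x y) \<le> K2 * (t - s)" if u: "u \<in> {s..t}" for u
    proof -
      let ?d = "\<lambda>w. P s u x w - (if x = w then 1 else 0)"
      have d: "\<bar>?d w\<bar> \<le> K1 * (t - s)" for w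
        using P_continuity[of s x u w] assms u K1_nonneg
        by (smt (verit) atLeastAtMost_iff mult_left_mono)
      have "(\<Sum>w\<in>UNIV. P s u x w * q u w y) = (\<Sum>w\<in>UNIV. ?d w * q u w y) + q u x y"
        by (simp add: left_diff_distrib sum_subtractf if_distrib[of "\<lambda>a. a * _"] cong: if_cong)
      moreover have "\<bar>\<Sum>w\<in>UNIV. ?d w * q u w y\<bar> \<le> of_nat (card (UNIV :: 's set)) * (K1 * (t - s) * K)"
      proof (rule order_trans[OF sum_abs], rule sum_bounded_above)
        fix w
        show "\<bar>?d w * q u w y\<bar> \<le> K1 * (t - s) * K"
          unfolding abs_mult using d[of w] q_nonneg[of u w y] q_le[of u w y]
          by (intro mult_mono) (auto intro: order_trans[OF abs_ge_zero])
      qed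
      moreover have "\<bar>P s u x y * (\<Sum>w\<in>UNIV. q u y w)\<bar> \<le> (K1 * (t - s)) * (real CARD('s) * K)"
        unfolding abs_mult using d[of y] assms q_row[of u y]
        by (intro mult_mono) (auto intro: order_trans[OF abs_ge_zero])
      moreover have "\<bar>q u x y - q s x y\<bar> \<le> L * (t - s)"
        using q_lipschitz[of u x y s] u L_nonneg
        by (smt (verit) atLeastAtMost_iff mult_left_mono)
      ultimately have "\<bar>flux (q u) (P s u x) y - q s x y\<bar> \<le>
          real CARD('s) * (K1 * (t - s) * K) + (K1 * (t - s)) * (real CARD('s) * K) + L * (t - s)"
        unfolding flux_def by linarith
      also have "\<dots> = K2 * (t - s)" unfolding K2_def K1_def by (simp add: algebra_simps)
      finally show ?thesis by simp
    qed
  qed (use assms in auto)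
  then show ?thesis using P_refl assms by (simp add: power2_eq_square mult.assoc)
qed

lemma law_sum_joint:
  assumes "0 \<le> s" "s \<le> t"
  shows "law t y = (\<Sum>x\<in>UNIV. law s x * P s t x y)"
proof -
  have "{w \<in> space M. X t w = y} = (\<Union>x\<in>UNIV. {w \<in> space M. X s w = x \<and> X t w = y})" by auto
  then have "law t y = (\<Sum>x\<in>UNIV. measure M {w \<in> space M. X s w = x \<and> X t w = y})"
    unfolding law_def using assms
    by (simp, subst finite_measure_finite_Union) (auto simp: disjoint_family_on_def)
  then show ?thesis using joint2 assms by simp
qed

lemma law_sum: "0 \<le> t \<Longrightarrow> (\<Sum>x\<in>UNIV. law t x) = 1"
proof -
  assume t: "0 \<le> t"
  have "prob (\<Union>x\<in>UNIV. {w \<in> space M. X t w = x}) = (\<Sum>x\<in>UNIV. law t x)"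
    unfolding law_def using t by (subst finite_measure_finite_Union) (auto simp: disjoint_family_on_def)
  moreover have "(\<Union>x\<in>UNIV. {w \<in> space M. X t w = x}) = space M" by auto
  ultimately show ?thesis using prob_space by simp
qed

lemma law_forward:
  assumes "0 \<le> t"
  shows "((\<lambda>u. law u y) has_real_derivative flux (q t) (law t) y) (at t within {0..})"
proof -
  have eq: "law u y = (\<Sum>x\<in>UNIV. law 0 x * P 0 u x y)" if "0 \<le> u" for u y
    using law_sum_joint[of 0 u] that by simp
  have "((\<lambda>u. \<Sum>x\<in>UNIV. law 0 x * P 0 u x y) has_real_derivative
      (\<Sum>x\<in>UNIV. law 0 x * flux (q t) (P 0 t x) y)) (at t within {0..})"
    by (intro DERIV_sum DERIV_cmult P_forward) (use assms in auto)
  moreover have "(\<Sum>x\<in>UNIV. law 0 x * flux (q t) (P 0 t x) y) = flux (q t) (law t) y"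
  proof -
    have "(\<Sum>x\<in>UNIV. \<Sum>w\<in>UNIV. law 0 x * (P 0 t x w * q t w y)) = (\<Sum>w\<in>UNIV. law t w * q t w y)"
      by (subst sum.swap) (simp add: eq[OF assms] sum_distrib_right mult.assoc)
    moreover have "(\<Sum>x\<in>UNIV. law 0 x * (P 0 t x y * c)) = law t y * c" for c
      by (simp add: eq[OF assms] sum_distrib_right mult.assoc)
    ultimately show ?thesis unfolding flux_def
      by (simp add: right_diff_distrib sum_subtractf) (simp add: sum_distrib_left)
  qed
  ultimately have "((\<lambda>u. \<Sum>x\<in>UNIV. law 0 x * P 0 u x y) has_real_derivative flux (q t) (law t) y) (at t within {0..})"
    by simp
  then show ?thesis
    unfolding has_real_derivative_iff_has_vector_derivative
    by (rule has_vector_derivative_transform[rotated 2]) (use assms eq in auto)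
qed

lemma law_lipschitz:
  assumes "0 \<le> s" "0 \<le> t"
  shows "\<bar>law t y - law s y\<bar> \<le> K1 * \<bar>t - s\<bar>"
proof -
  have "norm (law t y - law s y) \<le> K1 * norm (t - s)"
    by (rule field_differentiable_bound[of "{0..}" "\<lambda>u. law u y" "\<lambda>u. flux (q u) (law u) y"])
      (use assms law_forward flux_bound[of "law _"] law_bounds in auto)
  then show ?thesis by simp
qed

text \<open>On a finite state space the functional is a finite combination of indicators. Taking
  \<open>b = c\<close> yields the two-time formulas used later.\<close>

lemma expectation3:
  fixes g :: "'s \<Rightarrow> 's \<Rightarrow> 's \<Rightarrow> 'e::euclidean_space"
  assumes "0 \<le> a" "a \<le> b" "b \<le> c"
  shows "integrable M (\<lambda>w. g (X a w) (X b w) (X c w))"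
    and "(\<integral>w. g (X a w) (X b w) (X c w) \<partial>M) =
      (\<Sum>x\<in>UNIV. \<Sum>y\<in>UNIV. \<Sum>z\<in>UNIV. (law a x * P a b x y * P b c y z) *\<^sub>R g x y z)"
proof -
  let ?E = "\<lambda>x y z. {w \<in> space M. X a w = x \<and> X b w = y \<and> X c w = z}"
  let ?h = "\<lambda>w. \<Sum>x\<in>UNIV. \<Sum>y\<in>UNIV. \<Sum>z\<in>UNIV. indicator (?E x y z) w *\<^sub>R g x y z"
  have E: "?E x y z \<in> sets M" for x y z
  proof -
    have [measurable]: "X a \<in> measurable M (count_space UNIV)" "X b \<in> measurable M (count_space UNIV)"
      "X c \<in> measurable M (count_space UNIV)" using assms by auto
    show ?thesis by measurable
  qed
  have eq: "g (X a w) (X b w) (X c w) = ?h w" if "w \<in> space M" for w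
  proof -
    have "?h w = (\<Sum>x\<in>UNIV. \<Sum>y\<in>UNIV. \<Sum>z\<in>UNIV. if X a w = x then if X b w = y then
        if X c w = z then g x y z else 0 else 0 else 0)"
      using that by (intro sum.cong refl) (auto simp: indicator_def)
    also have "\<dots> = (\<Sum>x\<in>UNIV. \<Sum>y\<in>UNIV. if X a w = x then if X b w = y then g x y (X c w) else 0 else 0)"
      by (intro sum.cong refl) auto
    also have "\<dots> = (\<Sum>x\<in>UNIV. if X a w = x then g x (X b w) (X c w) else 0)"
      by (intro sum.cong refl) auto
    also have "\<dots> = g (X a w) (X b w) (X c w)" by simp
    finally show ?thesis by simp
  qed
  have int: "integrable M (\<lambda>w. indicator (?E x y z) w *\<^sub>R g x y z)" for x y z
    using E by (intro integrable_scaleR_left integrable_real_indicator) (auto simp: emeasure_eq_measure)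
  have int_h: "integrable M ?h" by (intro Bochner_Integration.integrable_sum int)
  then show "integrable M (\<lambda>w. g (X a w) (X b w) (X c w))"
    using eq by (subst Bochner_Integration.integrable_cong[OF refl, of _ _ ?h]) auto
  have "(\<integral>w. g (X a w) (X b w) (X c w) \<partial>M) = (\<integral>w. ?h w \<partial>M)"
    using eq by (intro Bochner_Integration.integral_cong) auto
  also have "\<dots> = (\<Sum>x\<in>UNIV. \<Sum>y\<in>UNIV. \<Sum>z\<in>UNIV. \<integral>w. indicator (?E x y z) w *\<^sub>R g x y z \<partial>M)"
    by (simp only: Bochner_Integration.integral_sum Bochner_Integration.integrable_sum int)
  also have "\<dots> = (\<Sum>x\<in>UNIV. \<Sum>y\<in>UNIV. \<Sum>z\<in>UNIV. measure M (?E x y z) *\<^sub>R g x y z)"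
    using E by (intro sum.cong refl)
      (auto simp: emeasure_eq_measure Int_absorb2 sets.sets_into_space)
  finally show "(\<integral>w. g (X a w) (X b w) (X c w) \<partial>M) =
      (\<Sum>x\<in>UNIV. \<Sum>y\<in>UNIV. \<Sum>z\<in>UNIV. (law a x * P a b x y * P b c y z) *\<^sub>R g x y z)"
    using joint3[OF assms] by simp
qed

text \<open>Two changes of state cost two factors \<open>K1 * (c - a)\<close>. The estimate for the
  second row requires \<open>y\<close> to be charged at time \<open>b\<close>, which a nonzero first
  product ensures.\<close>

lemma two_jumps:
  assumes "0 \<le> a" "a \<le> b" "b \<le> c" "x \<noteq> y" "y \<noteq> z"
  shows "\<bar>law a x * P a b x y * P b c y z\<bar> \<le> (K1 * (c - a))\<^sup>2"
proof (cases "law a x * P a b x y = 0")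
  case False
  have ax: "0 < law a x" using False law_bounds(1)[of a x] by (cases "law a x = 0") auto
  have "0 < law a x * P a b x y"
    using False joint2[OF assms(1,2), of x y] measure_nonneg[of M] by (metis less_eq_real_def)
  also have "law a x * P a b x y \<le> law b y"
    unfolding joint2[OF assms(1,2), symmetric] unfolding law_def
    using assms by (intro finite_measure_mono) auto
  finally have "0 < law b y" .
  then have "\<bar>P b c y z\<bar> \<le> K1 * (c - b)" using P_continuity[of b y c z] assms by auto
  also have "\<dots> \<le> K1 * (c - a)" using assms K1_nonneg by (intro mult_left_mono) auto
  finally have 1: "\<bar>P b c y z\<bar> \<le> K1 * (c - a)" .
  have "\<bar>P a b x y\<bar> \<le> K1 * (b - a)" using P_continuity[OF ax, of b y] assms by auto
  also have "\<dots> \<le> K1 * (c - a)" using assms K1_nonneg by (intro mult_left_mono) auto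
  finally have "\<bar>law a x * P a b x y\<bar> \<le> 1 * (K1 * (c - a))"
    unfolding abs_mult using law_bounds[of a x] by (intro mult_mono) auto
  then have "\<bar>law a x * P a b x y\<bar> * \<bar>P b c y z\<bar> \<le> (K1 * (c - a)) * (K1 * (c - a))"
    using 1 by (intro mult_mono) (auto intro: order_trans[OF abs_ge_zero])
  then show ?thesis by (simp add: abs_mult power2_eq_square)
qed auto

end

text \<open>\<open>\<phi>\<close> is meant to infer the displacement over a cell from the states at
  its two ends, which is correct when the cell contains at most one jump.\<close>

locale chain_increment = bounded_rate_chain +
  fixes \<phi> :: "'b \<Rightarrow> 'b \<Rightarrow> 'e::euclidean_space" and B :: real
  assumes \<phi>_refl: "\<phi> x x = 0" and \<phi>_le: "norm (\<phi> x y) \<le> B"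
begin

lemma B_nonneg: "0 \<le> B" using \<phi>_refl[of undefined] \<phi>_le[of undefined undefined] by simp

definition mean_rate :: "real \<Rightarrow> 'e" where
  "mean_rate t = (\<Sum>x\<in>UNIV. \<Sum>y\<in>UNIV. (law t x * q t x y) *\<^sub>R \<phi> x y)"

text \<open>There are \<open>CARD('b) ^ 3\<close> triples of states; each defect has three terms of
  size \<open>B\<close> and requires two changes of state.\<close>

definition K3 :: real where "K3 = real CARD('b) ^ 3 * (3 * B * K1\<^sup>2)"

lemma K3_nonneg: "0 \<le> K3" unfolding K3_def using B_nonneg by simp

text \<open>If \<open>x = y\<close> or \<open>y = z\<close>, the defect vanishes by
  \<open>\<phi>_refl\<close>, so only triples with two changes of state contribute.\<close>

lemma refinement_error:
  assumes "0 \<le> a" "a \<le> b" "b \<le> c"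
  shows "(\<integral>w. norm (\<phi> (X a w) (X b w) + \<phi> (X b w) (X c w) - \<phi> (X a w) (X c w)) \<partial>M) \<le> K3 * (c - a)\<^sup>2"
proof -
  let ?g = "\<lambda>x y z. norm (\<phi> x y + \<phi> y z - \<phi> x z)"
  have term_le: "(law a x * P a b x y * P b c y z) *\<^sub>R ?g x y z \<le> 3 * B * (K1 * (c - a))\<^sup>2" for x y z
  proof (cases "x = y \<or> y = z")
    case False
    have "?g x y z \<le> norm (\<phi> x y) + norm (\<phi> y z) + norm (\<phi> x z)"
      by (meson add_mono norm_triangle_ineq norm_triangle_ineq4 order_refl order_trans)
    also have "\<dots> \<le> 3 * B" using \<phi>_le[of x y] \<phi>_le[of y z] \<phi>_le[of x z] by simp
    finally have "\<bar>law a x * P a b x y * P b c y z\<bar> * ?g x y z \<le> (K1 * (c - a))\<^sup>2 * (3 * B)"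
      using two_jumps[OF assms, of x y z] False by (intro mult_mono) auto
    moreover have "(law a x * P a b x y * P b c y z) *\<^sub>R ?g x y z \<le> \<bar>law a x * P a b x y * P b c y z\<bar> * ?g x y z"
      by (simp add: mult_right_mono)
    ultimately show ?thesis by (simp add: mult_ac)
  qed (use \<phi>_refl B_nonneg in auto)
  have "(\<Sum>x\<in>UNIV. \<Sum>y\<in>UNIV. \<Sum>z\<in>UNIV. (law a x * P a b x y * P b c y z) *\<^sub>R ?g x y z)
      \<le> (\<Sum>x\<in>(UNIV::'b set). \<Sum>y\<in>(UNIV::'b set). \<Sum>z\<in>(UNIV::'b set). 3 * B * (K1 * (c - a))\<^sup>2)"
    by (intro sum_mono term_le)
  also have "\<dots> = K3 * (c - a)\<^sup>2" unfolding K3_def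
    by (simp add: power_mult_distrib power3_eq_cube)
  finally show ?thesis using expectation3(2)[OF assms, of ?g] by simp
qed

abbreviation approx :: "nat \<Rightarrow> real \<Rightarrow> real \<Rightarrow> 'a \<Rightarrow> 'e" where
  "approx n s t w \<equiv> dyadic_sum n (\<lambda>a b. \<phi> (X a w) (X b w)) s t"

lemma integrable_\<phi>: "0 \<le> s \<Longrightarrow> s \<le> t \<Longrightarrow> integrable M (\<lambda>w. \<phi> (X s w) (X t w))"
  using expectation3(1)[of s t t "\<lambda>x y z. \<phi> x y"] by simp

lemma integrable_approx: "0 \<le> s \<Longrightarrow> s \<le> t \<Longrightarrow> integrable M (approx n s t)"
proof (induction n arbitrary: s t)
  case (Suc n)
  have "0 \<le> (s + t) / 2" "s \<le> (s + t) / 2" "(s + t) / 2 \<le> t" using Suc.prems by auto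
  then show ?case using Suc by (simp add: Bochner_Integration.integrable_add)
qed (simp add: integrable_\<phi>)

text \<open>The constant reproduces itself, as \<open>2 * (2 * K3 * (h / 2)\<^sup>2) + K3 * h\<^sup>2 = 2 * K3 * h\<^sup>2\<close>.\<close>

lemma approx_error:
  assumes "0 \<le> s" "s \<le> t"
  shows "(\<integral>w. norm (approx n s t w - \<phi> (X s w) (X t w)) \<partial>M) \<le> 2 * K3 * (t - s)\<^sup>2"
  using assms
proof (induction n arbitrary: s t)
  case (Suc n)
  define m where "m = (s + t) / 2"
  have m: "0 \<le> s" "s \<le> m" "m \<le> t" "0 \<le> m" "s \<le> t" "m - s = (t - s) / 2" "t - m = (t - s) / 2"
    using Suc.prems by (auto simp: m_def field_simps)
  note int = integrable_approx integrable_\<phi> m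
  have "(\<integral>w. norm (approx (Suc n) s t w - \<phi> (X s w) (X t w)) \<partial>M)
      \<le> (\<integral>w. norm (approx n s m w - \<phi> (X s w) (X m w)) + norm (approx n m t w - \<phi> (X m w) (X t w))
        + norm (\<phi> (X s w) (X m w) + \<phi> (X m w) (X t w) - \<phi> (X s w) (X t w)) \<partial>M)"
  proof (rule integral_mono)
    show "norm (approx (Suc n) s t w - \<phi> (X s w) (X t w)) \<le>
        norm (approx n s m w - \<phi> (X s w) (X m w)) + norm (approx n m t w - \<phi> (X m w) (X t w))
        + norm (\<phi> (X s w) (X m w) + \<phi> (X m w) (X t w) - \<phi> (X s w) (X t w))" for w
      unfolding dyadic_sum.simps m_def[symmetric]
      by (rule order_trans[OF _ add_right_mono[OF norm_triangle_ineq]], rule order_trans[OF _ norm_triangle_ineq])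
        (simp add: algebra_simps)
  qed (use int in \<open>auto simp: m_def[symmetric]\<close>)
  also have "\<dots> = (\<integral>w. norm (approx n s m w - \<phi> (X s w) (X m w)) \<partial>M)
      + (\<integral>w. norm (approx n m t w - \<phi> (X m w) (X t w)) \<partial>M)
      + (\<integral>w. norm (\<phi> (X s w) (X m w) + \<phi> (X m w) (X t w) - \<phi> (X s w) (X t w)) \<partial>M)"
    using int by (simp add: Bochner_Integration.integral_add)
  also have "\<dots> \<le> 2 * K3 * (m - s)\<^sup>2 + 2 * K3 * (t - m)\<^sup>2 + K3 * (t - s)\<^sup>2"
    using m by (intro add_mono Suc.IH refinement_error) auto
  also have "\<dots> = 2 * K3 * (t - s)\<^sup>2" unfolding m by (simp add: power2_eq_square field_simps)
  finally show ?case .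
qed (use K3_nonneg in simp)

definition K4 :: real where "K4 = real CARD('b) ^ 2 * (K2 * B)"

lemma mean_increment:
  assumes "0 \<le> s" "s \<le> t"
  shows "norm ((\<integral>w. \<phi> (X s w) (X t w) \<partial>M) - (t - s) *\<^sub>R mean_rate s) \<le> K4 * (t - s)\<^sup>2"
proof -
  have "(\<integral>w. \<phi> (X s w) (X t w) \<partial>M) = (\<Sum>x\<in>UNIV. \<Sum>y\<in>UNIV. (law s x * P s t x y) *\<^sub>R \<phi> x y)"
    using expectation3(2)[of s t t "\<lambda>x y z. \<phi> x y"] assms P_refl[of t]
    by (simp add: if_distrib[of "\<lambda>a. (_ * a) *\<^sub>R _"] cong: if_cong)
  then have "(\<integral>w. \<phi> (X s w) (X t w) \<partial>M) - (t - s) *\<^sub>R mean_rate s =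
      (\<Sum>x\<in>UNIV. \<Sum>y\<in>UNIV. (law s x * (P s t x y - (t - s) * q s x y)) *\<^sub>R \<phi> x y)"
    unfolding mean_rate_def
    by (simp add: scaleR_sum_right sum_subtractf[symmetric] algebra_simps)
  also have "norm \<dots> \<le> (\<Sum>x\<in>(UNIV::'b set). \<Sum>y\<in>(UNIV::'b set). (K2 * (t - s)\<^sup>2) * B)"
  proof (intro sum_norm_le)
    fix x y
    show "norm ((law s x * (P s t x y - (t - s) * q s x y)) *\<^sub>R \<phi> x y) \<le> K2 * (t - s)\<^sup>2 * B"
    \<comment> \<open>The diagonal drops out as \<open>\<phi> x x = 0\<close>, and uncharged states
      have weight 0; to all others \<open>P_first_order\<close> applies.\<close>
    proof (cases "x = y \<or> law s x = 0")
      case False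
      then have "\<bar>law s x * (P s t x y - (t - s) * q s x y)\<bar> \<le> 1 * (K2 * (t - s)\<^sup>2)"
        unfolding abs_mult using law_bounds[of s x] assms
        by (intro mult_mono P_first_order) auto
      then show ?thesis unfolding norm_scaleR using \<phi>_le[of x y]
        by (intro mult_mono) (auto simp: K2_nonneg)
    qed (use \<phi>_refl B_nonneg K2_nonneg in auto)
  qed
  also have "\<dots> = K4 * (t - s)\<^sup>2" unfolding K4_def by (simp add: power2_eq_square)
  finally show ?thesis .
qed

text \<open>\<open>mean_increment\<close> is anchored at the left endpoint. For a derivative from
  the left the rate has to be moved to the right endpoint, and this bounds the cost.\<close>

lemma mean_rate_lipschitz:
  assumes "0 \<le> s" "0 \<le> t"
  shows "norm (mean_rate t - mean_rate s) \<le> real CARD('b) ^ 2 * ((K1 * K + L) * B) * \<bar>t - s\<bar>"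
proof -
  have "mean_rate t - mean_rate s = (\<Sum>x\<in>UNIV. \<Sum>y\<in>UNIV. (law t x * q t x y - law s x * q s x y) *\<^sub>R \<phi> x y)"
    unfolding mean_rate_def by (simp add: sum_subtractf[symmetric] scaleR_diff_left)
  also have "norm \<dots> \<le> (\<Sum>x\<in>(UNIV::'b set). \<Sum>y\<in>(UNIV::'b set). ((K1 * K + L) * \<bar>t - s\<bar>) * B)"
  proof (intro sum_norm_le)
    fix x y
    have "law t x * q t x y - law s x * q s x y = (law t x - law s x) * q t x y + law s x * (q t x y - q s x y)"
      by (simp add: algebra_simps)
    moreover have "\<bar>(law t x - law s x) * q t x y\<bar> \<le> (K1 * \<bar>t - s\<bar>) * K"
      unfolding abs_mult using law_lipschitz[OF assms] q_nonneg[of t x y] q_le[of t x y] K1_nonneg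
      by (intro mult_mono) auto
    moreover have "\<bar>law s x * (q t x y - q s x y)\<bar> \<le> 1 * (L * \<bar>t - s\<bar>)"
      unfolding abs_mult using law_bounds[of s x] q_lipschitz by (intro mult_mono) auto
    ultimately have "\<bar>law t x * q t x y - law s x * q s x y\<bar> \<le> (K1 * K + L) * \<bar>t - s\<bar>"
      by (simp add: algebra_simps)
    then show "norm ((law t x * q t x y - law s x * q s x y) *\<^sub>R \<phi> x y) \<le> ((K1 * K + L) * \<bar>t - s\<bar>) * B"
      unfolding norm_scaleR using \<phi>_le[of x y] by (intro mult_mono) (auto intro: order_trans[OF abs_ge_zero])
  qed
  also have "\<dots> = real CARD('b) ^ 2 * ((K1 * K + L) * B) * \<bar>t - s\<bar>"
    by (simp add: power2_eq_square)
  finally show ?thesis .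
qed

text \<open>The mesh \<open>\<epsilon>\<close> in \<open>path\<close> depends on \<open>w\<close>,
  so the dyadic sums reach the true increment only almost surely and without a uniform rate. The
  bound on their mean error, uniform in \<open>n\<close>, still carries over to the limit.\<close>

lemma mean_has_vector_derivative:
  fixes Y :: "real \<Rightarrow> 'a \<Rightarrow> 'e"
  assumes meas: "\<And>t. 0 \<le> t \<Longrightarrow> Y t \<in> borel_measurable M" and int0: "integrable M (Y 0)"
    and path: "AE w in M. \<forall>T. \<exists>\<epsilon>>0. \<forall>u v. 0 \<le> u \<longrightarrow> u \<le> v \<longrightarrow> v \<le> T \<longrightarrow> v - u < \<epsilon> \<longrightarrow>
        \<phi> (X u w) (X v w) = Y v w - Y u w"
    and t: "0 \<le> t"
  shows "((\<lambda>u. \<integral>w. Y u w \<partial>M) has_vector_derivative mean_rate t) (at t within {0..})"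
proof -
  have lim: "AE w in M. (\<lambda>n. approx n s t w - \<phi> (X s w) (X t w)) \<longlonglongrightarrow> Y t w - Y s w - \<phi> (X s w) (X t w)"
    if st: "0 \<le> s" "s \<le> t" for s t
    using path
  proof eventually_elim
    case (elim w)
    then obtain \<epsilon> where \<epsilon>: "\<epsilon> > 0" "\<And>u v. 0 \<le> u \<Longrightarrow> u \<le> v \<Longrightarrow> v \<le> t \<Longrightarrow> v - u < \<epsilon> \<Longrightarrow>
        \<phi> (X u w) (X v w) = Y v w - Y u w" by blast
    \<comment> \<open>Beyond \<open>N\<close> the cells are shorter than \<open>\<epsilon>\<close>,
      and the sums telescope exactly.\<close>
    obtain N where N: "(t - s) / \<epsilon> < 2 ^ N" using real_arch_pow[of 2 "(t - s) / \<epsilon>"] by auto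
    have "approx n s t w = Y t w - Y s w" if "N \<le> n" for n
    proof (rule dyadic_sum_increments[of t \<epsilon>])
      have "(2::real) ^ N \<le> 2 ^ n" using that by simp
      then have "(t - s) / \<epsilon> < 2 ^ n" using N by linarith
      then show "t - s < \<epsilon> * 2 ^ n" using \<epsilon>(1) by (simp add: pos_divide_less_eq mult.commute)
    qed (use \<epsilon> st in auto)
    then have "\<forall>\<^sub>F n in sequentially. approx n s t w - \<phi> (X s w) (X t w) = Y t w - Y s w - \<phi> (X s w) (X t w)"
      by (intro eventually_sequentiallyI[of N]) simp
    then show ?case by (rule tendsto_eventually)
  qed
  have defect: "integrable M (\<lambda>w. Y t w - Y s w - \<phi> (X s w) (X t w))"
    "norm (\<integral>w. Y t w - Y s w - \<phi> (X s w) (X t w) \<partial>M) \<le> 2 * K3 * (t - s)\<^sup>2"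
    if st: "0 \<le> s" "s \<le> t" for s t
  proof -
    have m: "(\<lambda>w. Y t w - Y s w - \<phi> (X s w) (X t w)) \<in> borel_measurable M"
      using meas[of s] meas[of t] integrable_\<phi>[OF st] st by auto
    have i: "integrable M (\<lambda>w. approx n s t w - \<phi> (X s w) (X t w))" for n
      using integrable_approx[OF st] integrable_\<phi>[OF st] by auto
    show "integrable M (\<lambda>w. Y t w - Y s w - \<phi> (X s w) (X t w))"
      "norm (\<integral>w. Y t w - Y s w - \<phi> (X s w) (X t w) \<partial>M) \<le> 2 * K3 * (t - s)\<^sup>2"
      using norm_integral_limit_le[OF m i approx_error[OF st] _ lim[OF st]] K3_nonneg by auto
  qed
  have int: "integrable M (Y t)" if "0 \<le> t" for t
  proof -
    \<comment> \<open>Integrability of \<open>Y t\<close> is recovered from the defect, the starting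
      point and the bounded functional \<open>\<phi>\<close>.\<close>
    have "integrable M (\<lambda>w. (Y t w - Y 0 w - \<phi> (X 0 w) (X t w)) + Y 0 w + \<phi> (X 0 w) (X t w))"
      using defect(1)[of 0 t] int0 integrable_\<phi>[of 0 t] that
      by (intro Bochner_Integration.integrable_add) auto
    then show ?thesis by simp
  qed
  let ?F = "\<lambda>u. \<integral>w. Y u w \<partial>M"
  define C where "C = 2 * K3 + K4"
  define D where "D = real CARD('b) ^ 2 * ((K1 * K + L) * B)"
  have D: "0 \<le> D" unfolding D_def using K1_nonneg K_nonneg L_nonneg B_nonneg by simp
  have step: "norm (?F t - ?F s - (t - s) *\<^sub>R mean_rate s) \<le> C * (t - s)\<^sup>2" if st: "0 \<le> s" "s \<le> t" for s t
  proof -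
    have "?F t - ?F s - (t - s) *\<^sub>R mean_rate s = (\<integral>w. Y t w - Y s w - \<phi> (X s w) (X t w) \<partial>M)
        + ((\<integral>w. \<phi> (X s w) (X t w) \<partial>M) - (t - s) *\<^sub>R mean_rate s)"
      using int[of s] int[of t] integrable_\<phi>[OF st] st by simp
    also have "norm \<dots> \<le> 2 * K3 * (t - s)\<^sup>2 + K4 * (t - s)\<^sup>2"
      by (intro norm_triangle_le add_mono defect mean_increment st)
    finally show ?thesis unfolding C_def by (simp add: algebra_simps)
  qed
  show ?thesis
  proof (rule has_vector_derivative_quadratic[where C = "C + D"])
    fix y assume y: "y \<in> {0::real..}"
    show "norm (?F y - ?F t - (y - t) *\<^sub>R mean_rate t) \<le> (C + D) * (y - t)\<^sup>2"
    proof (cases "t \<le> y")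
      case True
      have "0 \<le> D * (y - t)\<^sup>2" using D by simp
      then show ?thesis using step[OF t True] unfolding distrib_right by linarith
    next
      case False
      \<comment> \<open>To the left of \<open>t\<close> the expansion starts at \<open>y\<close>,
        and \<open>mean_rate y\<close> is exchanged for \<open>mean_rate t\<close>.\<close>
      have "?F y - ?F t - (y - t) *\<^sub>R mean_rate t =
          - (?F t - ?F y - (t - y) *\<^sub>R mean_rate y) + (t - y) *\<^sub>R (mean_rate t - mean_rate y)"
        by (simp add: algebra_simps)
      also have "norm \<dots> \<le> C * (t - y)\<^sup>2 + (t - y) * (D * \<bar>t - y\<bar>)"
        using False step[of y t] mean_rate_lipschitz[of y t] y t unfolding D_def[symmetric]
        by (intro norm_triangle_le add_mono) (auto simp: norm_minus_cancel intro!: mult_left_mono simp del: minus_diff_eq)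
      also have "\<dots> = (C + D) * (y - t)\<^sup>2" using False by (simp add: power2_eq_square algebra_simps)
      finally show ?thesis .
    qed
  qed
qed

end

section \<open>Perturbed rates and lifted paths\<close>

lemma of_int_mod_ring_uminus: "of_int_mod_ring (- z) = - of_int_mod_ring z"
  by (transfer) (simp add: zmod_zminus1_eq_if)

lemma pr_uminus: "pr (- z) = - pr z"
  unfolding pr_def by (simp add: vec_eq_iff of_int_mod_ring_uminus)

lemma real_vec_uminus: "real_vec (- z) = - real_vec z"
  unfolding real_vec_def by (simp add: vec_eq_iff)

lemma real_vec_add: "real_vec (y + z) = real_vec y + real_vec z"
  unfolding real_vec_def by (simp add: vec_eq_iff)

text \<open>Zero on the diagonal by decree, since \<open>Z\<close> may contain a vector with
  \<open>pr z = 0\<close>, which the projected walk does not see. Off the diagonal injectivity of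
  \<open>pr\<close> leaves at most one term, so the sum selects the jump without a choice
  operator.\<close>

definition jump_vec ::
    "(int ^ 'd) set \<Rightarrow> ('n::finite, 'd::finite) torus \<Rightarrow> ('n, 'd) torus \<Rightarrow> real ^ 'd" where
  "jump_vec Z a b = (if a = b then 0 else \<Sum>z\<in>{z \<in> Z. b = a + pr z}. real_vec z)"

lemma jump_vec_refl: "jump_vec Z a a = 0"
  unfolding jump_vec_def by simp

lemma jump_vec_pr:
  assumes "inj_on (pr :: int ^ 'd \<Rightarrow> ('n::finite, 'd::finite) torus) Z" "z \<in> Z"
    "(a :: ('n, 'd) torus) \<noteq> a + pr z"
  shows "jump_vec Z a (a + pr z) = real_vec z"
proof -
  have "{z' \<in> Z. a + pr z = a + pr z'} = {z}"
    using assms(1,2) by (auto simp: inj_on_def)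
  then show ?thesis using assms(3) unfolding jump_vec_def by simp
qed

text \<open>Right continuity and left limits leave room for at most one jump in a small ball around
  \<open>c\<close>, namely at \<open>c\<close> itself. At 0 only the right side exists.\<close>

lemma lifted_path_local:
  fixes x :: "real \<Rightarrow> ('n::finite, 'd::finite) torus"
  assumes inj: "inj_on (pr :: int ^ 'd \<Rightarrow> ('n, 'd) torus) Z" and lift: "lifted_path Z x y" and c: "0 \<le> c"
  shows "\<exists>\<delta>>0. \<forall>u v. 0 \<le> u \<longrightarrow> u \<le> v \<longrightarrow> u \<in> ball c \<delta> \<longrightarrow> v \<in> ball c \<delta> \<longrightarrow>
    jump_vec Z (x u) (x v) = real_vec (y v) - real_vec (y u)"
proof -
  have pr_y: "pr (y t) = x t" if "0 \<le> t" for t using lift that unfolding lifted_path_def by blast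
  obtain b where b: "c < b" "\<And>s. c < s \<Longrightarrow> s < b \<Longrightarrow> y s = y c"
    using lift c unfolding lifted_path_def eventually_at_right_field by blast
  then have right: "y s = y c \<and> x s = x c" if "c \<le> s" "s < b" for s
    using that c pr_y[of s] pr_y[of c] by (cases "s = c") auto
  show ?thesis
  proof (cases "c = 0")
    case True
    have "jump_vec Z (x u) (x v) = real_vec (y v) - real_vec (y u)"
      if "0 \<le> u" "u \<le> v" "v \<in> ball c b" for u v
      using right[of u] right[of v] that True by (auto simp: dist_real_def jump_vec_refl)
    then show ?thesis using b(1) True by blast
  next
    case False
    then have c: "0 < c" using c by simp
    then obtain a b' where left: "\<forall>\<^sub>F s in at_left c. x s = a \<and> y s = b'"
      and jump: "if x c = a then y c = b' else (\<exists>z\<in>Z. x c = a + pr z \<and> y c = b' + z)"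
      using lift unfolding lifted_path_def by blast
    obtain l where l: "l < c" "\<And>s. l < s \<Longrightarrow> s < c \<Longrightarrow> x s = a \<and> y s = b'"
      using left unfolding eventually_at_left_field by blast
    \<comment> \<open>The only increment across the jump: from the left limits \<open>a\<close>,
      \<open>b'\<close> to the values at \<open>c\<close>.\<close>
    have at: "jump_vec Z a (x c) = real_vec (y c) - real_vec b'"
    proof (cases "x c = a")
      case False
      then obtain z where "z \<in> Z" "x c = a + pr z" "y c = b' + z" using jump by auto
      then show ?thesis using jump_vec_pr[OF inj, of z a] False by (simp add: real_vec_add)
    qed (use jump in \<open>simp add: jump_vec_refl\<close>)
    define \<delta> where "\<delta> = min (b - c) (c - l)"
    have "jump_vec Z (x u) (x v) = real_vec (y v) - real_vec (y u)"
      if "u \<le> v" "u \<in> ball c \<delta>" "v \<in> ball c \<delta>" for u v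
    proof -
      have u: "l < u" "v < b" using that(2,3) unfolding \<delta>_def by (auto simp: dist_real_def)
      consider "v < c" | "u < c" "c \<le> v" | "c \<le> u" by linarith
      then show ?thesis
        using u l(2)[of u] l(2)[of v] right[of u] right[of v] that(1) at
        by cases (auto simp: jump_vec_refl)
    qed
    moreover have "0 < \<delta>" unfolding \<delta>_def using b l by simp
    ultimately show ?thesis by blast
  qed
qed

text \<open>A Lebesgue number for the cover of \<open>{0..T}\<close> by the balls of
  \<open>lifted_path_local\<close> places any two sufficiently close times in a common ball.\<close>

lemma lifted_path_increments:
  fixes x :: "real \<Rightarrow> ('n::finite, 'd::finite) torus"
  assumes inj: "inj_on (pr :: int ^ 'd \<Rightarrow> ('n, 'd) torus) Z" and lift: "lifted_path Z x y"
  shows "\<exists>\<epsilon>>0. \<forall>u v. 0 \<le> u \<longrightarrow> u \<le> v \<longrightarrow> v \<le> T \<longrightarrow> v - u < \<epsilon> \<longrightarrow>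
    jump_vec Z (x u) (x v) = real_vec (y v) - real_vec (y u)"
proof -
  obtain \<delta> where \<delta>: "\<And>c. 0 \<le> c \<Longrightarrow> 0 < \<delta> c" "\<And>c u v. 0 \<le> c \<Longrightarrow> 0 \<le> u \<Longrightarrow> u \<le> v \<Longrightarrow>
      u \<in> ball c (\<delta> c) \<Longrightarrow> v \<in> ball c (\<delta> c) \<Longrightarrow> jump_vec Z (x u) (x v) = real_vec (y v) - real_vec (y u)"
    using lifted_path_local[OF assms] by metis
  have "{0..T} \<subseteq> \<Union> ((\<lambda>c. ball c (\<delta> c)) ` {0..T})" using \<delta>(1) by force
  then obtain \<epsilon> where \<epsilon>: "0 < \<epsilon>"
    "\<And>u. u \<in> {0..T} \<Longrightarrow> \<exists>G\<in>(\<lambda>c. ball c (\<delta> c)) ` {0..T}. ball u \<epsilon> \<subseteq> G"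
    by (rule Heine_Borel_lemma[of "{0..T}", rotated]) auto
  have "jump_vec Z (x u) (x v) = real_vec (y v) - real_vec (y u)"
    if uv: "0 \<le> u" "u \<le> v" "v \<le> T" "v - u < \<epsilon>" for u v
  proof -
    obtain c where c: "c \<in> {0..T}" "ball u \<epsilon> \<subseteq> ball c (\<delta> c)" using \<epsilon>(2)[of u] uv by auto
    have "u \<in> ball u \<epsilon>" "v \<in> ball u \<epsilon>" using uv \<epsilon>(1) by (auto simp: dist_real_def)
    then have "u \<in> ball c (\<delta> c)" "v \<in> ball c (\<delta> c)" using c(2) by blast+
    then show ?thesis using \<delta>(2)[of c u v] c(1) uv by simp
  qed
  then show ?thesis using \<epsilon>(1) by blast
qed

text \<open>Exchanges the target state for the jump vector as summation index. A general additive
  \<open>F\<close> covers both total rates and rates weighted by displacement vectors.\<close>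

lemma fiber_sum:
  fixes c :: "int ^ 'd \<Rightarrow> 'a::real_vector" and x :: "('n::finite, 'd::finite) torus"
  assumes "finite Z" and F: "\<And>y. Modules.additive (F y)"
  shows "(\<Sum>y\<in>UNIV. F y (\<Sum>z\<in>{z \<in> Z. y = x + pr z}. c z)) = (\<Sum>z\<in>Z. F (x + pr z) (c z))"
proof -
  have "(\<Sum>y\<in>UNIV. F y (\<Sum>z\<in>{z \<in> Z. y = x + pr z}. c z))
      = (\<Sum>y\<in>UNIV. \<Sum>z\<in>Z. if y = x + pr z then F y (c z) else 0)"
  proof (intro sum.cong refl)
    fix y
    have "F y (\<Sum>z\<in>{z \<in> Z. y = x + pr z}. c z) = (\<Sum>z\<in>{z \<in> Z. y = x + pr z}. F y (c z))"
      using F by (rule Modules.additive.sum)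
    also have "\<dots> = (\<Sum>z\<in>Z. if y = x + pr z then F y (c z) else 0)"
      using assms by (intro sum.inter_filter)
    finally show "F y (\<Sum>z\<in>{z \<in> Z. y = x + pr z}. c z) = (\<Sum>z\<in>Z. if y = x + pr z then F y (c z) else 0)" .
  qed
  then show ?thesis by (subst (asm) sum.swap) simp
qed

section \<open>Estimates for the exponential weights\<close>

lemma exp_cos_lipschitz: "\<bar>exp (b * cos (\<omega> * s)) - exp (b * cos (\<omega> * t))\<bar> \<le> exp \<bar>b\<bar> * \<bar>b * \<omega>\<bar> * \<bar>s - t\<bar>"
  for b \<omega> s t :: real
proof -
  have "norm (exp (b * cos (\<omega> * s)) - exp (b * cos (\<omega> * t))) \<le> (exp \<bar>b\<bar> * \<bar>b * \<omega>\<bar>) * norm (s - t)"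
  proof (rule field_differentiable_bound[of UNIV])
    show "((\<lambda>t. exp (b * cos (\<omega> * t))) has_real_derivative
        exp (b * cos (\<omega> * t)) * (- (b * \<omega>) * sin (\<omega> * t))) (at t within UNIV)" for t
      by (auto intro!: derivative_eq_intros)
    show "norm (exp (b * cos (\<omega> * t)) * (- (b * \<omega>) * sin (\<omega> * t))) \<le> exp \<bar>b\<bar> * \<bar>b * \<omega>\<bar>" for t
    proof -
      have "\<bar>b * cos (\<omega> * t)\<bar> \<le> \<bar>b\<bar>"
        unfolding abs_mult by (rule mult_left_le) auto
      then have "exp (b * cos (\<omega> * t)) \<le> exp \<bar>b\<bar>" by simp
      moreover have "\<bar>- (b * \<omega>) * sin (\<omega> * t)\<bar> \<le> \<bar>b * \<omega>\<bar>"
        unfolding abs_mult[of "- (b * \<omega>)"] abs_minus_cancel by (rule mult_left_le) auto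
      ultimately show ?thesis unfolding real_norm_def abs_mult[of "exp _"] abs_exp_cancel
        by (rule mult_mono) auto
    qed
  qed auto
  then show ?thesis by simp
qed

text \<open>The factor \<open>(1 + \<bar>b\<bar>)\<^sup>2\<close> dominates
  \<open>\<bar>b\<bar>\<close> and \<open>b\<^sup>2\<close> at once, so both orders of the expansion
  share one constant.\<close>

lemma exp_remainder:
  fixes b l :: real
  assumes "0 \<le> l" "l \<le> 1"
  shows "\<bar>exp (l * b) - 1\<bar> \<le> exp \<bar>b\<bar> * (1 + \<bar>b\<bar>)\<^sup>2 * l"
    and "\<bar>exp (l * b) - 1 - l * b\<bar> \<le> exp \<bar>b\<bar> * (1 + \<bar>b\<bar>)\<^sup>2 * l\<^sup>2"
proof -
  have lb: "\<bar>l * b\<bar> \<le> \<bar>b\<bar>" using assms by (simp add: abs_mult mult_left_le_one_le)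
  have "\<bar>exp (l * b) - 1\<bar> \<le> exp \<bar>l * b\<bar> * \<bar>l * b\<bar>"
    using Taylor_exp_field[of "l * b" 0] by simp
  also have "\<dots> \<le> exp \<bar>b\<bar> * ((1 + \<bar>b\<bar>)\<^sup>2 * l)"
  proof (intro mult_mono)
    have "\<bar>b\<bar> \<le> (1 + \<bar>b\<bar>)\<^sup>2" by (simp add: power2_eq_square algebra_simps)
    then show "\<bar>l * b\<bar> \<le> (1 + \<bar>b\<bar>)\<^sup>2 * l"
      using assms by (simp add: abs_mult mult.commute mult_left_mono)
  qed (use lb assms in auto)
  finally show "\<bar>exp (l * b) - 1\<bar> \<le> exp \<bar>b\<bar> * (1 + \<bar>b\<bar>)\<^sup>2 * l" by simp
  have "\<bar>exp (l * b) - 1 - l * b\<bar> \<le> exp \<bar>l * b\<bar> * (l * b)\<^sup>2"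
    using Taylor_exp_field[of "l * b" 1] by (simp add: power2_eq_square algebra_simps abs_mult)
  also have "\<dots> \<le> exp \<bar>b\<bar> * ((1 + \<bar>b\<bar>)\<^sup>2 * l\<^sup>2)"
  proof (intro mult_mono)
    have "\<bar>b\<bar>\<^sup>2 \<le> (1 + \<bar>b\<bar>)\<^sup>2" by (intro power_mono) auto
    then have "b\<^sup>2 * l\<^sup>2 \<le> (1 + \<bar>b\<bar>)\<^sup>2 * l\<^sup>2" by (intro mult_right_mono) auto
    then show "(l * b)\<^sup>2 \<le> (1 + \<bar>b\<bar>)\<^sup>2 * l\<^sup>2" by (simp only: power_mult_distrib mult.commute)
  qed (use lb in auto)
  finally show "\<bar>exp (l * b) - 1 - l * b\<bar> \<le> exp \<bar>b\<bar> * (1 + \<bar>b\<bar>)\<^sup>2 * l\<^sup>2" by simp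
qed

section \<open>The perturbed rates and the first-order source\<close>

locale perturbed_walk = stationary_rates r p
  for r :: "('n::finite, 'd::finite) torus \<Rightarrow> ('n, 'd) torus \<Rightarrow> real" and p +
  fixes Z :: "(int ^ 'd) set" and v :: "real ^ 'd" and \<omega> :: real
  assumes finite_Z: "finite Z" and inj_pr: "inj_on (pr :: int ^ 'd \<Rightarrow> ('n, 'd) torus) Z"
    and Z_symmetric: "z \<in> Z \<Longrightarrow> - z \<in> Z"
    and r_refl: "r x x = 0" and r_support: "y \<notin> {x + pr z | z. z \<in> Z} \<Longrightarrow> r x y = 0"
    and \<omega>_nonzero: "\<omega> \<noteq> 0"
begin

definition force :: "int ^ 'd \<Rightarrow> real" where
  "force z = real_vec z \<bullet> v"

abbreviation rate where "rate l \<equiv> perturbed_rate Z r v \<omega> l"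

definition rate_deriv :: "real \<Rightarrow> ('n, 'd) torus \<Rightarrow> ('n, 'd) torus \<Rightarrow> real" where
  "rate_deriv t x y = (\<Sum>z\<in>{z \<in> Z. y = x + pr z}. cos (\<omega> * t) * force z * r x (x + pr z))"

lemma rate_eq: "rate l t x y =
    (\<Sum>z\<in>{z \<in> Z. y = x + pr z}. exp (l * (cos (\<omega> * t) * force z)) * r x (x + pr z))"
  unfolding perturbed_rate_def force_def by (simp add: mult.assoc)

text \<open>Gives the unperturbed rates the same fibre form as \<open>rate_eq\<close>, so that
  differences are taken weight by weight.\<close>

lemma r_fiber: "r x y = (\<Sum>z\<in>{z \<in> Z. y = x + pr z}. r x (x + pr z))"
proof (cases "\<exists>z\<in>Z. y = x + pr z")
  case True
  then obtain z where z: "z \<in> Z" "y = x + pr z" by blast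
  then have "{z \<in> Z. y = x + pr z} = {z}" using inj_pr by (auto simp: inj_on_def)
  then show ?thesis using z by simp
next
  case False
  then have "{z \<in> Z. y = x + pr z} = {}" by auto
  moreover have "r x y = 0" using False r_support by blast
  ultimately show ?thesis by (simp only: sum.empty)
qed

definition r_max :: real where "r_max = (\<Sum>x\<in>UNIV. \<Sum>y\<in>UNIV. r x y)"

lemma r_le_max: "r x y \<le> r_max"
proof -
  have "r x y \<le> (\<Sum>y\<in>UNIV. r x y)" by (rule member_le_sum) (auto simp: rate_nonneg)
  also have "\<dots> \<le> r_max" unfolding r_max_def
    by (rule member_le_sum) (auto simp: rate_nonneg intro!: sum_nonneg)
  finally show ?thesis .
qed

lemma fiber_bound:
  assumes "\<And>z. \<bar>a z\<bar> \<le> B z"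
  shows "\<bar>\<Sum>z\<in>{z \<in> Z. y = x + pr z}. a z * r x (x + pr z)\<bar> \<le> (\<Sum>z\<in>Z. B z) * r_max"
proof -
  have B: "0 \<le> B z" for z using assms[of z] by simp
  have "\<bar>\<Sum>z\<in>{z \<in> Z. y = x + pr z}. a z * r x (x + pr z)\<bar>
      \<le> (\<Sum>z\<in>{z \<in> Z. y = x + pr z}. \<bar>a z * r x (x + pr z)\<bar>)" by (rule sum_abs)
  also have "\<dots> \<le> (\<Sum>z\<in>{z \<in> Z. y = x + pr z}. B z * r_max)"
    unfolding abs_mult using assms r_le_max rate_nonneg B
    by (intro sum_mono mult_mono) auto
  also have "\<dots> \<le> (\<Sum>z\<in>Z. B z * r_max)"
    using finite_Z B order_trans[OF rate_nonneg r_le_max]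
    by (intro sum_mono2) (auto intro!: mult_nonneg_nonneg)
  finally show ?thesis by (simp add: sum_distrib_right)
qed

lemma abs_phase: "\<bar>cos (\<omega> * t) * force z\<bar> \<le> \<bar>force z\<bar>"
  using abs_cos_le_one[of "\<omega> * t"] by (simp add: abs_mult mult_left_le_one_le)

lemma rate_bounds: "\<exists>K L. \<forall>s t x y. 0 \<le> rate l t x y \<and> rate l t x y \<le> K \<and>
    \<bar>rate l s x y - rate l t x y\<bar> \<le> L * \<bar>s - t\<bar>"
proof -
  define K where "K = (\<Sum>z\<in>Z. exp \<bar>l * force z\<bar>) * r_max"
  define L where "L = (\<Sum>z\<in>Z. exp \<bar>l * force z\<bar> * \<bar>l * force z * \<omega>\<bar>) * r_max"
  have "0 \<le> rate l t x y" for t x y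
    unfolding rate_eq by (intro sum_nonneg mult_nonneg_nonneg) (auto simp: rate_nonneg)
  moreover have "rate l t x y \<le> K" for t x y
  proof -
    have "\<bar>exp (l * (cos (\<omega> * t) * force z))\<bar> \<le> exp \<bar>l * force z\<bar>" for z
    proof -
      have "\<bar>l * (cos (\<omega> * t) * force z)\<bar> \<le> \<bar>l * force z\<bar>"
        using abs_phase[of t z] unfolding abs_mult[of l] by (rule mult_left_mono) simp
      then show ?thesis by simp
    qed
    from fiber_bound[where x = x and y = y, OF this] show ?thesis
      unfolding rate_eq K_def by (rule order_trans[OF abs_ge_self])
  qed
  moreover have "\<bar>rate l s x y - rate l t x y\<bar> \<le> L * \<bar>s - t\<bar>" for s t x y
  proof -
    have "\<bar>exp (l * (cos (\<omega> * s) * force z)) - exp (l * (cos (\<omega> * t) * force z))\<bar>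
        \<le> exp \<bar>l * force z\<bar> * \<bar>l * force z * \<omega>\<bar> * \<bar>s - t\<bar>" for z
      using exp_cos_lipschitz[of "l * force z" \<omega> s t] by (simp add: mult_ac)
    from fiber_bound[where x = x and y = y, OF this]
    have "\<bar>rate l s x y - rate l t x y\<bar>
        \<le> (\<Sum>z\<in>Z. exp \<bar>l * force z\<bar> * \<bar>l * force z * \<omega>\<bar> * \<bar>s - t\<bar>) * r_max"
      unfolding rate_eq sum_subtractf[symmetric] left_diff_distrib[symmetric] .
    also have "\<dots> = L * \<bar>s - t\<bar>" unfolding L_def sum_distrib_right by (intro sum.cong refl) simp
    finally show ?thesis .
  qed
  ultimately show ?thesis by blast
qed

definition C0 :: real where
  "C0 = (\<Sum>z\<in>Z. exp \<bar>force z\<bar> * (1 + \<bar>force z\<bar>)\<^sup>2) * r_max"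

text \<open>The phase \<open>cos (\<omega> * t)\<close> only shrinks the exponent in modulus, so
  \<open>C0\<close> is uniform in time.\<close>

lemma rate_expansion:
  assumes "0 \<le> l" "l \<le> 1"
  shows "\<bar>rate l t x y - r x y\<bar> \<le> C0 * l"
    and "\<bar>rate l t x y - r x y - l * rate_deriv t x y\<bar> \<le> C0 * l\<^sup>2"
proof -
  let ?b = "\<lambda>z. cos (\<omega> * t) * force z"
  have mono: "exp \<bar>?b z\<bar> * (1 + \<bar>?b z\<bar>)\<^sup>2 \<le> exp \<bar>force z\<bar> * (1 + \<bar>force z\<bar>)\<^sup>2" for z
    using abs_phase[of t z] by (intro mult_mono power_mono) auto
  have "\<bar>exp (l * ?b z) - 1\<bar> \<le> exp \<bar>force z\<bar> * (1 + \<bar>force z\<bar>)\<^sup>2 * l" for z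
    by (rule order_trans[OF exp_remainder(1)[OF assms]]) (intro mult_right_mono mono assms)
  from fiber_bound[where x = x and y = y, OF this]
  have "\<bar>rate l t x y - r x y\<bar> \<le> (\<Sum>z\<in>Z. exp \<bar>force z\<bar> * (1 + \<bar>force z\<bar>)\<^sup>2 * l) * r_max"
    unfolding rate_eq r_fiber[of x y] by (simp only: left_diff_distrib sum_subtractf mult_1)
  also have "\<dots> = C0 * l" unfolding C0_def sum_distrib_right by (intro sum.cong refl) simp
  finally show "\<bar>rate l t x y - r x y\<bar> \<le> C0 * l" .
  have "\<bar>exp (l * ?b z) - 1 - l * ?b z\<bar> \<le> exp \<bar>force z\<bar> * (1 + \<bar>force z\<bar>)\<^sup>2 * l\<^sup>2" for z
    by (rule order_trans[OF exp_remainder(2)[OF assms]]) (intro mult_right_mono mono, simp)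
  from fiber_bound[where x = x and y = y, OF this]
  have "\<bar>rate l t x y - r x y - l * rate_deriv t x y\<bar>
      \<le> (\<Sum>z\<in>Z. exp \<bar>force z\<bar> * (1 + \<bar>force z\<bar>)\<^sup>2 * l\<^sup>2) * r_max"
    unfolding rate_eq r_fiber[of x y] rate_deriv_def
    by (simp only: left_diff_distrib sum_subtractf mult_1 sum_distrib_left mult.assoc)
  also have "\<dots> = C0 * l\<^sup>2" unfolding C0_def sum_distrib_right by (intro sum.cong refl) simp
  finally show "\<bar>rate l t x y - r x y - l * rate_deriv t x y\<bar> \<le> C0 * l\<^sup>2" .
qed

lemma C0_nonneg: "0 \<le> C0"
  using rate_expansion(1)[of 1] order_trans[OF abs_ge_zero] by fastforce

lemma sum_Z_uminus: "(\<Sum>z\<in>Z. f (- z)) = (\<Sum>z\<in>Z. f z)"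
  by (rule sum.reindex_bij_witness[of _ uminus uminus]) (auto simp: Z_symmetric)

text \<open>Arrivals at \<open>y\<close> by a jump \<open>z\<close> come from
  \<open>y - pr z\<close>. Replacing \<open>z\<close> by \<open>- z\<close> places them at
  \<open>y + pr z\<close>, where they are outgoing jumps of the time reversal at \<open>y\<close>.
  This is where \<open>Z = - Z\<close> enters.\<close>

lemma inflow_sum:
  fixes c :: "int ^ 'd \<Rightarrow> real"
  shows "(\<Sum>w\<in>UNIV. p w * (\<Sum>z\<in>{z \<in> Z. y = w + pr z}. c z * r w (w + pr z))) =
    (\<Sum>z\<in>Z. c (- z) * (p (y + pr z) * r (y + pr z) y))"
proof -
  have "(\<Sum>w\<in>UNIV. p w * (\<Sum>z\<in>{z \<in> Z. y = w + pr z}. c z * r w (w + pr z))) =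
      (\<Sum>w\<in>UNIV. \<Sum>z\<in>Z. if w = y - pr z then p w * (c z * r w y) else 0)"
    unfolding sum_distrib_left sum.inter_filter[OF finite_Z]
    by (intro sum.cong refl) (auto simp: eq_diff_eq)
  also have "\<dots> = (\<Sum>z\<in>Z. p (y - pr z) * (c z * r (y - pr z) y))"
    by (subst sum.swap) simp
  also have "\<dots> = (\<Sum>z\<in>Z. p (y - pr (- z)) * (c (- z) * r (y - pr (- z)) y))"
    by (rule sum_Z_uminus[symmetric])
  finally show ?thesis by (simp add: pr_uminus mult_ac)
qed

lemma Psi_inner: "p y * (Psi Z p r y \<bullet> v) =
    - (\<Sum>z\<in>Z. force z * (p (y + pr z) * r (y + pr z) y)) - p y * (\<Sum>z\<in>Z. force z * r y (y + pr z))"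
proof -
  have "p y * (Psi Z p r y \<bullet> v) =
      - (\<Sum>z\<in>Z. force z * (p y * time_reversal p r y (y + pr z)) + force z * (p y * r y (y + pr z)))"
    unfolding Psi_def force_def
    by (simp add: inner_sum_left sum_distrib_left algebra_simps)
  then show ?thesis unfolding p_reversal sum.distrib by (simp add: sum_distrib_left mult_ac)
qed

text \<open>The force is odd in \<open>z\<close>, so the relabelling in \<open>inflow_sum\<close>
  changes the sign of the inflow. Both contributions then carry a minus sign, which explains the sum
  in \<open>Psi\<close>.\<close>

lemma flux_rate_deriv: "flux (rate_deriv t) p y = p y * (cos (\<omega> * t) * (Psi Z p r y \<bullet> v))"
proof -
  have out: "(\<Sum>w\<in>UNIV. rate_deriv t y w) = (\<Sum>z\<in>Z. cos (\<omega> * t) * force z * r y (y + pr z))"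
    unfolding rate_deriv_def
    by (rule fiber_sum[OF finite_Z, where F = "\<lambda>_ c. c"]) (simp add: Modules.additive_def)
  have force_uminus: "force (- z) = - force z" for z unfolding force_def by (simp add: real_vec_uminus)
  have "flux (rate_deriv t) p y = cos (\<omega> * t) * (p y * (Psi Z p r y \<bullet> v))"
    unfolding flux_def out Psi_inner unfolding rate_deriv_def inflow_sum force_uminus
    by (simp add: right_diff_distrib sum_distrib_left sum_negf mult_ac)
  then show ?thesis by simp
qed

lemma Psi_inner_mean: "(\<Sum>y\<in>UNIV. p y * (Psi Z p r y \<bullet> v)) = 0"
proof -
  \<comment> \<open>At time 0 the cosine is 1, and a flux preserves total mass.\<close>
  have "(\<Sum>y\<in>UNIV. flux (rate_deriv 0) p y) = 0"
    unfolding flux_def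
    by (simp add: sum_subtractf sum_distrib_left) (subst sum.swap, simp)
  then show ?thesis unfolding flux_rate_deriv by simp
qed

text \<open>Origin of the adjoint generator: moving from measures to densities relative to
  \<open>p\<close> divides each rate \<open>r y x\<close> by the ratio of weights that defines the
  reversal.\<close>

lemma flux_r: "complex_of_real (flux r \<mu> x / p x) =
    generator (time_reversal p r) (\<lambda>x. complex_of_real (\<mu> x / p x)) x"
proof -
  have "flux r \<mu> x / p x = (\<Sum>y\<in>UNIV. \<mu> y * r y x / p x) - \<mu> x / p x * (\<Sum>y\<in>UNIV. time_reversal p r x y)"
    unfolding flux_def reversal_sum by (simp add: diff_divide_distrib sum_divide_distrib)
  also have "(\<Sum>y\<in>UNIV. \<mu> y * r y x / p x) = (\<Sum>y\<in>UNIV. time_reversal p r x y * (\<mu> y / p y))"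
    unfolding time_reversal_def by (intro sum.cong refl) simp
  finally have "flux r \<mu> x / p x = (\<Sum>y\<in>UNIV. time_reversal p r x y * (\<mu> y / p y - \<mu> x / p x))"
    by (simp add: right_diff_distrib sum_subtractf sum_distrib_left mult_ac)
  then show ?thesis unfolding generator_def by simp
qed

end

lemma flux_abs_le:
  fixes Q :: "'s::finite \<Rightarrow> 's \<Rightarrow> real"
  assumes "\<And>x y. \<bar>Q x y\<bar> \<le> a" "\<And>x. \<bar>\<mu> x\<bar> \<le> b"
  shows "\<bar>flux Q \<mu> y\<bar> \<le> 2 * real CARD('s) * (a * b)"
proof -
  have b: "0 \<le> b" using assms(2)[of undefined] by simp
  have a: "0 \<le> a" using assms(1)[of undefined undefined] by simp
  have "\<bar>\<Sum>w\<in>UNIV. \<mu> w * Q w y\<bar> \<le> of_nat (card (UNIV::'s set)) * (b * a)"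
    using assms b by (intro order_trans[OF sum_abs] sum_bounded_above) (simp add: abs_mult mult_mono)
  moreover have "\<bar>\<mu> y * (\<Sum>w\<in>UNIV. Q y w)\<bar> \<le> b * (of_nat (card (UNIV::'s set)) * a)"
    unfolding abs_mult using assms b
    by (intro mult_mono order_trans[OF sum_abs] sum_bounded_above) auto
  ultimately show ?thesis unfolding flux_def by (simp add: algebra_simps)
qed

lemma flux_diff_rates: "flux (\<lambda>x y. Q x y - R x y) \<mu> y = flux Q \<mu> y - flux R \<mu> y"
  unfolding flux_def by (simp add: right_diff_distrib sum_subtractf)

lemma flux_diff_measures: "flux Q (\<lambda>x. \<mu> x - \<nu> x) y = flux Q \<mu> y - flux Q \<nu> y"
  unfolding flux_def by (simp add: left_diff_distrib sum_subtractf)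

lemma flux_scale_rates: "flux (\<lambda>x y. c * Q x y) \<mu> y = c * flux Q \<mu> y"
  unfolding flux_def by (simp add: right_diff_distrib sum_distrib_left mult_ac)

section \<open>Linear response\<close>

lemma has_vector_derivative_complex_of_real:
  assumes "(f has_real_derivative f') (at t within S)"
  shows "((\<lambda>t. complex_of_real (f t)) has_vector_derivative complex_of_real f') (at t within S)"
  using assms unfolding has_vector_derivative_complex_iff by simp

lemma inv_shifted_cmult:
  assumes "bij (shifted \<omega> (generator r))"
  shows "inv_into UNIV (shifted \<omega> (generator r)) (\<lambda>x. c * f x) =
    (\<lambda>x. c * inv_into UNIV (shifted \<omega> (generator r)) f x)"
proof -
  let ?A = "shifted \<omega> (generator r)"
  have "?A (\<lambda>x. c * inv_into UNIV ?A f x) = (\<lambda>x. c * f x)"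
    unfolding shifted_cmult using assms by (simp add: bij_is_surj surj_f_inv_f)
  then show ?thesis using assms by (metis bij_inv_eq_iff)
qed

section \<open>First-order response of the density\<close>

context perturbed_walk begin

sublocale rev: stationary_rates "time_reversal p r" p by (rule stationary_reversal)

abbreviation resolvent :: "(('n, 'd) torus \<Rightarrow> complex) \<Rightarrow> ('n, 'd) torus \<Rightarrow> complex" where
  "resolvent \<equiv> inv_into UNIV (shifted \<omega> (generator (time_reversal p r)))"

lemma shifted_resolvent: "shifted \<omega> (generator (time_reversal p r)) (resolvent f) = f"
  using rev.bij_shifted[OF \<omega>_nonzero] by (simp add: bij_is_surj surj_f_inv_f)

text \<open>The resolvent applied to \<open>Psi\<close> in direction \<open>v\<close>, expanded in
  coordinates so that it matches the columns of \<open>mobility\<close>.\<close>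

definition response :: "('n, 'd) torus \<Rightarrow> complex" where
  "response x = (\<Sum>k\<in>UNIV. complex_of_real (v $ k) * resolvent (coord (Psi Z p r) k) x)"

lemma shifted_response:
  "shifted \<omega> (generator (time_reversal p r)) response x = complex_of_real (Psi Z p r x \<bullet> v)"
proof -
  have "shifted \<omega> (generator (time_reversal p r)) response x =
      (\<Sum>k\<in>UNIV. complex_of_real (v $ k) * coord (Psi Z p r) k x)"
    unfolding response_def[abs_def] shifted_sum shifted_cmult shifted_resolvent ..
  then show ?thesis unfolding coord_def inner_vec_def by (simp add: mult.commute)
qed

lemma response_mean: "(\<Sum>x\<in>UNIV. complex_of_real (p x) * response x) = 0"
proof -
  have "\<i> * \<omega> * (\<Sum>x\<in>UNIV. complex_of_real (p x) * response x) =
      complex_of_real (\<Sum>x\<in>UNIV. p x * (Psi Z p r x \<bullet> v))"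
    unfolding rev.shifted_mean[symmetric] shifted_response by simp
  then show ?thesis unfolding Psi_inner_mean using \<omega>_nonzero by simp
qed

definition rho :: "real \<Rightarrow> ('n, 'd) torus \<Rightarrow> real" where
  "rho t x = Re (exp (\<i> * complex_of_real (\<omega> * t)) * response x)"

text \<open>Multiply the resolvent equation by the phase and take real parts; the generator has real
  coefficients, so it commutes with \<open>Re\<close>.\<close>

lemma rho_deriv:
  "((\<lambda>t. complex_of_real (rho t x)) has_vector_derivative
    generator (time_reversal p r) (\<lambda>x. complex_of_real (rho t x)) x
      + complex_of_real (cos (\<omega> * t) * (Psi Z p r x \<bullet> v))) (at t within S)"
proof -
  let ?L = "generator (time_reversal p r)"
  let ?e = "exp (\<i> * complex_of_real (\<omega> * t))"
  have "((\<lambda>s. exp (\<i> * (complex_of_real \<omega> * s)) * response x) has_field_derivative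
      \<i> * complex_of_real \<omega> * ?e * response x) (at (complex_of_real t))"
    by (auto intro!: derivative_eq_intros)
  then have "((\<lambda>t. exp (\<i> * complex_of_real (\<omega> * t)) * response x) has_vector_derivative
      \<i> * complex_of_real \<omega> * ?e * response x) (at t within S)"
    using has_vector_derivative_real_field by fastforce
  then have "((\<lambda>t. rho t x) has_real_derivative Re (\<i> * complex_of_real \<omega> * ?e * response x)) (at t within S)"
    unfolding has_vector_derivative_complex_iff rho_def by blast
  then have 1: "((\<lambda>t. complex_of_real (rho t x)) has_vector_derivative
      complex_of_real (Re (\<i> * complex_of_real \<omega> * ?e * response x))) (at t within S)"
    by (rule has_vector_derivative_complex_of_real)
  have "\<i> * complex_of_real \<omega> * response x = ?L response x + complex_of_real (Psi Z p r x \<bullet> v)"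
    using shifted_response[of x] unfolding shifted_def by (simp add: algebra_simps)
  then have "\<i> * complex_of_real \<omega> * ?e * response x = ?L (\<lambda>x. ?e * response x) x + ?e * complex_of_real (Psi Z p r x \<bullet> v)"
    unfolding generator_cmult by (metis (no_types, opaque_lifting) distrib_left mult.assoc mult.commute)
  then have "complex_of_real (Re (\<i> * complex_of_real \<omega> * ?e * response x)) =
      ?L (\<lambda>x. complex_of_real (rho t x)) x + complex_of_real (cos (\<omega> * t) * (Psi Z p r x \<bullet> v))"
    unfolding rho_def generator_of_real_Re by (simp add: Re_exp)
  then show ?thesis using 1 by simp
qed

lemma rho_periodic: "rho (2 * pi / \<bar>\<omega>\<bar>) = rho 0"
proof -
  have "cos (\<omega> * (2 * pi / \<bar>\<omega>\<bar>)) = 1 \<and> sin (\<omega> * (2 * pi / \<bar>\<omega>\<bar>)) = 0"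
    using \<omega>_nonzero by (cases "\<omega> > 0") auto
  then have "exp (\<i> * complex_of_real (\<omega> * (2 * pi / \<bar>\<omega>\<bar>))) = 1"
    unfolding cis_conv_exp[symmetric] by (simp add: complex_eq_iff)
  then show ?thesis unfolding rho_def[abs_def] by simp
qed

lemma rho_mean: "(\<Sum>x\<in>UNIV. p x * rho t x) = 0"
proof -
  have "(\<Sum>x\<in>UNIV. p x * rho t x) =
      Re (exp (\<i> * complex_of_real (\<omega> * t)) * (\<Sum>x\<in>UNIV. complex_of_real (p x) * response x))"
    unfolding rho_def sum_distrib_left Re_sum by (intro sum.cong refl) (simp add: algebra_simps)
  then show ?thesis by (simp add: response_mean)
qed

text \<open>The rate is split into \<open>r\<close>, whose flux becomes the reversed generator by
  \<open>flux_r\<close>, and a remainder treated as forcing. Subtracting 1 is harmless since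
  constants are in the kernel.\<close>

lemma density_deriv:
  assumes "\<And>y. ((\<lambda>u. \<mu> u y) has_real_derivative flux (rate l t) (\<mu> t) y) (at t within S)"
  shows "((\<lambda>u. complex_of_real (\<mu> u x / p x - 1)) has_vector_derivative
    generator (time_reversal p r) (\<lambda>x. complex_of_real (\<mu> t x / p x - 1)) x
      + complex_of_real (flux (\<lambda>x y. rate l t x y - r x y) (\<mu> t) x / p x)) (at t within S)"
proof -
  have "((\<lambda>u. \<mu> u x / p x - 1) has_real_derivative flux (rate l t) (\<mu> t) x / p x) (at t within S)"
    using DERIV_cdivide[OF assms, of x "p x"] DERIV_diff[OF _ DERIV_const, of _ _ _ _ 1] by fastforce
  from has_vector_derivative_complex_of_real[OF this]
  have "((\<lambda>u. complex_of_real (\<mu> u x / p x - 1)) has_vector_derivative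
      complex_of_real (flux (rate l t) (\<mu> t) x / p x)) (at t within S)" .
  also have "complex_of_real (flux (rate l t) (\<mu> t) x / p x) = complex_of_real (flux r (\<mu> t) x / p x)
      + complex_of_real (flux (\<lambda>x y. rate l t x y - r x y) (\<mu> t) x / p x)"
    unfolding flux_diff_rates by (simp add: diff_divide_distrib)
  also have "complex_of_real (flux r (\<mu> t) x / p x) =
      generator (time_reversal p r) (\<lambda>x. complex_of_real (\<mu> t x / p x - 1)) x"
    unfolding flux_r of_real_diff generator_diff by (simp add: generator_const)
  finally show ?thesis .
qed

lemma density_expansion: "\<exists>C. \<forall>l \<mu>. 0 \<le> l \<longrightarrow> l \<le> 1 \<longrightarrow> (\<forall>t\<ge>0. \<forall>x. 0 \<le> \<mu> t x \<and> \<mu> t x \<le> 1) \<longrightarrow>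
    (\<forall>t\<ge>0. (\<Sum>x\<in>UNIV. \<mu> t x) = 1) \<longrightarrow> \<mu> (2 * pi / \<bar>\<omega>\<bar>) = \<mu> 0 \<longrightarrow>
    (\<forall>t\<ge>0. \<forall>y. ((\<lambda>u. \<mu> u y) has_real_derivative flux (rate l t) (\<mu> t) y) (at t within {0..})) \<longrightarrow>
    (\<forall>t\<ge>0. \<forall>x. \<bar>\<mu> t x - p x - l * (p x * rho t x)\<bar> \<le> C * l\<^sup>2)"
proof -
  let ?L = "generator (time_reversal p r)"
  let ?T = "2 * pi / \<bar>\<omega>\<bar>"
  have T: "0 < ?T" using \<omega>_nonzero by simp
  obtain C where C: "0 \<le> C" and stability: "\<And>h f \<epsilon> t x. \<epsilon> \<ge> 0 \<Longrightarrow> h ?T = h 0 \<Longrightarrow>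
    (\<And>t. 0 \<le> t \<Longrightarrow> (\<Sum>x\<in>UNIV. complex_of_real (p x) * h t x) = 0) \<Longrightarrow>
    (\<And>t x. 0 \<le> t \<Longrightarrow> ((\<lambda>t. h t x) has_vector_derivative (?L (h t) x + f t x)) (at t within {0..})) \<Longrightarrow>
    (\<And>t x. 0 \<le> t \<Longrightarrow> cmod (f t x) \<le> \<epsilon>) \<Longrightarrow> 0 \<le> t \<Longrightarrow> cmod (h t x) \<le> C * \<epsilon>"
  proof -
    obtain C where "0 \<le> C" and C: "\<forall>h f \<epsilon> T. T > 0 \<longrightarrow> \<epsilon> \<ge> 0 \<longrightarrow> h T = h 0 \<longrightarrow>
      (\<forall>t\<ge>0. (\<Sum>x\<in>UNIV. complex_of_real (p x) * h t x) = 0) \<longrightarrow>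
      (\<forall>t\<ge>0. \<forall>x. ((\<lambda>t. h t x) has_vector_derivative (?L (h t) x + f t x)) (at t within {0..})) \<longrightarrow>
      (\<forall>t\<ge>0. \<forall>x. cmod (f t x) \<le> \<epsilon>) \<longrightarrow> (\<forall>t\<ge>0. \<forall>x. cmod (h t x) \<le> C * \<epsilon>)"
      using rev.periodic_stability by (elim exE conjE)
    show ?thesis
      by (rule that[OF \<open>0 \<le> C\<close>], rule C[rule_format, OF T]) assumption+
  qed
  define N where "N = 2 * real CARD(('n, 'd) torus)"
  have N: "0 \<le> N" unfolding N_def by simp
  \<comment> \<open>Smallest weight, used to pass from measures to densities with a constant uniform
    in \<open>x\<close>.\<close>
  define m where "m = Min (range p)"
  have m: "0 < m" "\<And>x. m \<le> p x" unfolding m_def using p_pos by auto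
  have p_le: "p x \<le> 1" for x
    using member_le_sum[of x UNIV p] p_nonneg p_sum by auto
  \<comment> \<open>\<open>C1\<close> comes from the first pass. In \<open>C2\<close> the product
    \<open>C0 * C1\<close> stems from the changed rates acting on \<open>\<mu> - p\<close>, the
    single \<open>C0\<close> from the second-order remainder of the rates acting on
    \<open>p\<close>.\<close>
  define C1 where "C1 = C * (N * C0 / m)"
  define C2 where "C2 = N * (C0 * C1 + C0) / m"
  have C1: "0 \<le> C1" unfolding C1_def using C N C0_nonneg m(1) by simp
  have C2: "0 \<le> C2" unfolding C2_def using C1 N C0_nonneg m(1) by simp
  have div_le: "\<bar>a / p x\<bar> \<le> b / m" if "\<bar>a\<bar> \<le> b" for a b x
    using that m p_nonneg[of x] unfolding abs_divide by (intro frac_le) auto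
  have main: "\<bar>\<mu> t x - p x - l * (p x * rho t x)\<bar> \<le> (C * C2) * l\<^sup>2"
    if l: "0 \<le> l" "l \<le> 1" and bounds: "\<forall>t\<ge>0. \<forall>x. 0 \<le> \<mu> t x \<and> \<mu> t x \<le> 1"
      and total: "\<forall>t\<ge>0. (\<Sum>x\<in>UNIV. \<mu> t x) = 1" and periodic: "\<mu> ?T = \<mu> 0"
      and ode: "\<forall>t\<ge>0. \<forall>y. ((\<lambda>u. \<mu> u y) has_real_derivative flux (rate l t) (\<mu> t) y) (at t within {0..})"
      and t: "0 \<le> t" for l \<mu> t x
  proof -
    let ?h = "\<lambda>t x. complex_of_real (\<mu> t x / p x - 1)"
    let ?Q = "\<lambda>t x y. rate l t x y - r x y"
    let ?f = "\<lambda>t x. complex_of_real (flux (?Q t) (\<mu> t) x / p x)"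
    have Q: "\<bar>?Q t x y\<bar> \<le> C0 * l" for t x y by (rule rate_expansion(1)[OF l])
    have density_mean: "(\<Sum>x\<in>UNIV. p x * (\<mu> t x / p x - 1)) = 0" if "0 \<le> t" for t
      using total that p_sum by (simp add: right_diff_distrib sum_subtractf)
    have h_deriv: "((\<lambda>t. ?h t x) has_vector_derivative (?L (?h t) x + ?f t x)) (at t within {0..})"
      if "0 \<le> t" for t x
      using ode that by (intro density_deriv) auto
    have first: "\<bar>\<mu> t x / p x - 1\<bar> \<le> C1 * l" if t: "0 \<le> t" for t x
    proof -
      have "cmod (?h t x) \<le> C * (N * (C0 * l) / m)"
      proof (rule stability[where h = ?h and f = ?f])
        show "0 \<le> N * (C0 * l) / m" using N C0_nonneg l m(1) by simp
        show "?h ?T = ?h 0" using periodic by simp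
        show "(\<Sum>x\<in>UNIV. complex_of_real (p x) * ?h t x) = 0" if "0 \<le> t" for t
          using density_mean[OF that] by (metis (mono_tags, lifting) of_real_0 of_real_mult of_real_sum sum.cong)
        show "cmod (?f t x) \<le> N * (C0 * l) / m" if "0 \<le> t" for t x
        proof -
          have "\<bar>flux (?Q t) (\<mu> t) x\<bar> \<le> 2 * real CARD(('n, 'd) torus) * (C0 * l * 1)"
            using bounds that by (intro flux_abs_le Q) auto
          then have "\<bar>flux (?Q t) (\<mu> t) x / p x\<bar> \<le> N * (C0 * l) / m"
            unfolding N_def by (intro div_le) simp
          then show ?thesis unfolding norm_of_real .
        qed
      qed (fact t h_deriv)+
      then have "\<bar>\<mu> t x / p x - 1\<bar> \<le> C * (N * (C0 * l) / m)" unfolding norm_of_real .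
      then show ?thesis unfolding C1_def by simp
    qed
    let ?h2 = "\<lambda>t x. complex_of_real (\<mu> t x / p x - 1) - complex_of_real l * complex_of_real (rho t x)"
    let ?g = "\<lambda>t x. flux (?Q t) (\<mu> t) x / p x - l * (cos (\<omega> * t) * (Psi Z p r x \<bullet> v))"
    have "cmod (?h2 t x) \<le> C * (C2 * l\<^sup>2)"
    proof (rule stability[where h = ?h2 and f = "\<lambda>t x. complex_of_real (?g t x)"])
      show "0 \<le> C2 * l\<^sup>2" using C2 by simp
      show "?h2 ?T = ?h2 0" using periodic rho_periodic by simp
      show "(\<Sum>x\<in>UNIV. complex_of_real (p x) * ?h2 t x) = 0" if "0 \<le> t" for t
      proof -
        have "(\<Sum>x\<in>UNIV. complex_of_real (p x) * ?h2 t x) =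
            complex_of_real ((\<Sum>x\<in>UNIV. p x * (\<mu> t x / p x - 1)) - l * (\<Sum>x\<in>UNIV. p x * rho t x))"
          unfolding of_real_diff of_real_mult of_real_sum sum_distrib_left sum_subtractf[symmetric]
          by (intro sum.cong refl) (simp add: algebra_simps)
        then show ?thesis using density_mean[OF that] rho_mean by simp
      qed
      show "((\<lambda>t. ?h2 t x) has_vector_derivative (?L (?h2 t) x + complex_of_real (?g t x))) (at t within {0..})"
        if "0 \<le> t" for t x
      proof -
        have "((\<lambda>t. ?h2 t x) has_vector_derivative (?L (?h t) x + ?f t x) - complex_of_real l *
            (?L (\<lambda>x. complex_of_real (rho t x)) x + complex_of_real (cos (\<omega> * t) * (Psi Z p r x \<bullet> v)))) (at t within {0..})"
          by (intro has_vector_derivative_diff has_vector_derivative_mult_right h_deriv rho_deriv that)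
        moreover have "(?L (?h t) x + ?f t x) - complex_of_real l *
            (?L (\<lambda>x. complex_of_real (rho t x)) x + complex_of_real (cos (\<omega> * t) * (Psi Z p r x \<bullet> v)))
            = ?L (?h2 t) x + complex_of_real (?g t x)"
          unfolding generator_diff generator_cmult by (simp add: algebra_simps)
        ultimately show ?thesis by (simp only:)
      qed
      show "cmod (complex_of_real (?g t x)) \<le> C2 * l\<^sup>2" if "0 \<le> t" for t x
      proof -
        \<comment> \<open>The stationary part \<open>p\<close> is split off \<open>\<mu>\<close>: on
          it, the linear part of the rate change reproduces the source of \<open>rho\<close> and
          cancels.\<close>
        have "?g t x = (flux (?Q t) (\<lambda>x. \<mu> t x - p x) x
            + flux (\<lambda>x y. ?Q t x y - l * rate_deriv t x y) p x) / p x"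
          unfolding flux_diff_measures
          by (simp only: flux_diff_rates[of "\<lambda>x y. rate l t x y - r x y"] flux_scale_rates flux_rate_deriv)
            (simp add: field_simps)
        moreover have "\<bar>flux (?Q t) (\<lambda>x. \<mu> t x - p x) x\<bar> \<le> 2 * real CARD(('n, 'd) torus) * (C0 * l * (C1 * l))"
        proof (intro flux_abs_le Q)
          fix x
          have "\<mu> t x - p x = p x * (\<mu> t x / p x - 1)" by (simp add: right_diff_distrib)
          then have "\<bar>\<mu> t x - p x\<bar> = p x * \<bar>\<mu> t x / p x - 1\<bar>" using p_nonneg[of x] by (simp add: abs_mult)
          also have "\<dots> \<le> 1 * (C1 * l)" using first[OF that] p_le p_nonneg by (intro mult_mono) auto
          finally show "\<bar>\<mu> t x - p x\<bar> \<le> C1 * l" by simp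
        qed
        moreover have "\<bar>flux (\<lambda>x y. ?Q t x y - l * rate_deriv t x y) p x\<bar>
            \<le> 2 * real CARD(('n, 'd) torus) * (C0 * l\<^sup>2 * 1)"
          using p_le p_nonneg by (intro flux_abs_le rate_expansion(2)[OF l]) auto
        ultimately have "\<bar>?g t x\<bar> \<le> (N * (C0 * l * (C1 * l)) + N * (C0 * l\<^sup>2 * 1)) / m"
          unfolding N_def by (simp only:) (intro div_le order_trans[OF abs_triangle_ineq] add_mono)
        also have "\<dots> = C2 * l\<^sup>2" unfolding C2_def by (simp add: power2_eq_square field_simps)
        finally show ?thesis unfolding norm_of_real .
      qed
    qed (fact t)
    moreover have "cmod (?h2 t x) = \<bar>\<mu> t x / p x - 1 - l * rho t x\<bar>"
      by (simp only: of_real_mult[symmetric] of_real_diff[symmetric] norm_of_real)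
    ultimately have "\<bar>\<mu> t x / p x - 1 - l * rho t x\<bar> \<le> C * (C2 * l\<^sup>2)" by simp
    then have "p x * \<bar>\<mu> t x / p x - 1 - l * rho t x\<bar> \<le> 1 * (C * (C2 * l\<^sup>2))"
      using p_le[of x] p_nonneg[of x] by (intro mult_mono) auto
    moreover have "\<mu> t x - p x - l * (p x * rho t x) = p x * (\<mu> t x / p x - 1 - l * rho t x)"
      by (simp add: right_diff_distrib)
    ultimately show ?thesis using p_nonneg[of x] by (simp add: abs_mult mult.assoc)
  qed
  show ?thesis
    by (intro exI[of _ "C * C2"] allI impI) (rule main, assumption+)
qed

section \<open>From the law to the mean velocity\<close>

lemma rate_jump_sum:
  "(\<Sum>y\<in>UNIV. (c * rate l t x y) *\<^sub>R jump_vec Z x y) =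
    c *\<^sub>R (\<Sum>z\<in>Z. (exp (l * (cos (\<omega> * t) * force z)) * r x (x + pr z)) *\<^sub>R real_vec z)"
proof -
  have "(\<Sum>y\<in>UNIV. (c * rate l t x y) *\<^sub>R jump_vec Z x y) =
    (\<Sum>z\<in>Z. (c * (exp (l * (cos (\<omega> * t) * force z)) * r x (x + pr z))) *\<^sub>R jump_vec Z x (x + pr z))"
    unfolding rate_eq
    by (rule fiber_sum[OF finite_Z, where F = "\<lambda>y a. (c * a) *\<^sub>R jump_vec Z x y"])
      (simp add: Modules.additive_def algebra_simps)
  also have "\<dots> = (\<Sum>z\<in>Z. (c * (exp (l * (cos (\<omega> * t) * force z)) * r x (x + pr z))) *\<^sub>R real_vec z)"
  proof (intro sum.cong refl)
    fix z assume z: "z \<in> Z"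
    show "(c * (exp (l * (cos (\<omega> * t) * force z)) * r x (x + pr z))) *\<^sub>R jump_vec Z x (x + pr z) =
        (c * (exp (l * (cos (\<omega> * t) * force z)) * r x (x + pr z))) *\<^sub>R real_vec z"
    proof (cases "x = x + pr z")
      \<comment> \<open>\<open>Z\<close> may contain a vector with \<open>pr z = 0\<close>;
        \<open>jump_vec\<close> ignores it, and its rate is 0.\<close>
      case True
      then have "r x (x + pr z) = 0" using r_refl[of x] by simp
      then show ?thesis by simp
    next
      case False
      show ?thesis unfolding jump_vec_pr[OF inj_pr z False] ..
    qed
  qed
  finally show ?thesis by (simp add: scaleR_sum_right)
qed

text \<open>The interface between the process and the analysis: afterwards only the family of laws
  matters, not the underlying paths.\<close>

lemma walk_law:
  fixes M :: "'w measure"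
  assumes trans: "transition_function (rate l) P" and osc: "oscillatory_distribution \<omega> P \<pi>'"
    and chain: "markov_chain M P X" and init: "\<forall>x. measure M {w \<in> space M. X 0 w = x} = \<pi>' x"
    and lift: "lifted_walk M Z X Y"
  defines "\<mu> \<equiv> \<lambda>t x. measure M {w \<in> space M. X t w = x}"
  shows "0 \<le> \<mu> t x \<and> \<mu> t x \<le> 1"
    and "0 \<le> t \<Longrightarrow> (\<Sum>x\<in>UNIV. \<mu> t x) = 1"
    and "\<mu> (2 * pi / \<bar>\<omega>\<bar>) = \<mu> 0"
    and "0 \<le> t \<Longrightarrow> ((\<lambda>u. \<mu> u y) has_real_derivative flux (rate l t) (\<mu> t) y) (at t within {0..})"
    and "0 \<le> t \<Longrightarrow> mean_velocity M Y t =
      (\<Sum>x\<in>UNIV. \<mu> t x *\<^sub>R (\<Sum>z\<in>Z. (exp (l * (cos (\<omega> * t) * force z)) * r x (x + pr z)) *\<^sub>R real_vec z))"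
proof -
  obtain K L where KL: "\<forall>s t x y. 0 \<le> rate l t x y \<and> rate l t x y \<le> K \<and>
      \<bar>rate l s x y - rate l t x y\<bar> \<le> L * \<bar>s - t\<bar>"
    using rate_bounds by blast
  interpret chain_increment M "rate l" P X K L "jump_vec Z" "\<Sum>z\<in>Z. norm (real_vec z)"
  proof unfold_locales
    show "norm (jump_vec Z x y) \<le> (\<Sum>z\<in>Z. norm (real_vec z))" for x y :: "('n, 'd) torus"
    proof (cases "x = y")
      case False
      have "norm (jump_vec Z x y) \<le> (\<Sum>z\<in>{z \<in> Z. y = x + pr z}. norm (real_vec z))"
        using False unfolding jump_vec_def by (simp add: norm_sum)
      also have "\<dots> \<le> (\<Sum>z\<in>Z. norm (real_vec z))" using finite_Z by (intro sum_mono2) auto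
      finally show ?thesis .
    qed (simp add: jump_vec_refl sum_nonneg)
  qed (use trans chain KL jump_vec_refl in auto)
  have \<mu>: "\<mu> = law" unfolding \<mu>_def law_def by (intro ext) simp
  show "0 \<le> \<mu> t x \<and> \<mu> t x \<le> 1" unfolding \<mu> using law_bounds by simp
  show "(\<Sum>x\<in>UNIV. \<mu> t x) = 1" if "0 \<le> t" unfolding \<mu> using law_sum[OF that] .
  have law0: "law 0 x = \<pi>' x" for x using init unfolding law_def by simp
  \<comment> \<open>The law at time 0 is \<open>\<pi>'\<close>, which the one-period transition
    matrix preserves.\<close>
  show "\<mu> (2 * pi / \<bar>\<omega>\<bar>) = \<mu> 0"
  proof
    fix y
    show "\<mu> (2 * pi / \<bar>\<omega>\<bar>) y = \<mu> 0 y"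
      using law_sum_joint[of 0 "2 * pi / \<bar>\<omega>\<bar>" y] osc
      unfolding \<mu> law0 oscillatory_distribution_def by simp
  qed
  show "((\<lambda>u. \<mu> u y) has_real_derivative flux (rate l t) (\<mu> t) y) (at t within {0..})" if "0 \<le> t"
    unfolding \<mu> using law_forward[OF that] .
  show "mean_velocity M Y t =
      (\<Sum>x\<in>UNIV. \<mu> t x *\<^sub>R (\<Sum>z\<in>Z. (exp (l * (cos (\<omega> * t) * force z)) * r x (x + pr z)) *\<^sub>R real_vec z))"
    if t: "0 \<le> t"
  proof -
    have "((\<lambda>u. \<integral>w. real_vec (Y u w) \<partial>M) has_vector_derivative mean_rate t) (at t within {0..})"
    proof (rule mean_has_vector_derivative[OF _ _ _ t])
      show "(\<lambda>w. real_vec (Y u w)) \<in> borel_measurable M" if "0 \<le> u" for u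
      proof -
        have "Y u \<in> measurable M (count_space UNIV)" using lift that unfolding lifted_walk_def by blast
        then show ?thesis by (rule measurable_compose) simp
      qed
      show "integrable M (\<lambda>w. real_vec (Y 0 w))" using lift unfolding lifted_walk_def by blast
      have "AE w in M. lifted_path Z (\<lambda>t. X t w) (\<lambda>t. Y t w)" using lift unfolding lifted_walk_def by blast
      then show "AE w in M. \<forall>T. \<exists>\<epsilon>>0. \<forall>u v. 0 \<le> u \<longrightarrow> u \<le> v \<longrightarrow> v \<le> T \<longrightarrow> v - u < \<epsilon> \<longrightarrow>
          jump_vec Z (X u w) (X v w) = real_vec (Y v w) - real_vec (Y u w)"
        by eventually_elim (intro allI lifted_path_increments[OF inj_pr])
    qed
    \<comment> \<open>At each such \<open>t\<close>, 0 included, the derivative within the half line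
      is unique, so \<open>vector_derivative\<close> picks out this one.\<close>
    moreover have "at t within {0..} \<noteq> bot"
    proof -
      have "t islimpt {0..t + 1}" using t by (intro connected_imp_perfect) auto
      then have "t islimpt {0..}" by (rule islimpt_subset) auto
      then show ?thesis using trivial_limit_within by blast
    qed
    ultimately have "mean_velocity M Y t = mean_rate t"
      unfolding mean_velocity_def by (rule vector_derivative_within[rotated])
    then show ?thesis unfolding mean_rate_def rate_jump_sum \<mu> .
  qed
qed

lemma l2_inner_response:
  "l2_inner p f response = (\<Sum>k\<in>UNIV. l2_inner p f (resolvent (coord (Psi Z p r) k)) * complex_of_real (v $ k))"
  unfolding l2_inner_def response_def sum_distrib_left sum_distrib_right
  by (subst sum.swap) (simp add: mult_ac)

text \<open>The right-hand side is what the product rule gives for the mean velocity: the response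
  of the law times the drift, and the stationary law times the changed rates. As drift and
  covariance are real, taking real parts affects only the phase and the response.\<close>

lemma mobility_response:
  "Re (exp (\<i> * complex_of_real (\<omega> * t)) * (mobility Z p r \<omega> *v (\<chi> k. complex_of_real (v $ k))) $ j) =
    (\<Sum>x\<in>UNIV. (p x * rho t x) *\<^sub>R drift Z r x
      + p x *\<^sub>R (\<Sum>z\<in>Z. (cos (\<omega> * t) * force z * r x (x + pr z)) *\<^sub>R real_vec z)) $ j"
proof -
  let ?e = "exp (\<i> * complex_of_real (\<omega> * t))"
  have mv: "(mobility Z p r \<omega> *v (\<chi> k. complex_of_real (v $ k))) $ j =
      complex_of_real (\<Sum>k\<in>UNIV. jump_covariance Z p r j k * v $ k) + l2_inner p (coord (drift Z r) j) response"
    unfolding l2_inner_response mobility_def matrix_vector_mult_def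
    by (simp add: distrib_right sum.distrib)
  have cov: "(\<Sum>k\<in>UNIV. jump_covariance Z p r j k * v $ k) =
      (\<Sum>x\<in>UNIV. p x * (\<Sum>z\<in>Z. force z * r x (x + pr z) * real_vec z $ j))"
  proof -
    have "(\<Sum>k\<in>UNIV. (\<Sum>z\<in>Z. A z * real_vec z $ j * real_vec z $ k) * v $ k) =
        (\<Sum>z\<in>Z. A z * real_vec z $ j * force z)" for A :: "int ^ 'd \<Rightarrow> real"
      unfolding force_def inner_vec_def sum_distrib_right
      by (subst sum.swap) (simp add: sum_distrib_left mult_ac)
    then have "(\<Sum>k\<in>UNIV. jump_covariance Z p r j k * v $ k) =
        (\<Sum>z\<in>Z. (\<Sum>x\<in>UNIV. p x * r x (x + pr z)) * real_vec z $ j * force z)"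
      unfolding jump_covariance_def .
    also have "\<dots> = (\<Sum>x\<in>UNIV. p x * (\<Sum>z\<in>Z. force z * r x (x + pr z) * real_vec z $ j))"
      unfolding sum_distrib_right sum_distrib_left by (subst sum.swap) (simp add: mult_ac)
    finally show ?thesis .
  qed
  have resp: "Re (?e * l2_inner p (coord (drift Z r) j) response) =
      (\<Sum>x\<in>UNIV. p x * rho t x * drift Z r x $ j)"
    unfolding l2_inner_def rho_def coord_def sum_distrib_left Re_sum
    by (intro sum.cong refl) (simp add: algebra_simps)
  have real: "Re (?e * complex_of_real a) = cos (\<omega> * t) * a" for a
    by (simp add: Re_exp)
  have "Re (?e * (mobility Z p r \<omega> *v (\<chi> k. complex_of_real (v $ k))) $ j) =
      cos (\<omega> * t) * (\<Sum>x\<in>UNIV. p x * (\<Sum>z\<in>Z. force z * r x (x + pr z) * real_vec z $ j))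
      + (\<Sum>x\<in>UNIV. p x * rho t x * drift Z r x $ j)"
    unfolding mv distrib_left plus_complex.sel real resp cov ..
  then show ?thesis by (simp add: sum.distrib sum_distrib_left mult_ac)
qed

lemma velocity_derivative:
  fixes M :: "real \<Rightarrow> 'w measure"
  assumes trans: "\<forall>l\<ge>0. transition_function (rate l) (P l)"
    and osc: "\<forall>l\<ge>0. oscillatory_distribution \<omega> (P l) (\<pi>' l)"
    and chain: "\<forall>l\<ge>0. markov_chain (M l) (P l) (X l)"
    and init: "\<forall>l\<ge>0. \<forall>x. measure (M l) {w \<in> space (M l). X l 0 w = x} = \<pi>' l x"
    and lift: "\<forall>l\<ge>0. lifted_walk (M l) Z (X l) (Y l)" and t: "0 \<le> t"
  shows "((\<lambda>l. mean_velocity (M l) (Y l) t) has_vector_derivative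
        (\<chi> j. Re (exp (\<i> * complex_of_real (\<omega> * t)) *
          (mobility Z p r \<omega> *v (\<chi> k. complex_of_real (v $ k))) $ j))) (at 0 within {0..})"
proof -
  define \<mu> where "\<mu> l t x = measure (M l) {w \<in> space (M l). X l t w = x}" for l t x
  define W where "W l x = (\<Sum>z\<in>Z. (exp (l * (cos (\<omega> * t) * force z)) * r x (x + pr z)) *\<^sub>R real_vec z)" for l x
  note facts = walk_law[OF trans[THEN spec, THEN mp] osc[THEN spec, THEN mp] chain[THEN spec, THEN mp]
      init[THEN spec, THEN mp] lift[THEN spec, THEN mp], folded \<mu>_def]
  obtain C where C: "\<And>l x. 0 \<le> l \<Longrightarrow> l \<le> 1 \<Longrightarrow> \<bar>\<mu> l t x - p x - l * (p x * rho t x)\<bar> \<le> C * l\<^sup>2"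
  proof -
    obtain C where C: "\<forall>l \<mu>. 0 \<le> l \<longrightarrow> l \<le> 1 \<longrightarrow> (\<forall>t\<ge>0. \<forall>x. 0 \<le> \<mu> t x \<and> \<mu> t x \<le> 1) \<longrightarrow>
      (\<forall>t\<ge>0. (\<Sum>x\<in>UNIV. \<mu> t x) = 1) \<longrightarrow> \<mu> (2 * pi / \<bar>\<omega>\<bar>) = \<mu> 0 \<longrightarrow>
      (\<forall>t\<ge>0. \<forall>y. ((\<lambda>u. \<mu> u y) has_real_derivative flux (rate l t) (\<mu> t) y) (at t within {0..})) \<longrightarrow>
      (\<forall>t\<ge>0. \<forall>x. \<bar>\<mu> t x - p x - l * (p x * rho t x)\<bar> \<le> C * l\<^sup>2)"
      using density_expansion by (elim exE)
    show ?thesis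
    proof (rule that)
      fix l :: real and x assume l: "0 \<le> l" "l \<le> 1"
      show "\<bar>\<mu> l t x - p x - l * (p x * rho t x)\<bar> \<le> C * l\<^sup>2"
        by (rule C[rule_format, of l "\<mu> l"]) (use l t facts[OF l(1) l(1) l(1) l(1) l(1)] in auto)
    qed
  qed
  \<comment> \<open>At \<lambda> = 0 the error bound vanishes, which identifies the unperturbed law
    with \<open>p\<close>.\<close>
  have \<mu>0: "\<mu> 0 t x = p x" for x using C[of 0 x] by simp
  have "((\<lambda>l. \<mu> l t x) has_real_derivative p x * rho t x) (at 0 within {0..})" for x
    unfolding has_real_derivative_iff_has_vector_derivative
  proof (rule has_vector_derivative_quadratic[where C = C])
    fix l :: real assume "l \<in> {0..}" "\<bar>l - 0\<bar> \<le> 1"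
    then show "norm (\<mu> l t x - \<mu> 0 t x - (l - 0) *\<^sub>R (p x * rho t x)) \<le> C * (l - 0)\<^sup>2"
      using C[of l x] \<mu>0 by simp
  qed
  moreover have "((\<lambda>l. W l x) has_vector_derivative
      (\<Sum>z\<in>Z. (cos (\<omega> * t) * force z * r x (x + pr z)) *\<^sub>R real_vec z)) (at 0 within {0..})" for x
    unfolding W_def
  proof (intro has_vector_derivative_sum)
    fix z
    have "((\<lambda>l. exp (l * (cos (\<omega> * t) * force z)) * r x (x + pr z)) has_real_derivative
        cos (\<omega> * t) * force z * r x (x + pr z)) (at 0 within {0..})"
      by (auto intro!: derivative_eq_intros)
    from has_vector_derivative_scaleR[OF this has_vector_derivative_const[of "real_vec z"]]
    show "((\<lambda>l. (exp (l * (cos (\<omega> * t) * force z)) * r x (x + pr z)) *\<^sub>R real_vec z) has_vector_derivative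
        (cos (\<omega> * t) * force z * r x (x + pr z)) *\<^sub>R real_vec z) (at 0 within {0..})" by simp
  qed
  ultimately have deriv: "((\<lambda>l. \<Sum>x\<in>UNIV. \<mu> l t x *\<^sub>R W l x) has_vector_derivative
      (\<Sum>x\<in>UNIV. \<mu> 0 t x *\<^sub>R (\<Sum>z\<in>Z. (cos (\<omega> * t) * force z * r x (x + pr z)) *\<^sub>R real_vec z)
        + (p x * rho t x) *\<^sub>R W 0 x)) (at 0 within {0..})"
    by (intro has_vector_derivative_sum has_vector_derivative_scaleR)
  have W0: "W 0 x = drift Z r x" for x unfolding W_def drift_def by simp
  have eq: "(\<Sum>x\<in>UNIV. \<mu> 0 t x *\<^sub>R (\<Sum>z\<in>Z. (cos (\<omega> * t) * force z * r x (x + pr z)) *\<^sub>R real_vec z)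
        + (p x * rho t x) *\<^sub>R W 0 x) = (\<chi> j. Re (exp (\<i> * complex_of_real (\<omega> * t)) *
          (mobility Z p r \<omega> *v (\<chi> k. complex_of_real (v $ k))) $ j))"
    unfolding vec_eq_iff mobility_response \<mu>0 W0 vec_lambda_beta by (simp add: add.commute)
  show ?thesis
    by (rule has_vector_derivative_transform[OF _ _ deriv[unfolded eq]])
      (auto simp: W_def intro!: facts(5)[OF _ _ _ _ _ t])
qed

section \<open>Integral representation and the reversible case\<close>

lemma Psi_mean: "(\<Sum>x\<in>UNIV. complex_of_real (p x) * coord (Psi Z p r) k x) = 0"
proof -
  \<comment> \<open>With \<open>v\<close> replaced by the \<open>k\<close>-th unit vector,
    \<open>Psi_inner_mean\<close> speaks of a single coordinate.\<close>
  interpret k: perturbed_walk r p Z "axis k 1" \<omega> by unfold_locales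
  have "(\<Sum>x\<in>UNIV. p x * Psi Z p r x $ k) = 0"
    using k.Psi_inner_mean by (simp add: inner_axis)
  then show ?thesis unfolding coord_def of_real_mult[symmetric] of_real_sum[symmetric] by simp
qed

lemma mobility_integral:
  "(\<lambda>s. l2_inner p (coord (drift Z r) j)
     (op_exp (\<lambda>f x. - (complex_of_real s * shifted \<omega> (generator (time_reversal p r)) f x))
       (coord (Psi Z p r) k))) absolutely_integrable_on {0..}"
  "mobility Z p r \<omega> $ j $ k = complex_of_real (jump_covariance Z p r j k) +
    integral {0..} (\<lambda>s. l2_inner p (coord (drift Z r) j)
     (op_exp (\<lambda>f x. - (complex_of_real s * shifted \<omega> (generator (time_reversal p r)) f x))
       (coord (Psi Z p r) k)))"
  using rev.resolvent_integral[OF \<omega>_nonzero Psi_mean, unfolded evolution_def]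
  by (auto simp: mobility_def)

end

text \<open>Under detailed balance i \<omega> - L is symmetric for the bilinear pairing without
  conjugation, although the imaginary shift keeps it from being self-adjoint. The conjugation in
  \<open>l2_inner\<close> disappears because \<open>coord f j\<close> is real.\<close>

lemma (in stationary_rates) resolvent_symmetric:
  assumes rev: "time_reversal p r = r" and \<omega>: "\<omega> \<noteq> 0"
  shows "l2_inner p (coord f j) (inv_into UNIV (shifted \<omega> (generator r)) (coord f k)) =
    l2_inner p (coord f k) (inv_into UNIV (shifted \<omega> (generator r)) (coord f j))"
proof -
  let ?A = "shifted \<omega> (generator r)"
  have A_inv: "?A (inv_into UNIV ?A h) = h" for h
    using bij_shifted[OF \<omega>] by (simp add: bij_is_surj surj_f_inv_f)
  have detailed: "p x * r x y = p y * r y x" for x y using p_reversal[of x y] rev by simp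
  have sym: "(\<Sum>x\<in>UNIV. complex_of_real (p x) * ?A a x * b x) = (\<Sum>x\<in>UNIV. complex_of_real (p x) * ?A b x * a x)"
    for a b
  proof -
    have "(\<Sum>x\<in>UNIV. complex_of_real (p x) * generator r a x * b x) =
        (\<Sum>x\<in>UNIV. \<Sum>y\<in>UNIV. complex_of_real (p x * r x y) * (a y * b x))
        - (\<Sum>x\<in>UNIV. \<Sum>y\<in>UNIV. complex_of_real (p x * r x y) * (a x * b x))" for a b
      unfolding generator_def
      by (simp add: sum_distrib_left sum_distrib_right sum_subtractf[symmetric] algebra_simps)
    moreover have "(\<Sum>x\<in>UNIV. \<Sum>y\<in>UNIV. complex_of_real (p x * r x y) * (a y * b x)) =
        (\<Sum>x\<in>UNIV. \<Sum>y\<in>UNIV. complex_of_real (p x * r x y) * (b y * a x))"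
      by (subst sum.swap) (simp only: detailed mult.commute)
    ultimately have "(\<Sum>x\<in>UNIV. complex_of_real (p x) * generator r a x * b x) =
        (\<Sum>x\<in>UNIV. complex_of_real (p x) * generator r b x * a x)" by (simp add: mult.commute)
    then show ?thesis unfolding shifted_def
      by (simp add: right_diff_distrib left_diff_distrib sum_subtractf mult_ac)
  qed
  have real_left: "l2_inner p (coord f j) h = (\<Sum>x\<in>UNIV. complex_of_real (p x) * coord f j x * h x)" for j h
    unfolding l2_inner_def coord_def by simp
  show ?thesis
    using sym[of "inv_into UNIV ?A (coord f j)" "inv_into UNIV ?A (coord f k)"]
    unfolding A_inv real_left .
qed

lemma (in perturbed_walk) mobility_reversible:
  assumes rev: "time_reversal p r = r"
  shows "Psi Z p r x = - 2 *\<^sub>R drift Z r x"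
    and "transpose (mobility Z p r \<omega>) = mobility Z p r \<omega>"
    and "mobility Z p r \<omega> $ j $ k = complex_of_real (jump_covariance Z p r j k) -
      2 * l2_inner p (coord (drift Z r) j)
        (inv_into UNIV (shifted \<omega> (generator r)) (coord (drift Z r) k))"
    and "(\<lambda>s. l2_inner p (coord (drift Z r) j)
      (op_exp (\<lambda>f x. - (complex_of_real s * shifted \<omega> (generator r) f x))
        (coord (drift Z r) k))) absolutely_integrable_on {0..}"
    and "mobility Z p r \<omega> $ j $ k = complex_of_real (jump_covariance Z p r j k) -
      2 * integral {0..} (\<lambda>s. l2_inner p (coord (drift Z r) j)
        (op_exp (\<lambda>f x. - (complex_of_real s * shifted \<omega> (generator r) f x))
          (coord (drift Z r) k)))"
proof -
  have Psi: "Psi Z p r x = - 2 *\<^sub>R drift Z r x" for x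
    unfolding Psi_def drift_def rev by (simp add: scaleR_sum_right algebra_simps sum_negf)
  then show "Psi Z p r x = - 2 *\<^sub>R drift Z r x" .
  have coord_Psi: "coord (Psi Z p r) k = (\<lambda>x. - 2 * coord (drift Z r) k x)" for k
    unfolding coord_def Psi by simp
  have mob: "mobility Z p r \<omega> $ j $ k = complex_of_real (jump_covariance Z p r j k) -
      2 * l2_inner p (coord (drift Z r) j)
        (inv_into UNIV (shifted \<omega> (generator r)) (coord (drift Z r) k))" for j k
  proof -
    have scale: "l2_inner p f (\<lambda>x. c * g x) = c * l2_inner p f g" for f g c
      unfolding l2_inner_def by (simp add: sum_distrib_left mult_ac)
    show ?thesis
      unfolding mobility_def coord_Psi rev inv_shifted_cmult[OF bij_shifted[OF \<omega>_nonzero]] scale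
      by simp
  qed
  then show "mobility Z p r \<omega> $ j $ k = complex_of_real (jump_covariance Z p r j k) -
      2 * l2_inner p (coord (drift Z r) j)
        (inv_into UNIV (shifted \<omega> (generator r)) (coord (drift Z r) k))" .
  have "jump_covariance Z p r j k = jump_covariance Z p r k j" for j k
    unfolding jump_covariance_def by (simp add: mult_ac)
  then show "transpose (mobility Z p r \<omega>) = mobility Z p r \<omega>"
    unfolding vec_eq_iff transpose_def vec_lambda_beta mob
    using resolvent_symmetric[OF rev \<omega>_nonzero] by metis
  \<comment> \<open>The drift has mean zero because \<open>Psi\<close>, which is a multiple of it
    here, has; this is what the resolvent integral requires.\<close>
  have "(\<Sum>x\<in>UNIV. complex_of_real (p x) * coord (drift Z r) k x) = 0"
    using Psi_mean[of k] unfolding coord_Psi by (simp add: sum_distrib_left[symmetric] mult.left_commute sum_negf)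
  from resolvent_integral[OF \<omega>_nonzero this, unfolded evolution_def, of "coord (drift Z r) j"]
  show "(\<lambda>s. l2_inner p (coord (drift Z r) j)
      (op_exp (\<lambda>f x. - (complex_of_real s * shifted \<omega> (generator r) f x))
        (coord (drift Z r) k))) absolutely_integrable_on {0..}"
    and "mobility Z p r \<omega> $ j $ k = complex_of_real (jump_covariance Z p r j k) -
      2 * integral {0..} (\<lambda>s. l2_inner p (coord (drift Z r) j)
        (op_exp (\<lambda>f x. - (complex_of_real s * shifted \<omega> (generator r) f x))
          (coord (drift Z r) k)))"
    unfolding mob by auto
qed

theorem theorem5p3:
  fixes Z :: "(int ^ 'd::finite) set"
    and r :: "('n::finite, 'd) torus \<Rightarrow> ('n, 'd) torus \<Rightarrow> real"
    and \<pi> :: "('n, 'd) torus \<Rightarrow> real"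
    and v :: "real ^ 'd"
    and \<omega> :: real
    and P :: "real \<Rightarrow> real \<Rightarrow> real \<Rightarrow> ('n, 'd) torus \<Rightarrow> ('n, 'd) torus \<Rightarrow> real"
    and \<pi>' :: "real \<Rightarrow> ('n, 'd) torus \<Rightarrow> real"
    and M :: "real \<Rightarrow> 'w measure"
    and X :: "real \<Rightarrow> real \<Rightarrow> 'w \<Rightarrow> ('n, 'd) torus"
    and Y :: "real \<Rightarrow> real \<Rightarrow> 'w \<Rightarrow> int ^ 'd"
  assumes "finite Z"
    and "inj_on (pr :: int ^ 'd \<Rightarrow> ('n, 'd) torus) Z"
    and Z_symmetric: "\<forall>z\<in>Z. - z \<in> Z"
    and "\<forall>x y. 0 \<le> r x y"
    and "\<forall>x. r x x = 0"
    and "\<forall>x y. y \<notin> {x + pr z | z. z \<in> Z} \<longrightarrow> r x y = 0"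
    and "irreducible_rates r"
    and "invariant_distribution r \<pi>"
    and "norm v = 1"
    and "\<omega> \<noteq> 0"
    and "\<forall>l\<ge>0. transition_function (perturbed_rate Z r v \<omega> l) (P l)"
    and "\<forall>l\<ge>0. oscillatory_distribution \<omega> (P l) (\<pi>' l)"
    and "\<forall>l\<ge>0. markov_chain (M l) (P l) (X l)"
    and "\<forall>l\<ge>0. \<forall>x. measure (M l) {w \<in> space (M l). X l 0 w = x} = \<pi>' l x"
    and "\<forall>l\<ge>0. lifted_walk (M l) Z (X l) (Y l)"
  shows
    "(\<forall>t\<ge>0. ((\<lambda>l. mean_velocity (M l) (Y l) t) has_vector_derivative
        (\<chi> j. Re (exp (\<i> * complex_of_real (\<omega> * t)) *
          (mobility Z \<pi> r \<omega> *v (\<chi> k. complex_of_real (v $ k))) $ j)))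
        (at 0 within {0..})) \<and>
     bij (shifted \<omega> (generator (time_reversal \<pi> r))) \<and>
     (\<forall>j k.
        (\<lambda>s. l2_inner \<pi> (coord (drift Z r) j)
           (op_exp (\<lambda>f x. - (complex_of_real s * shifted \<omega> (generator (time_reversal \<pi> r)) f x))
             (coord (Psi Z \<pi> r) k))) absolutely_integrable_on {0..} \<and>
        mobility Z \<pi> r \<omega> $ j $ k = complex_of_real (jump_covariance Z \<pi> r j k) +
          integral {0..} (\<lambda>s. l2_inner \<pi> (coord (drift Z r) j)
           (op_exp (\<lambda>f x. - (complex_of_real s * shifted \<omega> (generator (time_reversal \<pi> r)) f x))
             (coord (Psi Z \<pi> r) k)))) \<and>
     ((\<forall>x y. time_reversal \<pi> r x y = r x y) \<longrightarrow>
        (\<forall>x. Psi Z \<pi> r x = - 2 *\<^sub>R drift Z r x) \<and>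
        generator (time_reversal \<pi> r) = generator r \<and>
        transpose (mobility Z \<pi> r \<omega>) = mobility Z \<pi> r \<omega> \<and>
        (\<forall>j k.
           mobility Z \<pi> r \<omega> $ j $ k = complex_of_real (jump_covariance Z \<pi> r j k) -
             2 * l2_inner \<pi> (coord (drift Z r) j)
               (inv_into UNIV (shifted \<omega> (generator r)) (coord (drift Z r) k)) \<and>
           (\<lambda>s. l2_inner \<pi> (coord (drift Z r) j)
              (op_exp (\<lambda>f x. - (complex_of_real s * shifted \<omega> (generator r) f x))
                (coord (drift Z r) k))) absolutely_integrable_on {0..} \<and>
           mobility Z \<pi> r \<omega> $ j $ k = complex_of_real (jump_covariance Z \<pi> r j k) -
             2 * integral {0..} (\<lambda>s. l2_inner \<pi> (coord (drift Z r) j)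
               (op_exp (\<lambda>f x. - (complex_of_real s * shifted \<omega> (generator r) f x))
                 (coord (drift Z r) k)))))"
proof -
  interpret perturbed_walk r \<pi> Z v \<omega>
    by unfold_locales (use assms in auto)
  have rev_eq: "time_reversal \<pi> r = r" if "\<forall>x y. time_reversal \<pi> r x y = r x y"
    using that by (intro ext) simp
  show ?thesis
  proof (intro conjI allI impI)
    fix t :: real assume "0 \<le> t"
    with assms(11-15) show "((\<lambda>l. mean_velocity (M l) (Y l) t) has_vector_derivative
        (\<chi> j. Re (exp (\<i> * complex_of_real (\<omega> * t)) *
          (mobility Z \<pi> r \<omega> *v (\<chi> k. complex_of_real (v $ k))) $ j))) (at 0 within {0..})"
      by (rule velocity_derivative)
  next
    show "bij (shifted \<omega> (generator (time_reversal \<pi> r)))" by (rule rev.bij_shifted[OF \<omega>_nonzero])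
  qed (fact mobility_integral | erule mobility_reversible[OF rev_eq] | drule rev_eq, simp only:)+
qed

end
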